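(* Let $n\ge 2$ and let $\Omega\subset\mathbb{R}^n$ be a bounded open set with Lipschitz boundary. Let $X_1,X_2\in\mathbb{R}^{n\times n}$, and let $f:\mathbb{R}^{n\times n}\to\mathbb{R}$ be the function $$f(X) := |X-X_1|^2\,|X-X_2|^2 .$$ Let $\sigma_1\ge\sigma_2\ge\cdots\ge\sigma_n\ge 0$ be the singular values of $X_1-X_2$ and assume that $$\sigma_1^2+\sigma_2^2+\cdots+\sigma_n^2\ge 2\sigma_1^2 .$$ Let $y_0\in W^{1,4}(\Omega;\mathbb{R}^n)$ and define, for $y\in W^{1,4}(\Omega;\mathbb{R}^n)$, $$I(y):=\int_\Omega f(\nabla y(x))\,dx .$$ Then the minimization problem $$\min_{y\in W^{1,4}(\Omega;\mathbb{R}^n)} I(y)\quad\text{subject to}\quad y=y_0\ \text{on}\ \partial\Omega$$ admits a solution, and the minimizer is unique.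
   Context: For $X\in\mathbb{R}^{n\times n}$, $|X|^2=\mathrm{tr}(X^TX)$ is the squared Frobenius norm. $W^{1,4}(\Omega;\mathbb{R}^n)$ is the Sobolev space of $\mathbb{R}^n$-valued functions on $\Omega$ that belong to $L^4$ together with their weak first derivatives; $\nabla y(x)\in\mathbb{R}^{n\times n}$ is the weak gradient. The boundary condition $y=y_0$ on $\partial\Omega$ is understood in the sense of traces, i.e. $y-y_0\in W^{1,4}_0(\Omega;\mathbb{R}^n)$. Uniqueness is as an element of $W^{1,4}(\Omega;\mathbb{R}^n)$ (i.e. up to equality almost everywhere). *)

theory Defs
  imports "HOL-Analysis.Analysis"
begin

definition frobenius_sq :: "real^'n^'n \<Rightarrow> real" where
  "frobenius_sq X = trace (transpose X ** X)"

text \<open>The singular values are the square roots of the eigenvalues of \<open>A\<^sup>T A\<close>, repeated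
  according to multiplicity, that is, as roots of the characteristic polynomial. They are listed
  in decreasing order with indices \<open>1, \<dots>, n\<close>; values of \<open>\<sigma>\<close> at other indices are irrelevant.\<close>

definition are_singular_values :: "real^'n^'n \<Rightarrow> (nat \<Rightarrow> real) \<Rightarrow> bool" where
  "are_singular_values A \<sigma> \<longleftrightarrow>
     antimono_on {1..CARD('n)} \<sigma> \<and> (\<forall>i\<in>{1..CARD('n)}. 0 \<le> \<sigma> i) \<and>
     (\<forall>t::real. det (t *\<^sub>R mat 1 - transpose A ** A) = (\<Prod>i=1..CARD('n). t - (\<sigma> i)\<^sup>2))"

text \<open>Near each boundary point the set is the strict epigraph of a Lipschitz function in rotated
  coordinates: \<open>\<nu>\<close> is the vertical direction, and the horizontal coordinates of \<open>z\<close> are given by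
  its orthogonal projection onto the hyperplane orthogonal to \<open>\<nu>\<close>.\<close>

definition lipschitz_boundary :: "'a::euclidean_space set \<Rightarrow> bool" where
  "lipschitz_boundary \<Omega> \<longleftrightarrow>
     (\<forall>x\<in>frontier \<Omega>. \<exists>r>0. \<exists>\<nu>. \<exists>\<gamma>::'a \<Rightarrow> real. \<exists>L.
        norm \<nu> = 1 \<and> L-lipschitz_on {v. v \<bullet> \<nu> = 0} \<gamma> \<and>
        \<Omega> \<inter> ball x r = {z \<in> ball x r. \<gamma> (z - (z \<bullet> \<nu>) *\<^sub>R \<nu>) < z \<bullet> \<nu>})"

definition partial_deriv :: "'n \<Rightarrow> (real^'n \<Rightarrow> real) \<Rightarrow> real^'n \<Rightarrow> real" where
  "partial_deriv j \<phi> x = frechet_derivative \<phi> (at x) (axis j 1)"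

primrec C_k :: "nat \<Rightarrow> (real^'n \<Rightarrow> real) \<Rightarrow> bool" where
  "C_k 0 \<phi> \<longleftrightarrow> continuous_on UNIV \<phi>"
| "C_k (Suc k) \<phi> \<longleftrightarrow> (\<forall>x. \<phi> differentiable at x) \<and> (\<forall>j. C_k k (partial_deriv j \<phi>))"

definition test_function :: "(real^'n) set \<Rightarrow> (real^'n \<Rightarrow> real) \<Rightarrow> bool" where
  "test_function \<Omega> \<phi> \<longleftrightarrow> (\<forall>k. C_k k \<phi>) \<and>
     compact (closure {x. \<phi> x \<noteq> 0}) \<and> closure {x. \<phi> x \<noteq> 0} \<subseteq> \<Omega>"

text \<open>Functions on \<open>\<Omega>\<close> are represented by total functions whose values outside \<open>\<Omega>\<close> are
  irrelevant; they are not quotiented by equality almost everywhere.\<close>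

definition locally_integrable ::
    "(real^'n) set \<Rightarrow> (real^'n \<Rightarrow> 'b::euclidean_space) \<Rightarrow> bool" where
  "locally_integrable \<Omega> g \<longleftrightarrow>
     (\<forall>K. compact K \<and> K \<subseteq> \<Omega> \<longrightarrow> set_integrable lebesgue K g)"

definition L_p :: "real \<Rightarrow> (real^'n) set \<Rightarrow> (real^'n \<Rightarrow> 'b::euclidean_space) set" where
  "L_p p \<Omega> = {g \<in> borel_measurable (lebesgue_on \<Omega>).
                integrable (lebesgue_on \<Omega>) (\<lambda>x. norm (g x) powr p)}"

text \<open>Row \<open>i\<close>, column \<open>j\<close> of the gradient is the derivative of component \<open>i\<close> in direction \<open>j\<close>.\<close>

definition has_weak_gradient ::
    "(real^'n) set \<Rightarrow> (real^'n \<Rightarrow> real^'n) \<Rightarrow> (real^'n \<Rightarrow> real^'n^'n) \<Rightarrow> bool" where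
  "has_weak_gradient \<Omega> y G \<longleftrightarrow>
     locally_integrable \<Omega> y \<and> locally_integrable \<Omega> G \<and>
     (\<forall>\<phi> i j. test_function \<Omega> \<phi> \<longrightarrow>
        (LINT x|lebesgue_on \<Omega>. y x $ i * partial_deriv j \<phi> x) =
        - (LINT x|lebesgue_on \<Omega>. G x $ i $ j * \<phi> x))"

text \<open>The weak gradient is unique up to equality almost everywhere, so the choice of
  representative does not affect the integrals below.\<close>

definition weak_gradient ::
    "(real^'n) set \<Rightarrow> (real^'n \<Rightarrow> real^'n) \<Rightarrow> real^'n \<Rightarrow> real^'n^'n" where
  "weak_gradient \<Omega> y = (SOME G. has_weak_gradient \<Omega> y G)"

definition W1p :: "real \<Rightarrow> (real^'n) set \<Rightarrow> (real^'n \<Rightarrow> real^'n) set" where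
  "W1p p \<Omega> = {y \<in> L_p p \<Omega>. \<exists>G \<in> L_p p \<Omega>. has_weak_gradient \<Omega> y G}"

definition W1p_norm :: "real \<Rightarrow> (real^'n) set \<Rightarrow> (real^'n \<Rightarrow> real^'n) \<Rightarrow> real" where
  "W1p_norm p \<Omega> y =
     ((LINT x|lebesgue_on \<Omega>. norm (y x) powr p) +
      (LINT x|lebesgue_on \<Omega>. norm (weak_gradient \<Omega> y x) powr p)) powr (1 / p)"

text \<open>The closure of the \<open>\<real>\<^sup>n\<close>-valued test functions in the Sobolev norm.\<close>

definition W1p_0 :: "real \<Rightarrow> (real^'n) set \<Rightarrow> (real^'n \<Rightarrow> real^'n) set" where
  "W1p_0 p \<Omega> = {y \<in> W1p p \<Omega>. \<exists>\<phi>::nat \<Rightarrow> real^'n \<Rightarrow> real^'n.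
     (\<forall>k i. test_function \<Omega> (\<lambda>x. \<phi> k x $ i)) \<and>
     (\<lambda>k. W1p_norm p \<Omega> (\<lambda>x. y x - \<phi> k x)) \<longlonglongrightarrow> 0}"

definition is_minimizer_on :: "('a \<Rightarrow> real) \<Rightarrow> 'a set \<Rightarrow> 'a \<Rightarrow> bool" where
  "is_minimizer_on I S y \<longleftrightarrow> y \<in> S \<and> (\<forall>z\<in>S. I y \<le> I z)"

end

theory Submission
  imports Defs
begin

text \<open>
  Let \<open>A\<close> be half the difference of the wells and let \<open>Z\<close> be \<open>X\<close> minus their midpoint. Then
  \<open>f X = |Z| ^ 4 + 2 * q Z + |A| ^ 4\<close> with the quadratic form \<open>q Z = |A|\<^sup>2 * |Z|\<^sup>2 - 2 * (A \<bullet> Z)\<^sup>2\<close>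
  (\<open>two_well_product_eq\<close>). The quartic part is uniformly convex. The form \<open>q\<close> can be negative,
  but its integral over the gradient of any \<open>u\<close> in \<open>W\<^sup>1\<^sup>,\<^sup>4\<^sub>0\<close> is nonnegative
  (\<open>two_well_form_W1p_0_nonneg\<close>). Indeed, if \<open>D\<close> is the gradient of a test function, integrals of products of first
  derivatives do not change when the two differentiation indices are exchanged
  (\<open>integral_partial_swap\<close>). Hence \<open>(A \<bullet> D)\<^sup>2\<close> has the same integral as the trace of the square of \<open>D A\<^sup>T\<close>. This is
  at most \<open>|D A\<^sup>T|\<^sup>2\<close>, hence at most \<open>|D|\<^sup>2\<close> times the square of the largest singular value of \<open>A\<close>. As
  \<open>|A|\<^sup>2\<close> is the sum of the squared singular values, the hypothesis is exactly what makes
  \<open>2 * |D A\<^sup>T|\<^sup>2 \<le> |A|\<^sup>2 * |D|\<^sup>2\<close>.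

  Two functions with the same boundary values differ by an element of \<open>W\<^sup>1\<^sup>,\<^sup>4\<^sub>0\<close>, so
  \<open>I ((y + z) / 2) + \<integral> |\<nabla> (y - z) / 2| ^ 4 \<le> (I y + I z) / 2\<close> (\<open>two_well_energy_midpoint\<close>). Therefore a
  minimizing sequence is a Cauchy sequence for the gradients in \<open>L\<^sup>4\<close>, and by the Poincare inequality
  (\<open>poincare_W1p_0\<close>) also for the functions. It converges strongly, and Fatou's lemma identifies the limit as a
  minimizer. Applied to two minimizers, the same inequality shows that they coincide almost
  everywhere.

  The rest is the part of Sobolev space theory that this argument rests on: weak gradients are
  unique almost everywhere by the fundamental lemma of the calculus of variations, integration by
  parts and the exchange of indices come from translation invariance of Lebesgue measure,
  and \<open>L\<^sup>4\<close> is complete.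
\<close>

section \<open>Singular values\<close>

lemma frobenius_sq_eq_norm: "frobenius_sq (X::real^'n^'n) = (norm X)\<^sup>2"
proof -
  have "frobenius_sq X = (\<Sum>i\<in>UNIV. \<Sum>k\<in>UNIV. X$k$i * X$k$i)"
    by (simp add: frobenius_sq_def trace_def matrix_matrix_mult_def transpose_def)
  also have "\<dots> = (\<Sum>k\<in>UNIV. \<Sum>i\<in>UNIV. X$k$i * X$k$i)" by (rule sum.swap)
  also have "\<dots> = X \<bullet> X" by (simp add: inner_vec_def)
  finally show ?thesis by (simp add: power2_norm_eq_inner)
qed

text \<open>In the Leibniz expansion only the identity permutation contributes to first order, and its product
  has derivative minus the sum of the diagonal entries.\<close>

lemma det_perturbed_identity_has_derivative:
  fixes S :: "real^'n^'n"
  shows "((\<lambda>s. det (mat 1 - s *\<^sub>R S)) has_real_derivative - trace S) (at 0)"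
proof -
  define e :: "('n \<Rightarrow> 'n) \<Rightarrow> 'n \<Rightarrow> real \<Rightarrow> real"
    where "e p i s = (if i = p i then 1 else 0) - s * S $ i $ p i" for p i s
  have det_e: "det (mat 1 - s *\<^sub>R S) = (\<Sum>p | p permutes UNIV. of_int (sign p) * (\<Prod>i\<in>UNIV. e p i s))" for s
    by (simp add: det_def e_def mat_def)
  have de: "(e p i has_real_derivative - S $ i $ p i) (at 0)" for p i
    unfolding e_def by (auto intro!: derivative_eq_intros)
  have dp: "((\<lambda>s. \<Prod>i\<in>UNIV. e p i s) has_real_derivative
      (\<Sum>i\<in>UNIV. (- S $ i $ p i) * (\<Prod>j\<in>UNIV - {i}. e p j 0))) (at 0)" for p
    by (rule has_field_derivative_prod[OF de])
  \<comment> \<open>A permutation other than the identity moves two points, so its product has a double zero at \<open>0\<close>.\<close>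
  have zero: "(\<Sum>i\<in>UNIV. (- S $ i $ p i) * (\<Prod>j\<in>UNIV - {i}. e p j 0)) = 0"
    if p: "p permutes UNIV" "p \<noteq> id" for p
  proof -
    obtain a where a: "p a \<noteq> a" using p(2) by (metis eq_id_iff)
    have b: "p (p a) \<noteq> p a" using a permutes_inj[OF p(1)] by (metis injD)
    have "(\<Prod>j\<in>UNIV - {i}. e p j 0) = 0" for i
    proof (cases "i = a")
      case True
      then have "p a \<in> UNIV - {i}" using a by auto
      moreover have "e p (p a) 0 = 0" using b by (simp add: e_def)
      ultimately show ?thesis by (meson finite prod_zero)
    next
      case False
      then have "a \<in> UNIV - {i}" by auto
      moreover have "e p a 0 = 0" using a by (simp add: e_def)
      ultimately show ?thesis by (meson finite prod_zero)
    qed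
    then show ?thesis by (simp only: mult_zero_right sum.neutral_const)
  qed
  have "((\<lambda>s. \<Sum>p | p permutes UNIV. of_int (sign p) * (\<Prod>i\<in>UNIV. e p i s)) has_real_derivative
      (\<Sum>p | p permutes UNIV. of_int (sign p) * (\<Sum>i\<in>UNIV. (- S $ i $ p i) * (\<Prod>j\<in>UNIV - {i}. e p j 0)))) (at 0)"
    by (intro DERIV_sum DERIV_cmult dp)
  also have "(\<Sum>p | p permutes UNIV. of_int (sign p) * (\<Sum>i\<in>UNIV. (- S $ i $ p i) * (\<Prod>j\<in>UNIV - {i}. e p j 0)))
     = (\<Sum>p\<in>{id}. of_int (sign p) * (\<Sum>i\<in>UNIV. (- S $ i $ p i) * (\<Prod>j\<in>UNIV - {i}. e p j 0)))"
  proof (rule sum.mono_neutral_right)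
    show "\<forall>p\<in>{p. p permutes UNIV} - {id}. of_int (sign p) *
        (\<Sum>i\<in>UNIV. (- S $ i $ p i) * (\<Prod>j\<in>UNIV - {i}. e p j 0)) = 0"
      proof
      fix p :: "'n \<Rightarrow> 'n" assume "p \<in> {p. p permutes UNIV} - {id}"
      then have "p permutes UNIV" "p \<noteq> id" by auto
      from zero[OF this] show "of_int (sign p) *
        (\<Sum>i\<in>UNIV. (- S $ i $ p i) * (\<Prod>j\<in>UNIV - {i}. e p j 0)) = 0"
        by (simp only: mult_zero_right)
    qed
  qed (auto simp: permutes_id finite_permutations)
  also have "\<dots> = - trace S"
    by (simp add: e_def trace_def sum_negf)
  finally show ?thesis unfolding det_e .
qed

text \<open>Substituting \<open>1 / s\<close> for the variable of the characteristic polynomial and differentiating at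
  \<open>s = 0\<close> reads off the trace of \<open>A\<^sup>T A\<close> on one side and the sum of the roots on the other.\<close>

lemma sum_squares_singular_values:
  fixes A :: "real^'n^'n"
  assumes "are_singular_values A \<sigma>"
  shows "(\<Sum>i=1..CARD('n). (\<sigma> i)\<^sup>2) = (norm A)\<^sup>2"
proof -
  let ?S = "transpose A ** A"
  let ?N = "{1..CARD('n)}"
  \<comment> \<open>The characteristic polynomial at \<open>1 / s\<close>, multiplied by \<open>s\<close> to the power of the dimension;
    both sides are polynomials in \<open>s\<close> with value \<open>1\<close> at \<open>0\<close>.\<close>
  have eq: "det (mat 1 - s *\<^sub>R ?S) = (\<Prod>i\<in>?N. 1 - s * (\<sigma> i)\<^sup>2)" for s
  proof (cases "s = 0")
    case False
    have m: "mat 1 - s *\<^sub>R ?S = s *\<^sub>R ((1/s) *\<^sub>R mat 1 - ?S)"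
      using False by (simp add: scaleR_diff_right)
    have "det (s *\<^sub>R ((1/s) *\<^sub>R mat 1 - ?S)) = s ^ CARD('n) * det ((1/s) *\<^sub>R mat 1 - ?S)"
    proof -
      have "(\<chi> i. s *s (M $ i)) = s *\<^sub>R M" "(\<chi> i. M $ i) = M" for M :: "real^'n^'n"
        by (simp_all add: vec_eq_iff)
      then show ?thesis
        using det_rows_mul[of "\<lambda>_. s" "\<lambda>i. ((1/s) *\<^sub>R mat 1 - ?S) $ i"] by (simp only: prod_constant)
    qed
    also have "\<dots> = (\<Prod>i\<in>?N. s) * (\<Prod>i\<in>?N. 1/s - (\<sigma> i)\<^sup>2)"
      using assms by (simp add: are_singular_values_def)
    also have "\<dots> = (\<Prod>i\<in>?N. 1 - s * (\<sigma> i)\<^sup>2)"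
      unfolding prod.distrib[symmetric] using False by (intro prod.cong) (auto simp: field_simps)
    finally show ?thesis unfolding m .
  qed simp
  have "((\<lambda>s. \<Prod>i\<in>?N. 1 - s * (\<sigma> i)\<^sup>2) has_real_derivative
      (\<Sum>i\<in>?N. (- (\<sigma> i)\<^sup>2) * (\<Prod>j\<in>?N - {i}. 1 - 0 * (\<sigma> j)\<^sup>2))) (at 0)"
    by (rule has_field_derivative_prod) (auto intro!: derivative_eq_intros)
  moreover have "((\<lambda>s. \<Prod>i\<in>?N. 1 - s * (\<sigma> i)\<^sup>2) has_real_derivative - trace ?S) (at 0)"
    using det_perturbed_identity_has_derivative[of ?S] unfolding eq .
  ultimately have "(\<Sum>i\<in>?N. (- (\<sigma> i)\<^sup>2)) = - trace ?S"
    using DERIV_unique by fastforce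
  then show ?thesis
    using frobenius_sq_eq_norm[of A] by (simp add: sum_negf frobenius_sq_def)
qed

text \<open>The maximum of \<open>|A w|\<^sup>2\<close> on the unit sphere is attained at an eigenvector of \<open>A\<^sup>T A\<close>, so the
  maximal value is a root of the characteristic polynomial and thus one of the \<open>\<sigma>\<^sub>i\<^sup>2\<close>.\<close>

lemma norm_mult_le_largest_singular_value:
  fixes A :: "real^'n^'n"
  assumes "are_singular_values A \<sigma>"
  shows "(norm (A *v z))\<^sup>2 \<le> (\<sigma> 1)\<^sup>2 * (norm z)\<^sup>2"
proof -
  let ?S = "transpose A ** A"
  let ?q = "\<lambda>z. (norm (A *v z))\<^sup>2"
  have q: "?q z = z \<bullet> (?S *v z)" for z
    by (metis dot_lmul_matrix matrix_vector_mul_assoc power2_norm_eq_inner vector_transpose_matrix transpose_matrix_vector)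
  have "continuous_on (sphere 0 1) ?q"
    by (intro continuous_intros linear_continuous_on matrix_vector_mul_bounded_linear)
  moreover have "sphere (0::real^'n) 1 \<noteq> {}" by simp
  ultimately obtain u where u: "norm u = 1" and umax: "\<And>w. norm w = 1 \<Longrightarrow> ?q w \<le> ?q u"
    using continuous_attains_sup[of "sphere 0 1" ?q] compact_sphere by auto
  define l where "l = ?q u"
  have le: "?q w \<le> l * (norm w)\<^sup>2" for w
  proof (cases "w = 0")
    case False
    have "?q ((1 / norm w) *\<^sub>R w) \<le> l" unfolding l_def using False by (intro umax) simp
    then show ?thesis using False
      by (simp add: matrix_vector_mult_scaleR power_mult_distrib power_divide field_simps)
  qed simp
  have sym: "(?S *v u) \<bullet> v = u \<bullet> (?S *v v)" for v
    by (metis dot_lmul_matrix matrix_transpose_mul transpose_matrix_vector transpose_transpose)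
  \<comment> \<open>The form \<open>l * (w \<bullet> w) - w \<bullet> (?S *v w)\<close> is nonnegative and vanishes at \<open>u\<close>,
    so its first variation at \<open>u\<close> vanishes and \<open>u\<close> is an eigenvector.\<close>
  have "(l *\<^sub>R u - ?S *v u) \<bullet> v = 0" for v
  proof -
    define b where "b = (l *\<^sub>R u - ?S *v u) \<bullet> v"
    define c where "c = l * (v \<bullet> v) - ?q v"
    have "0 \<le> 2 * t * b + t\<^sup>2 * c" for t
    proof -
      have "(u + t *\<^sub>R v) \<bullet> (?S *v (u + t *\<^sub>R v))
          = u \<bullet> (?S *v u) + 2 * t * ((?S *v u) \<bullet> v) + t\<^sup>2 * (v \<bullet> (?S *v v))"
        unfolding matrix_vector_right_distrib matrix_vector_mult_scaleR
        using sym[of v]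
        by (simp add: inner_add_left inner_add_right algebra_simps power2_eq_square inner_commute)
      then have "?q (u + t *\<^sub>R v) = l + 2 * t * ((?S *v u) \<bullet> v) + t\<^sup>2 * ?q v"
        unfolding q l_def .
      moreover have "(norm (u + t *\<^sub>R v))\<^sup>2 = 1 + 2 * t * (u \<bullet> v) + t\<^sup>2 * (v \<bullet> v)"
        unfolding power2_norm_eq_inner using u
        by (simp add: inner_add_left inner_add_right algebra_simps power2_eq_square inner_commute norm_eq_1)
      ultimately show ?thesis
        using le[of "u + t *\<^sub>R v"] unfolding b_def c_def
        by (simp add: inner_diff_left algebra_simps)
    qed
    have c: "0 \<le> c" using le[of v] by (simp add: c_def power2_norm_eq_inner)
    have "b = 0"
    proof (rule ccontr)
      assume "b \<noteq> 0"
      \<comment> \<open>Up to replacing \<open>c\<close> by \<open>c + 1 > 0\<close>, this is the minimum of the quadratic polynomial.\<close>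
      define t where "t = - b / (c + 1)"
      have tb: "t * (c + 1) = - b" using c by (simp add: t_def)
      have "2 * t * b + t\<^sup>2 * c \<le> 2 * t * b + t * (t * (c + 1))"
        by (simp add: power2_eq_square algebra_simps)
      also have "\<dots> = - (b\<^sup>2 / (c + 1))" unfolding tb by (simp add: t_def power2_eq_square)
      also have "\<dots> < 0" using c \<open>b \<noteq> 0\<close> by simp
      finally show False using \<open>0 \<le> 2 * t * b + t\<^sup>2 * c\<close> by (simp only: prod_constant)
    qed
    then show ?thesis by (simp add: b_def)
  qed
  then have "l *\<^sub>R u - ?S *v u = 0" by (metis inner_eq_zero_iff)
  then have "(l *\<^sub>R mat 1 - ?S) *v u = 0"
    by (simp add: matrix_vector_mult_diff_rdistrib scaleR_matrix_vector_assoc[symmetric])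
  moreover have "u \<noteq> 0" using u by auto
  ultimately have "det (l *\<^sub>R mat 1 - ?S) = 0"
    by (metis invertible_det_nz matrix_left_invertible_ker invertible_left_inverse)
  then have "(\<Prod>i=1..CARD('n). l - (\<sigma> i)\<^sup>2) = 0"
    using assms by (simp add: are_singular_values_def)
  then obtain i where i: "i \<in> {1..CARD('n)}" "l = (\<sigma> i)\<^sup>2" by auto
  have "0 \<le> \<sigma> i" "\<sigma> i \<le> \<sigma> 1"
    using assms i(1) unfolding are_singular_values_def monotone_on_def by auto
  then have "l \<le> (\<sigma> 1)\<^sup>2" using i by (simp add: power_mono)
  then show ?thesis using le[of z] by (meson mult_right_mono order_trans zero_le_power2)
qed

text \<open>The hypothesis on the singular values, brought into the form that makes the two-well quadratic form
  nonnegative after integration.\<close>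

lemma singular_values_imp_well_condition:
  fixes X :: "real^'n^'n"
  assumes \<sigma>: "are_singular_values X \<sigma>" and ge: "(\<Sum>i=1..CARD('n). (\<sigma> i)\<^sup>2) \<ge> 2 * (\<sigma> 1)\<^sup>2"
  shows "2 * (norm (X *v z))\<^sup>2 \<le> (norm X)\<^sup>2 * (norm z)\<^sup>2"
proof -
  have "2 * (norm (X *v z))\<^sup>2 \<le> (2 * (\<sigma> 1)\<^sup>2) * (norm z)\<^sup>2"
    using norm_mult_le_largest_singular_value[OF \<sigma>, of z] by simp
  also have "\<dots> \<le> (norm X)\<^sup>2 * (norm z)\<^sup>2"
    using ge unfolding sum_squares_singular_values[OF \<sigma>] by (rule mult_right_mono) simp
  finally show ?thesis .
qed

lemma norm_transpose: "norm (transpose B) = norm (B::real^'n^'n)"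
proof -
  have "(transpose B) \<bullet> (transpose B) = B \<bullet> B"
    unfolding inner_vec_def transpose_def vec_lambda_beta by (rule sum.swap)
  then show ?thesis by (simp add: norm_eq_sqrt_inner)
qed

text \<open>Row \<open>i\<close> of \<open>Z A\<^sup>T\<close> is \<open>A\<close> applied to row \<open>i\<close> of \<open>Z\<close>.\<close>

lemma norm_matrix_mult_transpose_le:
  fixes A Z :: "real^'n^'n"
  assumes "\<And>z. (norm (A *v z))\<^sup>2 \<le> c * (norm z)\<^sup>2"
  shows "(norm (Z ** transpose A))\<^sup>2 \<le> c * (norm Z)\<^sup>2"
proof -
  have n: "(norm (M::real^'n^'n))\<^sup>2 = (\<Sum>i\<in>UNIV. (norm (M$i))\<^sup>2)" for M
    by (simp add: power2_norm_eq_inner inner_vec_def)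
  have "(Z ** transpose A) $ i = A *v (Z $ i)" for i
    by (simp add: vec_eq_iff matrix_matrix_mult_def matrix_vector_mult_def transpose_def mult.commute)
  then show ?thesis unfolding n using assms by (simp add: sum_distrib_left sum_mono)
qed

lemma bounded_linear_entry: "bounded_linear (\<lambda>A::real^'n^'n. A $ i $ j)"
  by (rule bounded_linear_compose[OF bounded_linear_vec_nth bounded_linear_vec_nth])

section \<open>Inequalities for fourth powers\<close>

lemma le_one_plus_power4: "(t::real) \<le> 1 + t ^ 4"
proof (cases "t \<le> 1")
  case False
  then show ?thesis using power_increasing[of 1 4 t] by simp
qed (simp add: add_increasing2)

lemma power2_le_one_plus_power4: "(t::real)\<^sup>2 \<le> 1 + t ^ 4"
proof -
  have "2 * t\<^sup>2 \<le> 1 + t ^ 4"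
    using zero_le_power2[of "t\<^sup>2 - 1"] by (simp add: power2_eq_square power4_eq_xxxx algebra_simps)
  then show ?thesis using zero_le_power2[of t] by linarith
qed

lemma norm_add_power4_le:
  fixes a b :: "'b::real_normed_vector"
  shows "norm (a + b) ^ 4 \<le> 8 * (norm a ^ 4 + norm b ^ 4)"
proof -
  have sq: "(s + t)\<^sup>2 \<le> 2 * (s\<^sup>2 + t\<^sup>2)" for s t :: real
    using zero_le_power2[of "s - t"] by (simp add: power2_eq_square algebra_simps)
  have "norm (a + b) ^ 4 \<le> (norm a + norm b) ^ 4"
    by (intro power_mono norm_triangle_ineq) simp
  also have "\<dots> = ((norm a + norm b)\<^sup>2)\<^sup>2" by simp
  also have "\<dots> \<le> (2 * ((norm a)\<^sup>2 + (norm b)\<^sup>2))\<^sup>2" by (intro power_mono sq) simp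
  also have "\<dots> = 4 * ((norm a)\<^sup>2 + (norm b)\<^sup>2)\<^sup>2"
    by (simp only: power_mult_distrib) simp
  also have "\<dots> \<le> 4 * (2 * (((norm a)\<^sup>2)\<^sup>2 + ((norm b)\<^sup>2)\<^sup>2))" by (intro mult_left_mono sq) simp
  finally show ?thesis by simp
qed

lemma norm_power4_le_sum:
  fixes v :: "real^'n"
  shows "norm v ^ 4 \<le> CARD('n) * (\<Sum>i\<in>UNIV. (v $ i) ^ 4)"
proof -
  have "norm v ^ 4 = (v \<bullet> v)\<^sup>2" by (simp add: power2_norm_eq_inner[symmetric])
  also have "\<dots> = (\<Sum>i\<in>UNIV. (v $ i)\<^sup>2)\<^sup>2" by (simp add: inner_vec_def power2_eq_square)
  also have "\<dots> \<le> CARD('n) * (\<Sum>i\<in>UNIV. ((v $ i)\<^sup>2)\<^sup>2)"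
    using sum_squared_le_sum_of_squares[of "\<lambda>i. (v $ i)\<^sup>2" UNIV] by (simp add: mult.commute)
  finally show ?thesis by simp
qed

text \<open>Clarkson's inequality for exponent \<open>4\<close>: by the parallelogram law the squares \<open>p\<close> and \<open>q\<close> of the two
  norms on the left add up to the mean of \<open>|Z|\<^sup>2\<close> and \<open>|W|\<^sup>2\<close>, and \<open>p\<^sup>2 + q\<^sup>2 \<le> (p + q)\<^sup>2\<close>.\<close>

lemma norm_power4_midpoint:
  fixes Z W :: "'b::real_inner"
  shows "norm ((1/2) *\<^sub>R (Z + W)) ^ 4 + norm ((1/2) *\<^sub>R (Z - W)) ^ 4 \<le> (norm Z ^ 4 + norm W ^ 4) / 2"
proof -
  define p q z w where "p = (norm ((1/2) *\<^sub>R (Z + W)))\<^sup>2" "q = (norm ((1/2) *\<^sub>R (Z - W)))\<^sup>2"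
    "z = (norm Z)\<^sup>2" "w = (norm W)\<^sup>2"
  have pq: "p + q = (z + w) / 2"
    unfolding p_q_z_w_def power2_norm_eq_inner
    by (simp add: inner_add_left inner_add_right inner_diff_left inner_diff_right inner_commute field_simps)
  have "0 \<le> p" "0 \<le> q" by (simp_all add: p_q_z_w_def)
  then have "p\<^sup>2 + q\<^sup>2 \<le> (p + q)\<^sup>2" by (simp add: power2_sum)
  also have "\<dots> = ((z + w) / 2)\<^sup>2" by (simp only: pq)
  also have "\<dots> \<le> (z\<^sup>2 + w\<^sup>2) / 2"
    using zero_le_power2[of "z - w"] by (simp add: power2_eq_square field_simps)
  finally show ?thesis by (simp add: p_q_z_w_def)
qed

text \<open>Splits the mixed term of the Poincare inequality so that half of \<open>a ^ 4\<close> can be absorbed.\<close>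

lemma young_cubic:
  fixes a b r :: real
  assumes "0 \<le> a" "0 \<le> b" "0 < r"
  shows "4 * r * (a ^ 3 * b) \<le> a ^ 4 / 2 + 4 * r * (8 * r) ^ 3 * b ^ 4"
proof (cases "8 * r * b \<le> a")
  case True
  have "4 * r * (a ^ 3 * b) = a ^ 3 * (8 * r * b) / 2" by simp
  also have "\<dots> \<le> a ^ 3 * a / 2" using assms True by (intro divide_right_mono mult_left_mono) auto
  also have "\<dots> = a ^ 4 / 2" by (simp add: power4_eq_xxxx power3_eq_cube)
  finally show ?thesis using assms by (simp add: add_increasing2)
next
  case False
  then have "a ^ 3 \<le> (8 * r * b) ^ 3" using assms by (intro power_mono) auto
  then have "4 * r * (a ^ 3 * b) \<le> 4 * r * ((8 * r * b) ^ 3 * b)"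
    using assms by (intro mult_left_mono mult_right_mono) auto
  also have "\<dots> = 4 * r * (8 * r) ^ 3 * b ^ 4"
    by (simp add: power_mult_distrib power4_eq_xxxx power3_eq_cube)
  finally show ?thesis by (simp add: add_increasing)
qed

text \<open>The error made in the quadratic form when a gradient \<open>Z\<close> is perturbed by \<open>D\<close> has size
  \<open>2 * |Z| * |D| + |D|\<^sup>2\<close>; it is bounded here by a small multiple of an integrable function plus a
  large multiple of \<open>|D| ^ 4\<close>, which approximation makes small.\<close>

lemma young_square:
  fixes z d e :: real
  assumes e: "0 < e" and "0 \<le> z" "0 \<le> d"
  shows "2 * (z * d) + d\<^sup>2 \<le> e * (2 + z ^ 4) + (1 + 1 / e)\<^sup>2 / e * d ^ 4"
proof -
  have "2 * (z * d) \<le> e * z\<^sup>2 + d\<^sup>2 / e"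
  proof -
    have "0 \<le> (e * z - d)\<^sup>2 / e" using e by simp
    also have "\<dots> = e * z\<^sup>2 + d\<^sup>2 / e - 2 * (z * d)" using e by (simp add: field_simps power2_eq_square)
    finally show ?thesis by simp
  qed
  moreover have "e * z\<^sup>2 \<le> e * (1 + z ^ 4)"
  proof (rule mult_left_mono)
    show "z\<^sup>2 \<le> 1 + z ^ 4" by (rule power2_le_one_plus_power4)
  qed (use e in simp)
  moreover have "(1 + 1 / e) * d\<^sup>2 \<le> e + (1 + 1 / e)\<^sup>2 / e * d ^ 4"
  proof -
    \<comment> \<open>The remaining quadratic term in \<open>d\<close> is absorbed by its square and the constant \<open>e\<close>.\<close>
    define t where "t = (1 + 1 / e) * d\<^sup>2"
    have t: "0 \<le> t" using e by (simp add: t_def)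
    have "0 \<le> (e - t)\<^sup>2 / e" using e by simp
    also have "\<dots> = e + t\<^sup>2 / e - 2 * t" using e by (simp add: field_simps power2_eq_square)
    finally have "t \<le> e + t\<^sup>2 / e" using t by simp
    also have "t\<^sup>2 / e = (1 + 1 / e)\<^sup>2 / e * d ^ 4" by (simp add: t_def power_mult_distrib)
    finally show ?thesis by (simp add: t_def)
  qed
  ultimately show ?thesis by (simp add: algebra_simps)
qed

lemma geometric_tendsto_zero: "(\<lambda>k. (c::real) * (1/4) ^ k) \<longlonglongrightarrow> 0"
  using tendsto_mult_right_zero[OF LIMSEQ_power_zero[of "1/4::real"], of c] by simp

section \<open>Smooth functions\<close>

lemma partial_deriv_eq:
  assumes "(\<phi> has_derivative D) (at x)"
  shows "partial_deriv j \<phi> x = D (axis j 1)"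
  using frechet_derivative_at[OF assms] by (simp add: partial_deriv_def)

lemma has_derivative_partial:
  "\<phi> differentiable at x \<Longrightarrow> (\<phi> has_derivative frechet_derivative \<phi> (at x)) (at x)"
  using frechet_derivative_works by blast

lemma C_k_Suc_imp: "C_k (Suc k) \<phi> \<Longrightarrow> C_k k \<phi>"
proof (induction k arbitrary: \<phi>)
  case 0
  then show ?case by (simp add: continuous_on_eq_continuous_at differentiable_imp_continuous_within)
next
  case (Suc k)
  have "C_k k (partial_deriv j \<phi>)" for j
    using Suc.prems by (intro Suc.IH) simp
  then show ?case using Suc.prems by simp
qed

lemma C_k_const: "C_k k (\<lambda>_::real^'n. c)"
proof (induction k arbitrary: c)
  case (Suc k)
  have "partial_deriv j (\<lambda>_::real^'n. c) = (\<lambda>_. 0)" for j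
    by (rule ext) (rule partial_deriv_eq[OF has_derivative_const])
  then show ?case using Suc by simp
qed simp

lemma partial_deriv_add:
  assumes "\<phi> differentiable at x" "\<psi> differentiable at x"
  shows "partial_deriv j (\<lambda>x. \<phi> x + \<psi> x) x = partial_deriv j \<phi> x + partial_deriv j \<psi> x"
  using partial_deriv_eq[OF has_derivative_add[OF assms[THEN has_derivative_partial]]]
  by (simp add: partial_deriv_def)

lemma partial_deriv_mult:
  assumes "\<phi> differentiable at x" "\<psi> differentiable at x"
  shows "partial_deriv j (\<lambda>x. \<phi> x * \<psi> x) x = \<phi> x * partial_deriv j \<psi> x + partial_deriv j \<phi> x * \<psi> x"
  using partial_deriv_eq[OF has_derivative_mult[OF assms[THEN has_derivative_partial]]]
  by (simp add: partial_deriv_def)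

lemma C_k_add: "C_k k \<phi> \<Longrightarrow> C_k k \<psi> \<Longrightarrow> C_k k (\<lambda>x. \<phi> x + \<psi> x)"
proof (induction k arbitrary: \<phi> \<psi>)
  case (Suc k)
  then have d: "\<And>x. \<phi> differentiable at x" "\<And>x. \<psi> differentiable at x" by simp_all
  then have "partial_deriv j (\<lambda>x. \<phi> x + \<psi> x) = (\<lambda>x. partial_deriv j \<phi> x + partial_deriv j \<psi> x)" for j
    by (intro ext partial_deriv_add)
  then show ?case using Suc by simp
qed (simp add: continuous_on_add)

lemma C_k_mult: "C_k k \<phi> \<Longrightarrow> C_k k \<psi> \<Longrightarrow> C_k k (\<lambda>x. \<phi> x * \<psi> x)"
proof (induction k arbitrary: \<phi> \<psi>)
  case (Suc k)
  then have d: "\<And>x. \<phi> differentiable at x" "\<And>x. \<psi> differentiable at x" by simp_all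
  then have p: "partial_deriv j (\<lambda>x. \<phi> x * \<psi> x) = (\<lambda>x. \<phi> x * partial_deriv j \<psi> x + partial_deriv j \<phi> x * \<psi> x)" for j
    by (intro ext partial_deriv_mult)
  have "C_k k (partial_deriv j (\<lambda>x. \<phi> x * \<psi> x))" for j
    unfolding p using Suc.prems by (intro C_k_add Suc.IH Suc.prems[THEN C_k_Suc_imp]) simp_all
  then show ?case using d by simp
qed (simp add: continuous_on_mult)

lemma C_k_prod: "finite J \<Longrightarrow> (\<And>j. j \<in> J \<Longrightarrow> C_k k (g j)) \<Longrightarrow> C_k k (\<lambda>x. \<Prod>j\<in>J. g j x)"
  by (induction rule: finite_induct) (auto intro: C_k_mult C_k_const)

lemma C_k_coord: "C_k k (\<lambda>x::real^'n. x $ i)"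
proof (cases k)
  case (Suc m)
  have d: "((\<lambda>x::real^'n. x $ i) has_derivative (\<lambda>h. h $ i)) (at x)" for x
    by (intro bounded_linear_imp_has_derivative bounded_linear_vec_nth)
  have "partial_deriv j (\<lambda>x::real^'n. x $ i) = (\<lambda>_. axis j 1 $ i)" for j
    by (rule ext) (rule partial_deriv_eq[OF d])
  then show ?thesis using d Suc by (auto simp: differentiable_def C_k_const simp del: axis_def)
qed (simp add: continuous_on_component)

text \<open>The family is closed under differentiation up to linear combinations, so one induction yields
  smoothness of its member \<open>m = 0\<close>, the standard flat function \<open>exp (- 1 / t)\<close>.\<close>

definition flat_exp :: "nat \<Rightarrow> real \<Rightarrow> real" where
  "flat_exp m t = (if 0 < t then exp (- inverse t) * inverse t ^ m else 0)"

text \<open>One term of the exponential series at \<open>1 / t\<close> dominates the negative power. The quadratic bound makes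
  the function differentiable at \<open>0\<close> with derivative \<open>0\<close>.\<close>

lemma flat_exp_le: "\<bar>flat_exp m t\<bar> \<le> fact (m + 2) * t\<^sup>2"
proof (cases "0 < t")
  case True
  define s where "s = inverse t"
  have s: "0 < s" using True by (simp add: s_def)
  have "(\<Sum>i\<in>{m + 2}. s ^ i /\<^sub>R fact i) \<le> (\<Sum>i. s ^ i /\<^sub>R fact i)"
    using s by (intro sum_le_suminf summable_exp_generic) auto
  then have "s ^ (m + 2) \<le> fact (m + 2) * exp s"
    by (simp add: exp_def pos_divide_le_eq divide_inverse_commute[symmetric] mult.commute del: fact_Suc power_Suc)
  then have "s ^ (m + 2) * exp (- s) \<le> fact (m + 2)"
    by (simp add: exp_minus pos_divide_le_eq divide_inverse[symmetric] del: fact_Suc power_Suc)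
  then have "s ^ (m + 2) * exp (- s) * t\<^sup>2 \<le> fact (m + 2) * t\<^sup>2"
    by (rule mult_right_mono) simp
  moreover have "s ^ (m + 2) * exp (- s) * t\<^sup>2 = s ^ m * exp (- s)"
    using True by (simp add: s_def power_add field_simps power2_eq_square)
  ultimately have "s ^ m * exp (- s) \<le> fact (m + 2) * t\<^sup>2" by (simp only:)
  then show ?thesis using True by (simp add: flat_exp_def s_def mult.commute abs_mult del: fact_Suc)
qed (simp add: flat_exp_def)

lemma flat_exp_has_derivative:
  "(flat_exp m has_real_derivative (flat_exp (m + 2) t - m * flat_exp (m + 1) t)) (at t)"
proof -
  consider "t < 0" | "t = 0" | "0 < t" by linarith
  then show ?thesis
  proof cases
    case 1
    have "((\<lambda>_. 0) has_real_derivative 0) (at t)" by simp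
    then have "(flat_exp m has_real_derivative 0) (at t)"
      by (rule has_field_derivative_transform_within_open[where S = "{..<0}"])
        (use 1 in \<open>auto simp: flat_exp_def\<close>)
    then show ?thesis using 1 by (simp add: flat_exp_def)
  next
    case 2
    have "(\<lambda>h. flat_exp m h / h) \<midarrow>0\<rightarrow> 0"
    proof (rule Lim_null_comparison)
      show "\<forall>\<^sub>F h in at 0. norm (flat_exp m h / h) \<le> fact (m + 2) * \<bar>h\<bar>"
        using flat_exp_le[of m] by (auto simp: eventually_at_filter divide_le_eq power2_eq_square abs_mult mult.assoc)
      show "(\<lambda>h::real. fact (m + 2) * \<bar>h\<bar>) \<midarrow>0\<rightarrow> 0"
        by (auto intro!: tendsto_eq_intros)
    qed
    then show ?thesis using 2 by (simp add: DERIV_def flat_exp_def)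
  next
    case 3
    define u where "u = inverse t"
    have "((\<lambda>u. exp (- u) * u ^ m) has_real_derivative - exp (- u) * u ^ m + exp (- u) * (m * u ^ (m - 1))) (at u)"
      by (auto intro!: derivative_eq_intros)
    moreover have "(inverse has_real_derivative - u\<^sup>2) (at t)"
      using DERIV_inverse[of t] 3 by (simp add: u_def numeral_2_eq_2)
    ultimately have "((\<lambda>t. exp (- inverse t) * inverse t ^ m) has_real_derivative
        (- exp (- u) * u ^ m + exp (- u) * (m * u ^ (m - 1))) * (- u\<^sup>2)) (at t)"
      unfolding u_def by (rule DERIV_chain2)
    moreover have "(- exp (- u) * u ^ m + exp (- u) * (m * u ^ (m - 1))) * (- u\<^sup>2)
       = exp (- u) * u ^ (m + 2) - m * (exp (- u) * u ^ (m + 1))"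
      by (cases m) (simp_all add: power2_eq_square algebra_simps)
    ultimately have "((\<lambda>t. exp (- inverse t) * inverse t ^ m) has_real_derivative
        exp (- u) * u ^ (m + 2) - m * (exp (- u) * u ^ (m + 1))) (at t)" by simp
    then have "(flat_exp m has_real_derivative
        exp (- u) * u ^ (m + 2) - m * (exp (- u) * u ^ (m + 1))) (at t)"
      by (rule has_field_derivative_transform_within_open[where S = "{0<..}"])
        (use 3 in \<open>auto simp: flat_exp_def\<close>)
    then show ?thesis using 3 by (simp add: flat_exp_def u_def)
  qed
qed

lemma flat_exp_range: "0 \<le> flat_exp 0 t" "flat_exp 0 t \<le> 1"
  by (auto simp: flat_exp_def)

lemma C_k_flat_exp: "C_k k (\<lambda>x::real^'n. flat_exp m (c * x $ j + d))"
proof (induction k arbitrary: m)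
  case 0
  have "isCont (flat_exp m) t" for t using flat_exp_has_derivative DERIV_isCont by blast
  then have "continuous_on UNIV (flat_exp m)" by (simp add: continuous_on_eq_continuous_at)
  moreover have "continuous_on UNIV (\<lambda>x::real^'n. c * x $ j + d)" by (intro continuous_intros)
  ultimately show ?case by (auto intro: continuous_on_compose2[of UNIV "flat_exp m"])
next
  case (Suc k)
  let ?g = "\<lambda>x::real^'n. flat_exp m (c * x $ j + d)"
  have D: "(?g has_derivative (\<lambda>h. (c * h $ j) *
      (flat_exp (m + 2) (c * x $ j + d) - m * flat_exp (m + 1) (c * x $ j + d)))) (at x)" for x
    by (rule DERIV_compose_FDERIV[OF flat_exp_has_derivative])
      (intro has_derivative_add_const has_derivative_mult_right bounded_linear_imp_has_derivative bounded_linear_vec_nth)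
  have p: "partial_deriv i ?g = (\<lambda>x. (c * axis i 1 $ j) *
      (flat_exp (m + 2) (c * x $ j + d) + (- real m) * flat_exp (m + 1) (c * x $ j + d)))" for i
    by (rule ext) (simp add: partial_deriv_eq[OF D])
  have "C_k k (partial_deriv i ?g)" for i
    unfolding p by (intro C_k_mult C_k_add C_k_const Suc)
  then show ?case using D by (auto simp: differentiable_def)
qed

lemma flat_exp_tendsto: "(\<lambda>m. flat_exp 0 (real (Suc m) * t)) \<longlonglongrightarrow> (if 0 < t then 1 else 0)"
proof (cases "0 < t")
  case True
  have "(\<lambda>m. exp (- (inverse (real (Suc m)) * inverse t))) \<longlonglongrightarrow> exp (- (0 * inverse t))"
    by (intro tendsto_intros LIMSEQ_inverse_real_of_nat)
  moreover have "flat_exp 0 (real (Suc m) * t) = exp (- (inverse (real (Suc m)) * inverse t))" for m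
    using True by (simp add: flat_exp_def zero_less_mult_iff)
  ultimately show ?thesis using True by simp
next
  case False
  then have "flat_exp 0 (real (Suc m) * t) = 0" for m
    by (simp add: flat_exp_def zero_less_mult_iff not_less)
  then show ?thesis using False by simp
qed

text \<open>As \<open>m\<close> grows, these test functions increase to the indicator of the box, because
  \<open>exp (- 1 / (m * t))\<close> tends to \<open>1\<close> for every \<open>t > 0\<close>.\<close>

definition box_bump :: "real^'n \<Rightarrow> real^'n \<Rightarrow> real \<Rightarrow> real^'n \<Rightarrow> real" where
  "box_bump a b m x =
     (\<Prod>j\<in>UNIV. flat_exp 0 (m * x $ j + - (m * a $ j)) * flat_exp 0 (- m * x $ j + m * b $ j))"

lemma box_bump_range: "0 \<le> box_bump a b m x" "box_bump a b m x \<le> 1"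
  unfolding box_bump_def
  by (auto intro!: prod_nonneg prod_le_1 mult_nonneg_nonneg mult_le_one flat_exp_range)

lemma C_k_box_bump: "C_k k (box_bump a b m)"
  unfolding box_bump_def [abs_def] by (intro C_k_prod C_k_mult C_k_flat_exp) simp

lemma box_bump_nonzero_imp:
  assumes "0 < m" "box_bump a b m x \<noteq> 0"
  shows "x \<in> box a b"
proof -
  have "flat_exp 0 (m * x $ j + - (m * a $ j)) \<noteq> 0 \<and> flat_exp 0 (- m * x $ j + m * b $ j) \<noteq> 0" for j
    using assms(2) by (auto simp: box_bump_def)
  moreover have "0 < t" if "flat_exp 0 t \<noteq> 0" for t using that by (simp add: flat_exp_def split: if_splits)
  ultimately have "0 < m * x $ j + - (m * a $ j) \<and> 0 < - m * x $ j + m * b $ j" for j by blast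
  then show ?thesis
    using assms(1) by (auto simp: mem_box_cart)
qed

lemma test_function_box_bump:
  assumes "cbox a b \<subseteq> \<Omega>" "0 < m"
  shows "test_function \<Omega> (box_bump a b m)"
proof -
  have "{x. box_bump a b m x \<noteq> 0} \<subseteq> cbox a b"
    using box_bump_nonzero_imp[OF assms(2)] box_subset_cbox by blast
  then have "closure {x. box_bump a b m x \<noteq> 0} \<subseteq> cbox a b" by (intro closure_minimal closed_cbox)
  moreover from this have "compact (closure {x. box_bump a b m x \<noteq> 0})"
    by (meson bounded_cbox bounded_subset closed_closure compact_eq_bounded_closed)
  ultimately show ?thesis
    using assms(1) C_k_box_bump by (auto simp: test_function_def)
qed

lemma box_bump_tendsto_indicator:
  "(\<lambda>m. box_bump a b (real (Suc m)) x) \<longlonglongrightarrow> indicator (box a b) x"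
proof -
  have "(\<lambda>m. \<Prod>j\<in>UNIV. flat_exp 0 (real (Suc m) * (x $ j - a $ j)) * flat_exp 0 (real (Suc m) * (b $ j - x $ j)))
     \<longlonglongrightarrow> (\<Prod>j\<in>UNIV. (if 0 < x $ j - a $ j then 1 else 0) * (if 0 < b $ j - x $ j then 1 else 0))"
    by (intro tendsto_prod tendsto_mult flat_exp_tendsto)
  moreover have "(\<Prod>j\<in>UNIV. (if 0 < x $ j - a $ j then 1 else 0) * (if 0 < b $ j - x $ j then 1 else 0))
     = indicat_real (box a b) x"
  proof (cases "x \<in> box a b")
    case False
    then obtain j where "\<not> (a $ j < x $ j \<and> x $ j < b $ j)" by (auto simp: mem_box_cart)
    then have "(\<Prod>j\<in>UNIV. (if 0 < x $ j - a $ j then 1 else 0) * (if 0 < b $ j - x $ j then 1 else (0::real))) = 0"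
      by (intro prod_zero bexI[of _ j]) auto
    then show ?thesis using False by simp
  qed (simp add: mem_box_cart)
  moreover have "box_bump a b (real (Suc m)) x =
    (\<Prod>j\<in>UNIV. flat_exp 0 (real (Suc m) * (x $ j - a $ j)) * flat_exp 0 (real (Suc m) * (b $ j - x $ j)))" for m
    unfolding box_bump_def by (intro prod.cong arg_cong2[where f = "(*)"] arg_cong[where f = "flat_exp 0"])
      (simp_all add: algebra_simps)
  ultimately show ?thesis by simp
qed

section \<open>The fundamental lemma of the calculus of variations\<close>

text \<open>The sets over which \<open>h\<close> integrates to zero form a Dynkin system.\<close>

lemma integral_boxes_zero_imp_AE_zero:
  fixes h :: "'a::euclidean_space \<Rightarrow> real"
  assumes h: "integrable lborel h"
    and boxes: "\<And>a b. (LINT x:box a b|lborel. h x) = 0"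
  shows "AE x in lborel. h x = 0"
proof (rule sigma_finite_measure.density_zero[OF sigma_finite_lborel h])
  have si: "set_integrable lborel A h" if "A \<in> sets borel" for A
    using integrable_mult_indicator[OF _ h, of A] that by (simp add: set_integrable_def)
  \<comment> \<open>The boxes form an intersection-stable generator; closure under complements also needs the
    integral over the whole space.\<close>
  define B :: "nat \<Rightarrow> 'a set" where "B n = box (- (real n *\<^sub>R One)) (real n *\<^sub>R One)" for n
  have "(\<lambda>n. LINT x:B n|lborel. h x) \<longlonglongrightarrow> (LINT x:(\<Union>n. B n)|lborel. h x)"
  proof (rule set_integral_cont_up)
    show "incseq B"
      by (rule incseq_SucI) (auto simp: B_def intro!: subset_box_imp)
  qed (auto simp: B_def intro!: si)
  moreover have "(\<Union>n. B n) = UNIV" unfolding B_def by (rule UN_box_eq_UNIV)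
  ultimately have "(\<lambda>n. 0) \<longlonglongrightarrow> (LINT x:UNIV|lborel. h x)"
    using boxes by (simp add: B_def)
  then have total: "(LINT x:UNIV|lborel. h x) = 0" by (simp add: LIMSEQ_const_iff)
  fix A :: "'a set" assume A: "A \<in> sets lborel"
  have "Int_stable (range (\<lambda>(a, b). box a b :: 'a set))"
    by (auto simp: Int_stable_def box_Int_box)
  moreover have "range (\<lambda>(a, b). box a b :: 'a set) \<subseteq> Pow UNIV" by auto
  moreover have "A \<in> sigma_sets UNIV (range (\<lambda>(a, b). box a b))" using A by (simp add: borel_eq_box)
  ultimately show "(LINT x:A|lborel. h x) = 0"
  proof (induction rule: sigma_sets_induct_disjoint)
    case (basic A) then show ?case using boxes by auto
  next
    case empty then show ?case by (simp add: set_lebesgue_integral_def)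
  next
    case (compl A)
    then have A: "A \<in> sets borel" by (simp add: borel_eq_box)
    have "(LINT x:A \<union> (UNIV - A)|lborel. h x) = (LINT x:A|lborel. h x) + (LINT x:UNIV - A|lborel. h x)"
      using A by (intro set_integral_Un si) auto
    then show ?case using total compl by simp
  next
    case (union F)
    then have F: "\<And>i. F i \<in> sets borel" by (auto simp: borel_eq_box)
    then have "(LINT x:(\<Union>i. F i)|lborel. h x) = (\<Sum>i. (LINT x:F i|lborel. h x))"
      using union(1) by (intro lebesgue_integral_countable_add si) (auto simp: disjoint_family_on_def)
    then show ?case using union by simp
  qed
qed

text \<open>Testing with bumps that converge to the indicator of a box shows that \<open>g\<close> integrates to zero
  over every box whose closure lies in \<open>\<Omega>\<close>. Hence \<open>g\<close> vanishes almost everywhere on such a box, and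
  countably many closed boxes cover \<open>\<Omega>\<close>.\<close>

lemma fundamental_lemma_calculus_of_variations:
  fixes g :: "real^'n \<Rightarrow> real"
  assumes \<Omega>: "open \<Omega>" and g: "locally_integrable \<Omega> g"
    and zero: "\<And>\<phi>. test_function \<Omega> \<phi> \<Longrightarrow> (LINT x|lebesgue_on \<Omega>. g x * \<phi> x) = 0"
  shows "AE x in lebesgue_on \<Omega>. g x = 0"
proof -
  have \<Omega>s: "\<Omega> \<inter> space lebesgue \<in> sets lebesgue" using \<Omega> by simp
  have int: "integrable lebesgue (\<lambda>x. indicator (cbox a b) x * g x)" if "cbox a b \<subseteq> \<Omega>" for a b
    using g that by (auto simp: locally_integrable_def set_integrable_def)
  have box0: "(LINT x|lebesgue. indicator (box a b) x * g x) = 0" if ab: "cbox a b \<subseteq> \<Omega>" for a b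
  proof -
    \<comment> \<open>The bumps are at most \<open>1\<close> and vanish outside \<open>cbox a b\<close>, so \<open>g\<close> restricted to \<open>cbox a b\<close> dominates.\<close>
    let ?s = "\<lambda>m x. (indicator (cbox a b) x * g x) * box_bump a b (real (Suc m)) x"
    have "(\<lambda>m. LINT x|lebesgue. ?s m x) \<longlonglongrightarrow> (LINT x|lebesgue. indicator (box a b) x * g x)"
    proof (rule integral_dominated_convergence)
      show "integrable lebesgue (\<lambda>x. \<bar>indicator (cbox a b) x * g x\<bar>)"
        using int[OF ab] by (rule integrable_abs)
      have "box_bump a b m \<in> borel_measurable borel" for m
        using C_k_box_bump[of 0 a b m] by (simp add: borel_measurable_continuous_onI)
      then have bm: "box_bump a b m \<in> borel_measurable lebesgue" for m
        by (intro measurable_completion) simp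
      show m: "?s m \<in> borel_measurable lebesgue" for m
        using borel_measurable_integrable[OF int[OF ab]] bm by (rule borel_measurable_times)
      have "(\<lambda>m. ?s m x) \<longlonglongrightarrow> (indicator (cbox a b) x * g x) * indicator (box a b) x" for x
        by (intro tendsto_mult tendsto_const box_bump_tendsto_indicator)
      moreover have "(indicator (cbox a b) x * g x) * indicator (box a b) x = indicator (box a b) x * g x" for x
        using box_subset_cbox[of a b] by (auto simp: indicator_def)
      ultimately have lim: "(\<lambda>m. ?s m x) \<longlonglongrightarrow> indicator (box a b) x * g x" for x by simp
      then show "AE x in lebesgue. (\<lambda>m. ?s m x) \<longlonglongrightarrow> indicator (box a b) x * g x" by simp
      show "(\<lambda>x. indicator (box a b) x * g x) \<in> borel_measurable lebesgue"
        using m lim by (rule borel_measurable_LIMSEQ_metric)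
      show "AE x in lebesgue. norm (?s m x) \<le> \<bar>indicator (cbox a b) x * g x\<bar>" for m
      proof (rule AE_I2)
        fix x
        have "\<bar>box_bump a b (real (Suc m)) x\<bar> \<le> 1"
          using box_bump_range[of a b "real (Suc m)" x] by (simp del: of_nat_Suc)
        then show "norm (?s m x) \<le> \<bar>indicator (cbox a b) x * g x\<bar>"
          unfolding real_norm_def abs_mult[of _ "box_bump a b (real (Suc m)) x"] by (rule mult_left_le) simp
      qed
    qed
    moreover have "(LINT x|lebesgue. ?s m x) = 0" for m
    proof -
      have "(LINT x|lebesgue_on \<Omega>. g x * box_bump a b (real (Suc m)) x) = 0"
        using test_function_box_bump[OF ab] by (intro zero) simp
      moreover have "indicator \<Omega> x *\<^sub>R (g x * box_bump a b (real (Suc m)) x) = ?s m x" for x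
        using ab box_bump_nonzero_imp[of "real (Suc m)" a b x] box_subset_cbox[of a b]
        by (auto simp: indicator_def)
      ultimately show ?thesis by (simp only: integral_restrict_space[OF \<Omega>s])
    qed
    ultimately show ?thesis by (simp add: LIMSEQ_const_iff)
  qed
  have ae: "AE x in lebesgue. x \<in> cbox a b \<longrightarrow> g x = 0" if ab: "cbox a b \<subseteq> \<Omega>" for a b
  proof -
    let ?h = "\<lambda>x. indicator (box a b) x * g x"
    have hi: "integrable lebesgue ?h"
    proof -
      have "integrable lebesgue (\<lambda>x. indicator (box a b) x *\<^sub>R (indicator (cbox a b) x * g x))"
        by (intro integrable_mult_indicator int[OF ab]) simp
      moreover have "indicator (box a b) x *\<^sub>R (indicator (cbox a b) x * g x) = ?h x" for x
        using box_subset_cbox[of a b] by (auto simp: indicator_def)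
      ultimately show ?thesis by (simp only:)
    qed
    obtain h' where h': "h' \<in> borel_measurable lborel" and eq: "AE x in lborel. ?h x = h' x"
      using completion_ex_borel_measurable_real[OF borel_measurable_integrable[OF hi]] by auto
    have eq': "AE x in lebesgue. ?h x = h' x" using eq by (rule AE_completion)
    have h'l: "h' \<in> borel_measurable lebesgue" using h' by (rule measurable_completion)
    have "integrable lebesgue h'"
      using hi integrable_cong_AE[OF borel_measurable_integrable[OF hi] h'l eq'] by simp
    then have "integrable lborel h'" using integrable_completion[OF h'] by simp
    moreover have "(LINT x:box c d|lborel. h' x) = 0" for c d
    proof -
      \<comment> \<open>\<open>h'\<close> vanishes almost everywhere outside \<open>box a b\<close>, so only the box \<open>box c d \<inter> box a b\<close> counts.\<close>
      obtain p q where pq: "box c d \<inter> box a b = box p q"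
        using box_Int_box[of c d a b] by (rule that)
      have "(LINT x:box c d|lborel. h' x) = (LINT x|lebesgue. indicator (box c d) x *\<^sub>R h' x)"
        unfolding set_lebesgue_integral_def by (rule integral_completion[symmetric]) (use h' in simp)
      also have "\<dots> = (LINT x|lebesgue. indicator (box p q) x * g x)"
      proof (rule integral_cong_AE)
        show "(\<lambda>x. indicat_real (box c d) x *\<^sub>R h' x) \<in> borel_measurable lebesgue"
          by (intro borel_measurable_scaleR h'l borel_measurable_indicator) simp
        have "(\<lambda>x. indicator (box c d) x *\<^sub>R ?h x) \<in> borel_measurable lebesgue"
          by (intro borel_measurable_scaleR borel_measurable_integrable[OF hi] borel_measurable_indicator) simp
        moreover have i: "indicator (box c d) x *\<^sub>R ?h x = indicator (box p q) x * g x" for x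
          using pq by (auto simp: indicator_def)
        ultimately show "(\<lambda>x. indicator (box p q) x * g x) \<in> borel_measurable lebesgue" by (simp only:)
        show "AE x in lebesgue. indicat_real (box c d) x *\<^sub>R h' x = indicat_real (box p q) x * g x"
          using eq' by eventually_elim (simp only: i[symmetric])
      qed
      also have "\<dots> = 0"
      proof (cases "box p q = {}")
        case False
        have "cbox p q \<subseteq> cbox a b"
        proof -
          have "box p q \<subseteq> cbox a b" using pq box_subset_cbox[of a b] by blast
          then have "closure (box p q) \<subseteq> cbox a b" by (intro closure_minimal closed_cbox)
          then show ?thesis using closure_box[OF False] by simp
        qed
        then show ?thesis using ab by (intro box0) simp
      qed simp
      finally show ?thesis .
    qed
    ultimately have "AE x in lborel. h' x = 0" by (rule integral_boxes_zero_imp_AE_zero)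
    then have "AE x in lebesgue. h' x = 0" by (rule AE_completion)
    moreover have "AE x in lebesgue. x \<notin> cbox a b - box a b"
      using negligible_frontier_interval[of a b] by (intro AE_not_in) (simp add: negligible_iff_null_sets)
    ultimately show ?thesis using eq' by eventually_elim (auto simp: indicator_def)
  qed
  obtain \<D> where D: "countable \<D>" "\<D> \<subseteq> Pow \<Omega>" "\<And>X. X \<in> \<D> \<Longrightarrow> \<exists>a b. X = cbox a b" "\<Union>\<D> = \<Omega>"
    using open_countable_Union_open_cbox[OF \<Omega>] by metis
  have "AE x in lebesgue. \<forall>X\<in>\<D>. x \<in> X \<longrightarrow> g x = 0"
    unfolding AE_ball_countable[OF D(1)]
  proof
    fix X assume "X \<in> \<D>"
    then obtain a b where "X = cbox a b" "cbox a b \<subseteq> \<Omega>" using D by blast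
    then show "AE x in lebesgue. x \<in> X \<longrightarrow> g x = 0" using ae by simp
  qed
  then have "AE x in lebesgue. x \<in> \<Omega> \<longrightarrow> g x = 0"
    by eventually_elim (use D(4) in blast)
  then show ?thesis by (simp add: AE_restrict_space_iff[OF \<Omega>s])
qed

section \<open>Integrals of partial derivatives\<close>

definition C1_c :: "(real^'n \<Rightarrow> real) \<Rightarrow> bool" where
  "C1_c \<phi> \<longleftrightarrow> C_k 1 \<phi> \<and> bounded {x. \<phi> x \<noteq> 0}"

definition diff_quot :: "real \<Rightarrow> 'n \<Rightarrow> (real^'n \<Rightarrow> real) \<Rightarrow> real^'n \<Rightarrow> real" where
  "diff_quot h j \<phi> x = (\<phi> (x + h *\<^sub>R axis j 1) - \<phi> x) / h"

lemma C1_c_differentiable: "C1_c \<phi> \<Longrightarrow> \<phi> differentiable at x"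
  by (simp add: C1_c_def)

lemma C1_c_continuous: "C1_c \<phi> \<Longrightarrow> continuous_on UNIV \<phi>"
  using C_k_Suc_imp[of 0 \<phi>] by (simp add: C1_c_def)

lemma C1_c_continuous_partial: "C1_c \<phi> \<Longrightarrow> continuous_on UNIV (partial_deriv j \<phi>)"
  by (simp add: C1_c_def)

lemma C1_c_mult:
  assumes "C1_c \<phi>" "C_k 1 \<psi>" shows "C1_c (\<lambda>x. \<psi> x * \<phi> x)"
proof -
  have "{x. \<psi> x * \<phi> x \<noteq> 0} \<subseteq> {x. \<phi> x \<noteq> 0}" by auto
  then show ?thesis using assms C_k_mult[of 1 \<psi> \<phi>] unfolding C1_c_def by (metis bounded_subset)
qed

lemma partial_deriv_line:
  assumes "\<phi> differentiable at (x + t *\<^sub>R axis j 1)"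
  shows "((\<lambda>t. \<phi> (x + t *\<^sub>R axis j 1)) has_real_derivative partial_deriv j \<phi> (x + t *\<^sub>R axis j 1)) (at t)"
proof -
  let ?D = "frechet_derivative \<phi> (at (x + t *\<^sub>R axis j 1))"
  have D: "(\<phi> has_derivative ?D) (at (x + t *\<^sub>R axis j 1))"
    using assms by (rule has_derivative_partial)
  have "((\<lambda>t. x + t *\<^sub>R axis j 1) has_derivative (\<lambda>s. s *\<^sub>R axis j 1)) (at t)"
    by (auto intro!: derivative_eq_intros)
  from has_derivative_compose[OF this D]
  have "((\<lambda>t. \<phi> (x + t *\<^sub>R axis j 1)) has_derivative (\<lambda>s. ?D (s *\<^sub>R axis j 1))) (at t)" .
  moreover have "?D (s *\<^sub>R axis j 1) = partial_deriv j \<phi> (x + t *\<^sub>R axis j 1) * s" for s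
    using linear_scale[OF has_derivative_linear[OF D]] by (simp add: partial_deriv_def)
  ultimately show ?thesis by (simp add: has_field_derivative_def)
qed

lemma partial_deriv_zero_outside:
  assumes "x \<notin> closure {x. \<phi> x \<noteq> 0}"
  shows "partial_deriv j \<phi> x = 0"
proof -
  have "((\<lambda>_. 0::real) has_derivative (\<lambda>_. 0)) (at x)" by simp
  then have "(\<phi> has_derivative (\<lambda>_. 0)) (at x)"
    by (rule has_derivative_transform_within_open[where s = "- closure {x. \<phi> x \<noteq> 0}"])
      (use assms closure_subset[of "{x. \<phi> x \<noteq> 0}"] in auto)
  then show ?thesis by (rule partial_deriv_eq)
qed

lemma C1_c_bounds:
  assumes "C1_c \<phi>"
  obtains R M where "0 < R" "0 \<le> M" "\<And>x. \<bar>\<phi> x\<bar> \<le> M" "\<And>x j. \<bar>partial_deriv j \<phi> x\<bar> \<le> M"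
    "\<And>x. R < norm x \<Longrightarrow> \<phi> x = 0" "\<And>x j. R < norm x \<Longrightarrow> partial_deriv j \<phi> x = 0"
proof -
  obtain R where R: "0 < R" "{x. \<phi> x \<noteq> 0} \<subseteq> cball 0 R"
    using assms bounded_subset_cball[of "{x. \<phi> x \<noteq> 0}"] bounded_pos
    by (auto simp: C1_c_def bounded_pos subset_eq)
  then have c: "closure {x. \<phi> x \<noteq> 0} \<subseteq> cball 0 R" by (intro closure_minimal closed_cball)
  have z: "\<phi> x = 0" if "R < norm x" for x using R(2) that by (force simp: subset_eq)
  have pz: "partial_deriv j \<phi> x = 0" if "R < norm x" for x j
    using c that by (intro partial_deriv_zero_outside) (auto simp: subset_eq)
  have bd: "\<exists>B. \<forall>x. \<bar>f x\<bar> \<le> B" if "continuous_on UNIV f" "\<And>x. R < norm x \<Longrightarrow> f x = 0" for f :: "real^'a \<Rightarrow> real"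
  proof -
    have "compact (f ` cball 0 R)"
      using that(1) by (intro compact_continuous_image) (auto intro: continuous_on_subset)
    then obtain B where "0 < B" "\<forall>y\<in>f ` cball 0 R. norm y \<le> B"
      using compact_imp_bounded bounded_pos by metis
    then have "\<bar>f x\<bar> \<le> B" for x using that(2)[of x] by (cases "norm x \<le> R") auto
    then show ?thesis by blast
  qed
  obtain B where B: "\<And>x. \<bar>\<phi> x\<bar> \<le> B" using bd[OF C1_c_continuous[OF assms] z] by blast
  have "\<forall>j. \<exists>B. \<forall>x. \<bar>partial_deriv j \<phi> x\<bar> \<le> B"
    using bd[OF C1_c_continuous_partial[OF assms] pz] by blast
  then obtain P where P: "\<And>j x. \<bar>partial_deriv j \<phi> x\<bar> \<le> P j" by metis
  define M where "M = B + (\<Sum>j\<in>UNIV. P j)"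
  have P0: "0 \<le> P j" for j using P[of j 0] by linarith
  have B0: "0 \<le> B" using B[of 0] by linarith
  have PS: "P j \<le> (\<Sum>j\<in>UNIV. P j)" for j using P0 by (intro member_le_sum) auto
  have S0: "0 \<le> (\<Sum>j\<in>UNIV. P j)" using P0 by (intro sum_nonneg)
  have "0 \<le> M" using B0 S0 by (simp add: M_def)
  moreover have "\<bar>\<phi> x\<bar> \<le> M" for x using B[of x] S0 by (simp add: M_def)
  moreover have "\<bar>partial_deriv j \<phi> x\<bar> \<le> M" for x j
    using P[of j x] PS[of j] B0 unfolding M_def by linarith
  ultimately show ?thesis using that R(1) z pz by blast
qed

lemma diff_quot_bound:
  assumes \<phi>: "\<And>x. \<phi> differentiable at x" and M: "\<And>x. \<bar>partial_deriv j \<phi> x\<bar> \<le> M"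
  shows "\<bar>diff_quot h j \<phi> x\<bar> \<le> M"
proof (cases "h = 0")
  case True
  then show ?thesis using M[of x] by (simp add: diff_quot_def)
next
  case False
  have "norm (\<phi> (x + h *\<^sub>R axis j 1) - \<phi> (x + 0 *\<^sub>R axis j 1)) \<le> M * norm (h - 0)"
    using partial_deriv_line[OF \<phi>] M
    by (intro field_differentiable_bound[where S = UNIV and f = "\<lambda>t. \<phi> (x + t *\<^sub>R axis j 1)"]) auto
  then show ?thesis using False by (simp add: diff_quot_def field_simps)
qed

lemma diff_quot_tendsto:
  assumes \<phi>: "\<phi> differentiable at x" and h: "h \<longlonglongrightarrow> 0" "\<And>n. h n \<noteq> 0"
  shows "(\<lambda>n. diff_quot (h n) j \<phi> x) \<longlonglongrightarrow> partial_deriv j \<phi> x"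
proof -
  have "((\<lambda>h. diff_quot h j \<phi> x) \<longlongrightarrow> partial_deriv j \<phi> x) (at 0)"
    using partial_deriv_line[of \<phi> x 0 j] \<phi> by (simp add: DERIV_def diff_quot_def)
  moreover have "filterlim h (at 0) sequentially"
    using h by (simp add: filterlim_at)
  ultimately show ?thesis by (rule filterlim_compose)
qed

lemma integrable_continuous_bounded_support:
  fixes f :: "real^'n \<Rightarrow> real"
  assumes "continuous_on UNIV f" "\<And>x. R < norm x \<Longrightarrow> f x = 0"
  shows "integrable lborel f"
proof -
  have "integrable lborel (\<lambda>x. indicator (cball 0 R) x *\<^sub>R f x)"
    using assms(1) by (intro borel_integrable_compact) (auto intro: continuous_on_subset)
  moreover have "indicator (cball 0 R) x *\<^sub>R f x = f x" for x
    using assms(2)[of x] by (auto simp: indicator_def)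
  ultimately show ?thesis by (simp only:)
qed

lemma integral_translate:
  fixes f :: "real^'n \<Rightarrow> real"
  assumes "f \<in> borel_measurable borel"
  shows "(LINT x|lborel. f (x + v)) = (LINT x|lborel. f x)"
proof -
  have "(LINT x|lborel. f x) = (LINT x|distr lborel borel ((+) v). f x)" by (simp only: lborel_distr_plus)
  also have "\<dots> = (LINT x|lborel. f (v + x))" using assms by (intro integral_distr) auto
  finally show ?thesis by (simp add: add.commute)
qed

text \<open>Dominated convergence in the form used for difference quotients: both factors are bounded and
  one of them lives in a fixed ball.\<close>

lemma integral_prod_tendsto:
  fixes F G :: "nat \<Rightarrow> real^'n \<Rightarrow> real"
  assumes F: "\<And>n. F n \<in> borel_measurable borel" "\<And>n x. \<bar>F n x\<bar> \<le> M" "\<And>x. (\<lambda>n. F n x) \<longlonglongrightarrow> f x"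
    and G: "\<And>n. G n \<in> borel_measurable borel" "\<And>n x. \<bar>G n x\<bar> \<le> N" "\<And>x. (\<lambda>n. G n x) \<longlonglongrightarrow> g x"
    and supp: "\<And>n x. R < norm x \<Longrightarrow> F n x = 0"
  shows "(\<lambda>n. LINT x|lborel. F n x * G n x) \<longlonglongrightarrow> (LINT x|lborel. f x * g x)"
proof (rule integral_dominated_convergence)
  have "f \<in> borel_measurable borel" "g \<in> borel_measurable borel"
    using borel_measurable_LIMSEQ_metric[OF F(1) F(3)] borel_measurable_LIMSEQ_metric[OF G(1) G(3)] by auto
  then show "(\<lambda>x. f x * g x) \<in> borel_measurable lborel" by simp
  show "(\<lambda>x. F n x * G n x) \<in> borel_measurable lborel" for n using F(1) G(1) by simp
  show "integrable lborel (\<lambda>x::real^'n. indicator (cball 0 R) x * (M * N))"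
    by (intro integrable_mult_left integrable_real_indicator)
       (use emeasure_bounded_finite[OF bounded_cball] in auto)
  show "AE x in lborel. (\<lambda>n. F n x * G n x) \<longlonglongrightarrow> f x * g x"
    using F(3) G(3) by (intro AE_I2 tendsto_mult)
  show "AE x in lborel. norm (F n x * G n x) \<le> indicator (cball 0 R) x * (M * N)" for n
  proof (rule AE_I2)
    fix x :: "real^'n"
    have "\<bar>F n x\<bar> * \<bar>G n x\<bar> \<le> M * N"
      using F(2)[of n x] G(2)[of n x] by (intro mult_mono) auto
    then show "norm (F n x * G n x) \<le> indicator (cball 0 R) x * (M * N)"
      using supp[of x n] by (auto simp: indicator_def abs_mult)
  qed
qed

lemma diff_quot_measurable:
  "continuous_on UNIV \<phi> \<Longrightarrow> diff_quot h j \<phi> \<in> borel_measurable borel"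
  unfolding diff_quot_def [abs_def]
  by (intro borel_measurable_divide borel_measurable_diff borel_measurable_const borel_measurable_continuous_onI)
     (auto intro!: continuous_intros intro: continuous_on_compose2[of UNIV \<phi>])

lemma diff_quot_support:
  assumes "\<And>x. R < norm x \<Longrightarrow> \<phi> x = 0" "\<bar>h\<bar> \<le> 1" "R + 1 < norm x"
  shows "diff_quot h j \<phi> x = 0"
proof -
  have "norm x \<le> norm (x + h *\<^sub>R axis j 1) + norm (h *\<^sub>R (axis j 1 :: real^'a))"
    by (metis add_diff_cancel_right' norm_triangle_ineq4)
  then have "R < norm (x + h *\<^sub>R axis j 1)" "R < norm x" using assms(2,3) by auto
  then show ?thesis using assms(1) by (simp add: diff_quot_def)
qed

text \<open>A difference quotient integrates to zero by translation invariance of Lebesgue measure, and the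
  quotients converge boundedly to the derivative.\<close>

lemma integral_partial_deriv_zero:
  assumes "C1_c \<phi>"
  shows "(LINT x|lborel. partial_deriv j \<phi> x) = 0"
proof -
  obtain R M where b: "0 < R" "0 \<le> M" "\<And>x. \<bar>\<phi> x\<bar> \<le> M" "\<And>x j. \<bar>partial_deriv j \<phi> x\<bar> \<le> M"
    "\<And>x. R < norm x \<Longrightarrow> \<phi> x = 0" "\<And>x j. R < norm x \<Longrightarrow> partial_deriv j \<phi> x = 0"
    by (rule C1_c_bounds[OF assms]) (rule that)
  define h where "h n = inverse (real (Suc n))" for n
  have h: "h \<longlonglongrightarrow> 0" "\<And>n. h n \<noteq> 0" "\<And>n. \<bar>h n\<bar> \<le> 1"
    unfolding h_def using LIMSEQ_inverse_real_of_nat by (auto simp: field_simps)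
  have "(\<lambda>n. LINT x|lborel. diff_quot (h n) j \<phi> x * 1) \<longlonglongrightarrow> (LINT x|lborel. partial_deriv j \<phi> x * 1)"
    by (rule integral_prod_tendsto[where M = M and N = 1 and R = "R + 1"])
      (auto intro!: diff_quot_bound diff_quot_tendsto diff_quot_measurable b h
        C1_c_differentiable C1_c_continuous assms diff_quot_support[where R = R])
  moreover have "(LINT x|lborel. diff_quot k j \<phi> x * 1) = 0" for k
  proof -
    have i: "integrable lborel \<phi>"
      using integrable_continuous_bounded_support[OF C1_c_continuous[OF assms] b(5)] .
    have m: "\<phi> \<in> borel_measurable borel" by (simp add: borel_measurable_continuous_onI C1_c_continuous assms)
    have "integrable lborel (\<lambda>x. \<phi> (k *\<^sub>R axis j 1 + x))"
      using i integrable_distr[of "(+) (k *\<^sub>R axis j 1)" lborel borel \<phi>] by (simp add: lborel_distr_plus)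
    then have i': "integrable lborel (\<lambda>x. \<phi> (x + k *\<^sub>R axis j 1))" by (simp add: add.commute)
    show ?thesis using i i' integral_translate[OF m] by (simp add: diff_quot_def)
  qed
  ultimately show ?thesis by (simp add: LIMSEQ_const_iff)
qed

lemma integration_by_parts:
  assumes "C1_c \<phi>" "C1_c \<psi>"
  shows "(LINT x|lborel. \<phi> x * partial_deriv j \<psi> x) = - (LINT x|lborel. partial_deriv j \<phi> x * \<psi> x)"
proof -
  have pd: "partial_deriv j (\<lambda>x. \<phi> x * \<psi> x) x = \<phi> x * partial_deriv j \<psi> x + partial_deriv j \<phi> x * \<psi> x" for x
    by (intro partial_deriv_mult C1_c_differentiable assms)
  obtain R M where b: "0 < R" "0 \<le> M" "\<And>x. \<bar>\<phi> x\<bar> \<le> M" "\<And>x j. \<bar>partial_deriv j \<phi> x\<bar> \<le> M"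
    "\<And>x. R < norm x \<Longrightarrow> \<phi> x = 0" "\<And>x j. R < norm x \<Longrightarrow> partial_deriv j \<phi> x = 0"
    by (rule C1_c_bounds[OF assms(1)]) (rule that)
  note [intro] = C1_c_continuous C1_c_continuous_partial assms
  have "integrable lborel (\<lambda>x. \<phi> x * partial_deriv j \<psi> x)" "integrable lborel (\<lambda>x. partial_deriv j \<phi> x * \<psi> x)"
    using b by (auto intro!: integrable_continuous_bounded_support[where R = R] continuous_on_mult)
  then have "(LINT x|lborel. \<phi> x * partial_deriv j \<psi> x) + (LINT x|lborel. partial_deriv j \<phi> x * \<psi> x) = 0"
    using integral_partial_deriv_zero[OF C1_c_mult[OF assms(2), of \<phi>], of j] assms(1)
    by (simp add: pd C1_c_def)
  then show ?thesis by simp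
qed

text \<open>This is the statement that the minors \<open>\<partial>\<^sub>j \<phi> * \<partial>\<^sub>l \<psi> - \<partial>\<^sub>l \<phi> * \<partial>\<^sub>j \<psi>\<close> are null Lagrangians. Proving it for
  difference quotients first needs no second derivatives: expanded into products of translates, the
  two integrals agree exactly once the step is reversed.\<close>

lemma integral_partial_swap:
  fixes \<phi> \<psi> :: "real^'n \<Rightarrow> real"
  assumes "C1_c \<phi>" "C1_c \<psi>"
  shows "(LINT x|lborel. partial_deriv j \<phi> x * partial_deriv l \<psi> x)
       = (LINT x|lborel. partial_deriv l \<phi> x * partial_deriv j \<psi> x)"
proof -
  obtain R M where b: "0 < R" "0 \<le> M" "\<And>x. \<bar>\<phi> x\<bar> \<le> M" "\<And>x j. \<bar>partial_deriv j \<phi> x\<bar> \<le> M"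
    "\<And>x. R < norm x \<Longrightarrow> \<phi> x = 0" "\<And>x j. R < norm x \<Longrightarrow> partial_deriv j \<phi> x = 0"
    by (rule C1_c_bounds[OF assms(1)]) (rule that)
  obtain S N where d: "0 < S" "0 \<le> N" "\<And>x. \<bar>\<psi> x\<bar> \<le> N" "\<And>x j. \<bar>partial_deriv j \<psi> x\<bar> \<le> N"
    "\<And>x. S < norm x \<Longrightarrow> \<psi> x = 0" "\<And>x j. S < norm x \<Longrightarrow> partial_deriv j \<psi> x = 0"
    by (rule C1_c_bounds[OF assms(2)]) (rule that)
  have lim: "(\<lambda>n. LINT x|lborel. diff_quot (h n) p \<phi> x * diff_quot (h n) q \<psi> x)
      \<longlonglongrightarrow> (LINT x|lborel. partial_deriv p \<phi> x * partial_deriv q \<psi> x)"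
    if "h \<longlonglongrightarrow> 0" "\<And>n. h n \<noteq> 0" "\<And>n. \<bar>h n\<bar> \<le> 1" for h p q
    by (rule integral_prod_tendsto[where M = M and N = N and R = "R + 1"])
      (auto intro!: diff_quot_bound diff_quot_tendsto diff_quot_measurable b d that
        C1_c_differentiable C1_c_continuous assms diff_quot_support[where R = R])
  define c where "c v = (LINT x|lborel. \<phi> x * \<psi> (x + v))" for v
  have cont: "continuous_on UNIV (\<lambda>x. \<phi> (x + u) * \<psi> (x + v))" for u v
    by (intro continuous_on_mult continuous_on_compose2[OF C1_c_continuous[OF assms(1)]]
        continuous_on_compose2[OF C1_c_continuous[OF assms(2)]] continuous_intros) auto
  have ct: "(LINT x|lborel. \<phi> (x + u) * \<psi> (x + v)) = c (v - u)" for u v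
    using integral_translate[OF borel_measurable_continuous_onI[OF cont[of u v]], of "- u"]
    by (simp add: c_def algebra_simps)
  have it: "integrable lborel (\<lambda>x. \<phi> (x + u) * \<psi> (x + v))" for u v
  proof (rule integrable_continuous_bounded_support[OF cont])
    fix x :: "real^'n" assume x: "R + norm u < norm x"
    have "norm x \<le> norm (x + u) + norm u" by (metis add_diff_cancel_right' norm_triangle_ineq4)
    then show "\<phi> (x + u) * \<psi> (x + v) = 0" using x b(5)[of "x + u"] by simp
  qed
  \<comment> \<open>Only the correlations \<open>c\<close> occur, and reversing the sign of \<open>h\<close> while exchanging the directions
    permutes them.\<close>
  have expand: "(LINT x|lborel. diff_quot h p \<phi> x * diff_quot h q \<psi> x)
     = (c (h *\<^sub>R axis q 1 - h *\<^sub>R axis p 1) - c (- h *\<^sub>R axis p 1) - c (h *\<^sub>R axis q 1) + c 0) / (h * h)" for h p q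
  proof -
    let ?e = "h *\<^sub>R axis p 1" and ?f = "h *\<^sub>R axis q 1"
    have "(LINT x|lborel. diff_quot h p \<phi> x * diff_quot h q \<psi> x) =
      (LINT x|lborel. (\<phi> (x + ?e) * \<psi> (x + ?f) - \<phi> (x + ?e) * \<psi> (x + 0) - \<phi> (x + 0) * \<psi> (x + ?f) + \<phi> (x + 0) * \<psi> (x + 0)) / (h * h))"
      by (intro Bochner_Integration.integral_cong) (simp_all add: diff_quot_def algebra_simps)
    also have "\<dots> = ((LINT x|lborel. \<phi> (x + ?e) * \<psi> (x + ?f)) - (LINT x|lborel. \<phi> (x + ?e) * \<psi> (x + 0))
       - (LINT x|lborel. \<phi> (x + 0) * \<psi> (x + ?f)) + (LINT x|lborel. \<phi> (x + 0) * \<psi> (x + 0))) / (h * h)"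
      by (simp only: integral_divide_zero Bochner_Integration.integral_add Bochner_Integration.integral_diff
          Bochner_Integration.integrable_diff it)
    finally show ?thesis unfolding ct by simp
  qed
  have sym: "(LINT x|lborel. diff_quot h j \<phi> x * diff_quot h l \<psi> x)
       = (LINT x|lborel. diff_quot (- h) l \<phi> x * diff_quot (- h) j \<psi> x)" for h
    unfolding expand by (simp add: algebra_simps)
  define h where "h n = inverse (real (Suc n))" for n
  have h: "h \<longlonglongrightarrow> 0" "\<And>n. h n \<noteq> 0" "\<And>n. \<bar>h n\<bar> \<le> 1"
    unfolding h_def using LIMSEQ_inverse_real_of_nat by (auto simp: field_simps)
  have "(\<lambda>n. - h n) \<longlonglongrightarrow> 0" using tendsto_minus[OF h(1)] by simp
  then have "(\<lambda>n. LINT x|lborel. diff_quot (- h n) l \<phi> x * diff_quot (- h n) j \<psi> x)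
      \<longlonglongrightarrow> (LINT x|lborel. partial_deriv l \<phi> x * partial_deriv j \<psi> x)"
    using h by (intro lim) auto
  then show ?thesis
    using lim[OF h, of j l] unfolding sym by (rule LIMSEQ_unique[rotated])
qed

text \<open>The derivative of \<open>x $ j * \<phi> x ^ 4\<close> in direction \<open>j\<close> integrates to zero, which expresses the integral
  of \<open>\<phi> ^ 4\<close> through \<open>x $ j * \<phi> ^ 3 * \<partial>\<^sub>j \<phi>\<close>; Young's inequality absorbs the factor \<open>\<phi> ^ 3\<close>.\<close>

lemma poincare_scalar:
  fixes \<phi> :: "real^'n \<Rightarrow> real"
  assumes \<phi>: "C1_c \<phi>" and r: "0 < r" "\<And>x. \<phi> x \<noteq> 0 \<Longrightarrow> norm x \<le> r"
  shows "(LINT x|lborel. \<phi> x ^ 4) \<le> 8 * r * (8 * r) ^ 3 * (LINT x|lborel. \<bar>partial_deriv j \<phi> x\<bar> ^ 4)"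
proof -
  obtain R M where b: "0 < R" "0 \<le> M" "\<And>x. \<bar>\<phi> x\<bar> \<le> M" "\<And>x j. \<bar>partial_deriv j \<phi> x\<bar> \<le> M"
    "\<And>x. R < norm x \<Longrightarrow> \<phi> x = 0" "\<And>x j. R < norm x \<Longrightarrow> partial_deriv j \<phi> x = 0"
    by (rule C1_c_bounds[OF \<phi>]) (rule that)
  have c: "continuous_on UNIV \<phi>" "continuous_on UNIV (partial_deriv j \<phi>)"
    using \<phi> by (auto intro: C1_c_continuous C1_c_continuous_partial)
  have "C_k 1 \<phi>" using \<phi> by (simp add: C1_c_def)
  \<comment> \<open>The function whose derivative in direction \<open>j\<close> is integrated is \<open>x $ j * \<phi> x ^ 4\<close>.\<close>
  then have "C_k 1 (\<lambda>x. x $ j * (\<phi> x * (\<phi> x * \<phi> x)))" by (intro C_k_mult C_k_coord)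
  then have C: "C1_c (\<lambda>x. x $ j * (\<phi> x * (\<phi> x * \<phi> x)) * \<phi> x)" by (intro C1_c_mult \<phi>)
  have pd: "partial_deriv j (\<lambda>x. x $ j * (\<phi> x * (\<phi> x * \<phi> x)) * \<phi> x) x
      = \<phi> x ^ 4 + 4 * x $ j * (\<phi> x ^ 3 * partial_deriv j \<phi> x)" for x
  proof -
    have D: "(\<phi> has_derivative frechet_derivative \<phi> (at x)) (at x)"
      using \<phi> by (intro has_derivative_partial C1_c_differentiable)
    have X: "((\<lambda>x. x $ j) has_derivative (\<lambda>h. h $ j)) (at x)"
      by (intro bounded_linear_imp_has_derivative bounded_linear_vec_nth)
    show ?thesis
      using partial_deriv_eq[OF has_derivative_mult[OF has_derivative_mult[OF X
          has_derivative_mult[OF D has_derivative_mult[OF D D]]] D], of j]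
      by (simp add: partial_deriv_def power4_eq_xxxx power3_eq_cube algebra_simps)
  qed
  have i1: "integrable lborel (\<lambda>x. \<phi> x ^ 4)" and
    i2: "integrable lborel (\<lambda>x. 4 * x $ j * (\<phi> x ^ 3 * partial_deriv j \<phi> x))" and
    i3: "integrable lborel (\<lambda>x. \<bar>partial_deriv j \<phi> x\<bar> ^ 4)"
    using b(5,6) by (auto intro!: integrable_continuous_bounded_support[where R = R] continuous_intros c)
  have "(LINT x|lborel. \<phi> x ^ 4 + 4 * x $ j * (\<phi> x ^ 3 * partial_deriv j \<phi> x)) = 0"
    using integral_partial_deriv_zero[OF C, of j] unfolding pd .
  then have "(LINT x|lborel. \<phi> x ^ 4) = (LINT x|lborel. - (4 * x $ j * (\<phi> x ^ 3 * partial_deriv j \<phi> x)))"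
    using i1 i2 by simp
  also have "\<dots> \<le> (LINT x|lborel. \<phi> x ^ 4 / 2 + 4 * r * (8 * r) ^ 3 * \<bar>partial_deriv j \<phi> x\<bar> ^ 4)"
  proof (rule integral_mono)
    fix x :: "real^'n"
    have "- (4 * x $ j * (\<phi> x ^ 3 * partial_deriv j \<phi> x)) \<le> 4 * \<bar>x $ j\<bar> * (\<bar>\<phi> x\<bar> ^ 3 * \<bar>partial_deriv j \<phi> x\<bar>)"
      by (rule order_trans[OF abs_ge_minus_self]) (simp add: abs_mult power_abs)
    also have "\<dots> \<le> 4 * r * (\<bar>\<phi> x\<bar> ^ 3 * \<bar>partial_deriv j \<phi> x\<bar>)"
    proof (cases "\<phi> x = 0")
      case False
      then have "\<bar>x $ j\<bar> \<le> r" using r(2) component_le_norm_cart order_trans by blast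
      then show ?thesis by (intro mult_right_mono) auto
    qed simp
    also have "\<dots> \<le> \<bar>\<phi> x\<bar> ^ 4 / 2 + 4 * r * (8 * r) ^ 3 * \<bar>partial_deriv j \<phi> x\<bar> ^ 4"
      using r(1) by (intro young_cubic) auto
    finally show "- (4 * x $ j * (\<phi> x ^ 3 * partial_deriv j \<phi> x)) \<le> \<phi> x ^ 4 / 2 + 4 * r * (8 * r) ^ 3 * \<bar>partial_deriv j \<phi> x\<bar> ^ 4"
      by simp
  qed (use i1 i2 i3 in simp_all)
  also have "\<dots> = (LINT x|lborel. \<phi> x ^ 4) / 2 + 4 * r * (8 * r) ^ 3 * (LINT x|lborel. \<bar>partial_deriv j \<phi> x\<bar> ^ 4)"
    using i1 i3 by simp
  finally show ?thesis by simp
qed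

section \<open>The two-well quadratic form\<close>

text \<open>Half of the quadratic part of the two-well function with wells \<open>A\<close> and \<open>- A\<close>. For \<open>A \<noteq> 0\<close> it is
  negative at \<open>Z = A\<close>; a sign appears only after integration over gradients.\<close>

definition two_well_form :: "real^'n^'n \<Rightarrow> real^'n^'n \<Rightarrow> real" where
  "two_well_form A Z = (norm A)\<^sup>2 * (norm Z)\<^sup>2 - 2 * (A \<bullet> Z)\<^sup>2"

lemma abs_two_well_form_le: "\<bar>two_well_form A Z\<bar> \<le> 3 * (norm A)\<^sup>2 * (norm Z)\<^sup>2"
proof -
  have "\<bar>A \<bullet> Z\<bar>\<^sup>2 \<le> (norm A * norm Z)\<^sup>2"
    by (intro power_mono Cauchy_Schwarz_ineq2) simp
  then have "(A \<bullet> Z)\<^sup>2 \<le> (norm A)\<^sup>2 * (norm Z)\<^sup>2" by (simp add: power_mult_distrib)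
  moreover have "\<bar>p - 2 * q\<bar> \<le> 3 * p" if "q \<le> p" "0 \<le> q" for p q :: real using that by linarith
  ultimately show ?thesis unfolding two_well_form_def by (simp add: mult.assoc)
qed

lemma two_well_form_diff_le:
  "two_well_form A (Z - D) \<le> two_well_form A Z + 6 * (norm A)\<^sup>2 * (norm Z * norm D) + 3 * (norm A)\<^sup>2 * (norm D)\<^sup>2"
proof -
  have "two_well_form A (Z - D) = two_well_form A Z - 2 * (norm A)\<^sup>2 * (Z \<bullet> D) + 4 * ((A \<bullet> Z) * (A \<bullet> D)) + two_well_form A D"
    unfolding two_well_form_def power2_norm_eq_inner[of "Z - D"] power2_norm_eq_inner[of Z] power2_norm_eq_inner[of D]
    by (simp add: inner_diff_left inner_diff_right inner_commute power2_eq_square algebra_simps)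
  moreover have "- ((norm A)\<^sup>2 * (Z \<bullet> D)) \<le> (norm A)\<^sup>2 * (norm Z * norm D)"
    using mult_left_mono[of "- (Z \<bullet> D)" "norm Z * norm D" "(norm A)\<^sup>2"] Cauchy_Schwarz_ineq2[of Z D]
    by (simp add: abs_le_iff)
  moreover have "(A \<bullet> Z) * (A \<bullet> D) \<le> (norm A)\<^sup>2 * (norm Z * norm D)"
  proof -
    have "(A \<bullet> Z) * (A \<bullet> D) \<le> \<bar>A \<bullet> Z\<bar> * \<bar>A \<bullet> D\<bar>" by (metis abs_ge_self abs_mult)
    also have "\<dots> \<le> (norm A * norm Z) * (norm A * norm D)"
      by (intro mult_mono Cauchy_Schwarz_ineq2) auto
    finally show ?thesis by (simp add: power2_eq_square algebra_simps)
  qed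
  moreover have "two_well_form A D \<le> 3 * (norm A)\<^sup>2 * (norm D)\<^sup>2"
    using abs_two_well_form_le[of A D] by linarith
  ultimately show ?thesis by linarith
qed

lemma two_well_form_parallelogram:
  "two_well_form A ((1/2) *\<^sub>R (Z + W)) + two_well_form A ((1/2) *\<^sub>R (Z - W))
    = (two_well_form A Z + two_well_form A W) / 2"
proof -
  have aux: "(a - 2 * p) / 4 + (b - 2 * q) / 4 = (c - 2 * r + (d - 2 * t)) / 2"
    if "a + b = 2 * (c + d)" "p + q = 2 * (r + t)" for a b c d p q r t :: real
    using that by (simp add: field_simps)
  have s: "two_well_form A ((1/2) *\<^sub>R V) = two_well_form A V / 4" for V
    by (simp add: two_well_form_def power_mult_distrib power2_eq_square algebra_simps)
  have "(norm (Z + W))\<^sup>2 + (norm (Z - W))\<^sup>2 = 2 * ((norm Z)\<^sup>2 + (norm W)\<^sup>2)"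
    unfolding power2_norm_eq_inner by (simp add: inner_add_left inner_add_right inner_diff_left inner_diff_right)
  then have "(norm A)\<^sup>2 * (norm (Z + W))\<^sup>2 + (norm A)\<^sup>2 * (norm (Z - W))\<^sup>2 = 2 * ((norm A)\<^sup>2 * (norm Z)\<^sup>2 + (norm A)\<^sup>2 * (norm W)\<^sup>2)"
    unfolding distrib_left[symmetric] by simp
  moreover have "(A \<bullet> (Z + W))\<^sup>2 + (A \<bullet> (Z - W))\<^sup>2 = 2 * ((A \<bullet> Z)\<^sup>2 + (A \<bullet> W)\<^sup>2)"
    by (simp add: inner_add_right inner_diff_right power2_eq_square algebra_simps)
  ultimately show ?thesis unfolding s unfolding two_well_form_def
    by (rule aux)
qed

text \<open>\<open>|Z - A|\<^sup>2\<close> and \<open>|Z + A|\<^sup>2\<close> are \<open>|Z|\<^sup>2 + |A|\<^sup>2\<close> minus and plus \<open>2 * (A \<bullet> Z)\<close>.\<close>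

lemma two_well_product_eq:
  fixes Z A :: "real^'n^'n"
  shows "(norm (Z - A))\<^sup>2 * (norm (Z + A))\<^sup>2 = norm Z ^ 4 + 2 * two_well_form A Z + norm A ^ 4"
proof -
  have "(norm (Z - A))\<^sup>2 = (norm Z)\<^sup>2 + (norm A)\<^sup>2 - 2 * (A \<bullet> Z)"
    "(norm (Z + A))\<^sup>2 = (norm Z)\<^sup>2 + (norm A)\<^sup>2 + 2 * (A \<bullet> Z)"
    unfolding power2_norm_eq_inner by (simp_all add: inner_diff_left inner_diff_right inner_add_left inner_add_right inner_commute)
  moreover have "(z + a - 2 * p) * (z + a + 2 * p) = z\<^sup>2 + 2 * (a * z - 2 * p\<^sup>2) + a\<^sup>2" for z a p :: real
    by (simp add: power2_eq_square algebra_simps)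
  ultimately show ?thesis by (simp add: two_well_form_def)
qed

text \<open>In coordinates centred at the midpoint of the wells, Clarkson's inequality for the quartic part is added to
  the parallelogram law for the quadratic part. The quadratic defect has no sign pointwise.\<close>

lemma two_well_uniform_convexity:
  fixes X1 X2 X Y :: "real^'n^'n"
  defines "f \<equiv> \<lambda>X. (norm (X - X1))\<^sup>2 * (norm (X - X2))\<^sup>2" and "A \<equiv> (1/2) *\<^sub>R (X1 - X2)"
  shows "f ((1/2) *\<^sub>R X + (1/2) *\<^sub>R Y) + norm ((1/2) *\<^sub>R X - (1/2) *\<^sub>R Y) ^ 4
      + 2 * two_well_form A ((1/2) *\<^sub>R X - (1/2) *\<^sub>R Y) \<le> (f X + f Y) / 2"
proof -
  define C where "C = (1/2) *\<^sub>R (X1 + X2)"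
  have f: "f V = norm (V - C) ^ 4 + 2 * two_well_form A (V - C) + norm A ^ 4" for V
  proof -
    have e: "V - C - A = V - X1" "V - C + A = V - X2"
      unfolding C_def A_def by (simp_all add: algebra_simps flip: scaleR_add_left)
    show ?thesis unfolding two_well_product_eq[symmetric] e f_def ..
  qed
  define Z W where "Z = X - C" and "W = Y - C"
  have 1: "(1/2) *\<^sub>R X + (1/2) *\<^sub>R Y - C = (1/2) *\<^sub>R (Z + W)"
  proof -
    have "Z + W = X + Y - (C + C)" by (simp add: Z_def W_def)
    then have "(1/2) *\<^sub>R (Z + W) = (1/2) *\<^sub>R (X + Y) - C"
      by (simp only: scaleR_diff_right scaleR_half_double)
    then show ?thesis by (simp only: scaleR_add_right)
  qed
  have 2: "(1/2) *\<^sub>R X - (1/2) *\<^sub>R Y = (1/2) *\<^sub>R (Z - W)"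
    unfolding Z_def W_def by (simp add: algebra_simps)
  have 3: "X - C = Z" "Y - C = W" by (simp_all add: Z_def W_def)
  show ?thesis
    unfolding f 1 2 3
    using norm_power4_midpoint[of Z W] two_well_form_parallelogram[of A Z W] by (simp add: field_simps)
qed

section \<open>Fourth powers on a bounded open set\<close>

locale bounded_open_set =
  fixes \<Omega> :: "(real^'n) set"
  assumes open_domain: "open \<Omega>" and bounded_domain: "bounded \<Omega>"
begin

abbreviation M where "M \<equiv> lebesgue_on \<Omega>"

text \<open>The fourth power of the norm of \<open>L\<^sup>4\<close>. It replaces the norm throughout, which avoids roots at the
  cost of a factor \<open>8\<close> in the triangle inequality.\<close>

definition N4 :: "(real^'n \<Rightarrow> 'b::euclidean_space) \<Rightarrow> real" where
  "N4 g = (LINT x|M. norm (g x) ^ 4)"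

lemma domain_sets: "\<Omega> \<inter> space lebesgue \<in> sets lebesgue"
  using open_domain by simp

sublocale finite_measure M
proof
  have "emeasure lebesgue \<Omega> < \<infinity>"
    using emeasure_bounded_finite[OF bounded_domain] open_domain by simp
  then show "emeasure M (space M) \<noteq> \<infinity>"
    using open_domain by (simp add: emeasure_restrict_space)
qed

lemma L4_iff: "g \<in> L_p 4 \<Omega> \<longleftrightarrow> g \<in> borel_measurable M \<and> integrable M (\<lambda>x. norm (g x) ^ 4)"
  by (simp add: L_p_def powr_numeral)

lemma N4_nonneg: "0 \<le> N4 g"
  by (simp add: N4_def)

lemma N4_cong_AE:
  assumes "AE x in M. f x = g x" "f \<in> borel_measurable M" "g \<in> borel_measurable M"
  shows "N4 f = N4 g"
  unfolding N4_def using assms by (intro integral_cong_AE) auto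

text \<open>The measure is finite, so the constant summand is integrable.\<close>

lemma integrable_by_L4:
  fixes h :: "real^'n \<Rightarrow> 'c::euclidean_space"
  assumes g: "g \<in> L_p 4 \<Omega>" and h: "h \<in> borel_measurable M"
    and le: "\<And>x. norm (h x) \<le> c * (1 + norm (g x) ^ 4)"
  shows "integrable M h"
proof (rule Bochner_Integration.integrable_bound[OF _ h])
  show "integrable M (\<lambda>x. c * (1 + norm (g x) ^ 4))"
    using g by (auto simp: L4_iff)
  show "AE x in M. norm (h x) \<le> norm (c * (1 + norm (g x) ^ 4))"
    using le by (intro AE_I2) (metis abs_ge_self order_trans real_norm_def)
qed

lemma L4_integrable: "g \<in> L_p 4 \<Omega> \<Longrightarrow> integrable M g"
  by (rule integrable_by_L4[where c = 1]) (auto simp: L4_iff le_one_plus_power4)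

lemma L4_lincomb:
  fixes f g :: "real^'n \<Rightarrow> 'b::euclidean_space"
  assumes f: "f \<in> L_p 4 \<Omega>" and g: "g \<in> L_p 4 \<Omega>"
  shows "(\<lambda>x. a *\<^sub>R f x + b *\<^sub>R g x) \<in> L_p 4 \<Omega>"
    and "N4 (\<lambda>x. a *\<^sub>R f x + b *\<^sub>R g x) \<le> 8 * (a ^ 4 * N4 f + b ^ 4 * N4 g)"
proof -
  have m: "(\<lambda>x. a *\<^sub>R f x + b *\<^sub>R g x) \<in> borel_measurable M"
    using f g by (auto simp: L4_iff)
  have int: "integrable M (\<lambda>x. 8 * (a ^ 4 * norm (f x) ^ 4 + b ^ 4 * norm (g x) ^ 4))"
    using f g by (auto simp: L4_iff)
  have le: "norm (a *\<^sub>R f x + b *\<^sub>R g x) ^ 4 \<le> 8 * (a ^ 4 * norm (f x) ^ 4 + b ^ 4 * norm (g x) ^ 4)" for x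
    using norm_add_power4_le[of "a *\<^sub>R f x" "b *\<^sub>R g x"] by (simp add: power_mult_distrib)
  have int': "integrable M (\<lambda>x. norm (a *\<^sub>R f x + b *\<^sub>R g x) ^ 4)"
    by (rule Bochner_Integration.integrable_bound[OF int])
      (use m le in \<open>auto intro!: AE_I2 order_trans[OF le abs_ge_self]\<close>)
  then show "(\<lambda>x. a *\<^sub>R f x + b *\<^sub>R g x) \<in> L_p 4 \<Omega>" using m by (simp add: L4_iff)
  have "N4 (\<lambda>x. a *\<^sub>R f x + b *\<^sub>R g x) \<le> (LINT x|M. 8 * (a ^ 4 * norm (f x) ^ 4 + b ^ 4 * norm (g x) ^ 4))"
    unfolding N4_def using int' int le by (rule integral_mono)
  also have "\<dots> = 8 * (a ^ 4 * N4 f + b ^ 4 * N4 g)"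
    using f g by (simp add: N4_def L4_iff)
  finally show "N4 (\<lambda>x. a *\<^sub>R f x + b *\<^sub>R g x) \<le> 8 * (a ^ 4 * N4 f + b ^ 4 * N4 g)" .
qed

lemma L4_add: "f \<in> L_p 4 \<Omega> \<Longrightarrow> g \<in> L_p 4 \<Omega> \<Longrightarrow> (\<lambda>x. f x + g x) \<in> L_p 4 \<Omega>"
  and N4_add_le: "f \<in> L_p 4 \<Omega> \<Longrightarrow> g \<in> L_p 4 \<Omega> \<Longrightarrow> N4 (\<lambda>x. f x + g x) \<le> 8 * (N4 f + N4 g)"
  using L4_lincomb[of f g 1 1] by simp_all

lemma L4_diff: "f \<in> L_p 4 \<Omega> \<Longrightarrow> g \<in> L_p 4 \<Omega> \<Longrightarrow> (\<lambda>x. f x - g x) \<in> L_p 4 \<Omega>"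
  using L4_lincomb(1)[of f g 1 "-1"] by simp

lemma N4_commute: "N4 (\<lambda>x. f x - g x) = N4 (\<lambda>x. g x - f x)"
  by (simp add: N4_def norm_minus_commute)

lemma N4_le_split:
  assumes "f \<in> L_p 4 \<Omega>" "g \<in> L_p 4 \<Omega>"
  shows "N4 f \<le> 8 * (N4 (\<lambda>x. f x - g x) + N4 g)"
  using N4_add_le[OF L4_diff[OF assms] assms(2)] by simp

lemma N4_triangle:
  assumes "f \<in> L_p 4 \<Omega>" "g \<in> L_p 4 \<Omega>" "h \<in> L_p 4 \<Omega>"
  shows "N4 (\<lambda>x. f x - h x) \<le> 8 * (N4 (\<lambda>x. f x - g x) + N4 (\<lambda>x. g x - h x))"
  using N4_add_le[OF L4_diff[OF assms(1,2)] L4_diff[OF assms(2,3)]] by simp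

lemma N4_eq_0_imp_AE:
  assumes "f \<in> L_p 4 \<Omega>" "N4 f \<le> 0"
  shows "AE x in M. f x = 0"
proof -
  have "N4 f = 0" using assms(2) N4_nonneg[of f] by simp
  then have "AE x in M. norm (f x) ^ 4 = 0"
    using assms(1) integral_nonneg_eq_0_iff_AE[of M "\<lambda>x. norm (f x) ^ 4"] by (simp add: N4_def L4_iff)
  then show ?thesis by eventually_elim simp
qed

text \<open>Completeness of Lebesgue measure, for functions given only on \<open>\<Omega>\<close>.\<close>

lemma borel_measurable_AE_on:
  fixes f g :: "real^'n \<Rightarrow> 'b::euclidean_space"
  assumes "f \<in> borel_measurable M" "AE x in M. f x = g x"
  shows "g \<in> borel_measurable M"
proof -
  have "(\<lambda>x. indicator \<Omega> x *\<^sub>R f x) \<in> borel_measurable lebesgue"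
    using assms(1) borel_measurable_restrict_space_iff[OF domain_sets] by blast
  moreover have "AE x in lebesgue. indicator \<Omega> x *\<^sub>R f x = indicator \<Omega> x *\<^sub>R g x"
    using assms(2) unfolding AE_restrict_space_iff[OF domain_sets] by eventually_elim (auto simp: indicator_def)
  ultimately have "(\<lambda>x. indicator \<Omega> x *\<^sub>R g x) \<in> borel_measurable lebesgue" by (rule borel_measurable_AE)
  then show ?thesis using borel_measurable_restrict_space_iff[OF domain_sets] by blast
qed

lemma L4_AE_cong:
  fixes f g :: "real^'n \<Rightarrow> 'b::euclidean_space"
  assumes "f \<in> L_p 4 \<Omega>" "AE x in M. f x = g x"
  shows "g \<in> L_p 4 \<Omega>"
proof -
  have g: "g \<in> borel_measurable M" using assms by (auto simp: L4_iff intro: borel_measurable_AE_on)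
  have "integrable M (\<lambda>x. norm (f x) ^ 4) \<longleftrightarrow> integrable M (\<lambda>x. norm (g x) ^ 4)"
    using assms g by (intro integrable_cong_AE) (auto simp: L4_iff)
  then show ?thesis using assms(1) g by (simp add: L4_iff)
qed

lemma integrable_imp_locally_integrable:
  fixes g :: "real^'n \<Rightarrow> 'b::euclidean_space"
  assumes "integrable M g"
  shows "locally_integrable \<Omega> g"
  unfolding locally_integrable_def set_integrable_def
proof safe
  fix K assume K: "compact K" "K \<subseteq> \<Omega>"
  have "integrable lebesgue (\<lambda>x. indicator \<Omega> x *\<^sub>R g x)"
    using assms by (simp add: integrable_restrict_space[OF domain_sets])
  moreover have "K \<in> sets lebesgue" using borel_compact[OF K(1)] by simp
  ultimately have "integrable lebesgue (\<lambda>x. indicator K x *\<^sub>R (indicator \<Omega> x *\<^sub>R g x))"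
    by (rule integrable_mult_indicator[rotated])
  moreover have "indicator K x *\<^sub>R (indicator \<Omega> x *\<^sub>R g x) = indicator K x *\<^sub>R g x" for x
    using K(2) by (auto simp: indicator_def)
  ultimately show "integrable lebesgue (\<lambda>x. indicator K x *\<^sub>R g x)" by (simp only:)
qed

lemma locally_integrable_lincomb:
  assumes "locally_integrable \<Omega> f" "locally_integrable \<Omega> g"
  shows "locally_integrable \<Omega> (\<lambda>x. a *\<^sub>R f x + b *\<^sub>R g x)"
  using assms unfolding locally_integrable_def by (auto intro!: set_integral_add)

lemma locally_integrable_bounded_linear:
  assumes "locally_integrable \<Omega> f" "bounded_linear T"
  shows "locally_integrable \<Omega> (\<lambda>x. T (f x))"
proof -
  interpret bounded_linear T by fact
  show ?thesis
    using assms integrable_bounded_linear[OF assms(2)]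
    unfolding locally_integrable_def set_integrable_def by (auto simp: scaleR[symmetric])
qed

lemma integral_domain_eq_lborel:
  fixes f :: "real^'n \<Rightarrow> real"
  assumes "f \<in> borel_measurable borel" "\<And>x. x \<notin> \<Omega> \<Longrightarrow> f x = 0"
  shows "(LINT x|M. f x) = (LINT x|lborel. f x)"
proof -
  have i: "indicator \<Omega> x *\<^sub>R f x = f x" for x using assms(2)[of x] by (auto simp: indicator_def)
  have "(LINT x|M. f x) = (LINT x|lebesgue. indicator \<Omega> x *\<^sub>R f x)"
    by (rule integral_restrict_space[OF domain_sets])
  also have "\<dots> = (LINT x|lebesgue. f x)" by (simp only: i)
  also have "\<dots> = (LINT x|lborel. f x)" using assms(1) by (intro integral_completion) simp
  finally show ?thesis .
qed

text \<open>Completeness of \<open>L\<^sup>4\<close> for sequences that are Cauchy at a geometric rate: the weighted increments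
  have a finite integral, so almost everywhere the increments are summable, and Fatou's lemma
  transfers the rate to the limit.\<close>

lemma L4_complete_rate:
  fixes f :: "nat \<Rightarrow> real^'n \<Rightarrow> 'b::euclidean_space"
  assumes f: "\<And>k. f k \<in> L_p 4 \<Omega>"
    and cauchy: "\<And>k l. k \<le> l \<Longrightarrow> N4 (\<lambda>x. f l x - f k x) \<le> c * (1/4) ^ k"
  obtains g where "g \<in> L_p 4 \<Omega>" "AE x in M. (\<lambda>k. f k x) \<longlonglongrightarrow> g x"
    "\<And>k. N4 (\<lambda>x. g x - f k x) \<le> c * (1/4) ^ k"
proof -
  have fm: "f k \<in> borel_measurable M" for k using f by (auto simp: L4_iff)
  have di: "integrable M (\<lambda>x. norm (f l x - f k x) ^ 4)" for k l
    using L4_diff[OF f f] by (simp add: L4_iff)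
  \<comment> \<open>The fourth powers of the increments have integrals at most \<open>c / 4 ^ k\<close>, so the weights \<open>2 ^ k\<close> leave a
    convergent series of integrals.\<close>
  define s where "s k x = 2 ^ k * norm (f (Suc k) x - f k x) ^ 4" for k x
  have si: "integrable M (s k)" for k unfolding s_def using di by simp
  have "AE x in M. summable (\<lambda>k. norm (s k x))"
  proof (rule AE_I2[THEN AE_mp], rule AE_mp)
    show "AE x in M. (\<Sum>k. ennreal (s k x)) \<noteq> \<infinity>"
    proof (rule nn_integral_PInf_AE)
      show "(\<lambda>x. \<Sum>k. ennreal (s k x)) \<in> borel_measurable M"
        using si by (intro borel_measurable_suminf_order measurable_compose[OF _ measurable_ennreal] borel_measurable_integrable)
      have "(\<integral>\<^sup>+x. (\<Sum>k. ennreal (s k x)) \<partial>M) = (\<Sum>k. \<integral>\<^sup>+x. ennreal (s k x) \<partial>M)"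
        using si by (intro nn_integral_suminf measurable_compose[OF _ measurable_ennreal] borel_measurable_integrable)
      also have "\<dots> \<le> (\<Sum>k. ennreal (c * (1/2) ^ k))"
      proof (intro suminf_le summableI)
        fix k
        have "(\<integral>\<^sup>+x. ennreal (s k x) \<partial>M) = ennreal (LINT x|M. s k x)"
          by (intro nn_integral_eq_integral si) (simp add: s_def)
        also have "(LINT x|M. s k x) = 2 ^ k * N4 (\<lambda>x. f (Suc k) x - f k x)"
          by (simp add: s_def N4_def)
        also have "\<dots> \<le> 2 ^ k * (c * (1/4) ^ k)" by (intro mult_left_mono cauchy) auto
        also have "\<dots> = c * (1/2) ^ k" by (simp add: power_divide field_simps flip: power_mult_distrib)
        finally show "(\<integral>\<^sup>+x. ennreal (s k x) \<partial>M) \<le> ennreal (c * (1/2) ^ k)" by (simp add: ennreal_leI)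
      qed
      also have "\<dots> < \<infinity>"
      proof -
        have "0 \<le> c" using order_trans[OF N4_nonneg cauchy[of 0 0]] by simp
        then have "(\<Sum>k. ennreal (c * (1/2) ^ k)) = ennreal (\<Sum>k. c * (1/2) ^ k)"
          by (intro suminf_ennreal2) (auto intro!: summable_mult summable_geometric)
        then show ?thesis by simp
      qed
      finally show "(\<integral>\<^sup>+x. (\<Sum>k. ennreal (s k x)) \<partial>M) \<noteq> \<infinity>" by simp
    qed
    show "AE x in M. (\<Sum>k. ennreal (s k x)) \<noteq> \<infinity> \<longrightarrow> summable (\<lambda>k. s k x)"
      by (intro AE_I2 impI summable_suminf_not_top) (auto simp: s_def)
  qed (simp add: s_def)
  then have conv: "AE x in M. convergent (\<lambda>k. f k x)"
  proof eventually_elim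
    case (elim x)
    then have "(\<lambda>k. norm (s k x)) \<longlonglongrightarrow> 0" by (rule summable_LIMSEQ_zero)
    then have "Bseq (\<lambda>k. norm (s k x))" by (simp add: convergent_imp_Bseq convergentI)
    then obtain B where B: "0 < B" "\<And>k. s k x \<le> B" by (auto simp: Bseq_def abs_le_iff)
    \<comment> \<open>The bound \<open>B / 2 ^ k\<close> on the fourth power becomes geometric with ratio \<open>2 powr (- 1 / 4)\<close>.\<close>
    define q :: real where "q = 1 / root 4 2"
    have q: "0 < q" "q < 1" "q ^ 4 = 1 / 2" by (auto simp: q_def power_divide)
    have step: "norm (f (Suc k) x - f k x) \<le> root 4 B * q ^ k" for k
    proof (rule power_le_imp_le_base[of _ 3])
      have "norm (f (Suc k) x - f k x) ^ 4 \<le> B * (1/2) ^ k"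
        using B(2)[of k] by (simp add: s_def field_simps power_divide)
      also have "\<dots> = (root 4 B * q ^ k) ^ 4"
        using B(1) by (simp add: power_mult_distrib flip: q(3) power_mult) (simp add: mult.commute)
      finally show "norm (f (Suc k) x - f k x) ^ Suc 3 \<le> (root 4 B * q ^ k) ^ Suc 3" by simp
      show "0 \<le> root 4 B * q ^ k" using B q by simp
    qed
    have "summable (\<lambda>k. root 4 B * q ^ k)"
      using q by (intro summable_mult summable_geometric) simp
    then have "summable (\<lambda>k. norm (f (Suc k) x - f k x))"
      by (rule summable_comparison_test'[where N = 0]) (simp add: step)
    then have "summable (\<lambda>k. f (Suc k) x - f k x)" by (rule summable_norm_cancel)
    then have "convergent (\<lambda>n. \<Sum>k<n. f (Suc k) x - f k x)" by (simp add: summable_iff_convergent)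
    then have "convergent (\<lambda>n. f n x - f 0 x)" by (simp only: sum_lessThan_telescope[where f = "\<lambda>n. f n x"])
    then show ?case by (simp add: convergent_diff_const_right_iff)
  qed
  define g where "g x = lim (\<lambda>k. f k x)" for x
  have lim: "AE x in M. (\<lambda>k. f k x) \<longlonglongrightarrow> g x"
    using conv by eventually_elim (simp add: g_def convergent_LIMSEQ_iff)
  have gm: "g \<in> borel_measurable M"
    unfolding g_def [abs_def] by (rule borel_measurable_lim_metric[OF fm])
  have c0: "0 \<le> c" using order_trans[OF N4_nonneg cauchy[of 0 0]] by simp
  have fatou: "(\<integral>\<^sup>+x. ennreal (norm (g x - f k x) ^ 4) \<partial>M) \<le> ennreal (c * (1/4) ^ k)" for k
  proof -
    have "(\<integral>\<^sup>+x. ennreal (norm (g x - f k x) ^ 4) \<partial>M)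
        = (\<integral>\<^sup>+x. liminf (\<lambda>l. ennreal (norm (f l x - f k x) ^ 4)) \<partial>M)"
    proof (rule nn_integral_cong_AE, use lim in eventually_elim)
      fix x assume "(\<lambda>k. f k x) \<longlonglongrightarrow> g x"
      then have "(\<lambda>l. ennreal (norm (f l x - f k x) ^ 4)) \<longlonglongrightarrow> ennreal (norm (g x - f k x) ^ 4)"
        by (intro tendsto_intros)
      then show "ennreal (norm (g x - f k x) ^ 4) = liminf (\<lambda>l. ennreal (norm (f l x - f k x) ^ 4))"
        by (rule lim_imp_Liminf[OF sequentially_bot, symmetric])
    qed
    also have "\<dots> \<le> liminf (\<lambda>l. \<integral>\<^sup>+x. ennreal (norm (f l x - f k x) ^ 4) \<partial>M)"
      using fm by (intro nn_integral_liminf) auto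
    also have "\<dots> \<le> ennreal (c * (1/4) ^ k)"
    proof (rule Liminf_le)
      have "(\<integral>\<^sup>+x. ennreal (norm (f l x - f k x) ^ 4) \<partial>M) \<le> ennreal (c * (1/4) ^ k)" if "k \<le> l" for l
        using cauchy[OF that] nn_integral_eq_integral[OF di, of l k] by (simp add: N4_def ennreal_leI)
      then show "\<forall>\<^sub>F l in sequentially. (\<integral>\<^sup>+x. ennreal (norm (f l x - f k x) ^ 4) \<partial>M) \<le> ennreal (c * (1/4) ^ k)"
        by (rule eventually_sequentiallyI)
    qed simp
    finally show ?thesis .
  qed
  have gi: "integrable M (\<lambda>x. norm (g x - f k x) ^ 4)" for k
    unfolding integrable_iff_bounded using fatou[of k] fm gm by (auto intro: le_less_trans)
  have bound: "N4 (\<lambda>x. g x - f k x) \<le> c * (1/4) ^ k" for k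
    using fatou[of k] nn_integral_eq_integral[OF gi, of k] c0 by (simp add: N4_def)
  have "(\<lambda>x. g x - f 0 x) \<in> L_p 4 \<Omega>" using gi[of 0] gm fm by (simp add: L4_iff)
  from L4_add[OF this f[of 0]] have "g \<in> L_p 4 \<Omega>" by simp
  then show ?thesis using lim bound that by blast
qed

lemma N4_tendsto_imp_L1:
  fixes d :: "nat \<Rightarrow> real^'n \<Rightarrow> 'b::euclidean_space"
  assumes d: "\<And>k. d k \<in> L_p 4 \<Omega>" and lim: "(\<lambda>k. N4 (d k)) \<longlonglongrightarrow> 0"
  shows "(\<lambda>k. LINT x|M. norm (d k x)) \<longlonglongrightarrow> 0"
proof (rule LIMSEQ_I)
  fix r :: real assume r: "0 < r"
  define m where "m = measure M (space M)"
  have m: "0 \<le> m" by (simp add: m_def)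
  define e where "e = r / (2 * (m + 1))"
  have e: "0 < e" using r m by (simp add: e_def)
  have "e * m < e * (m + 1)" using e by simp
  also have "\<dots> = r / 2" using m by (simp add: e_def nonzero_divide_eq_eq) (simp add: algebra_simps)?
  finally have em: "e * m < r / 2" .
  have "0 < e ^ 3 * (r / 2)" using e r by simp
  from order_tendstoD(2)[OF lim this] obtain K where K: "\<forall>k\<ge>K. N4 (d k) < e ^ 3 * (r / 2)"
    unfolding eventually_sequentially by (rule exE)
  \<comment> \<open>Where \<open>norm (d k x) > e\<close>, the norm is at most \<open>norm (d k x) ^ 4 / e ^ 3\<close>.\<close>
  have bound: "(LINT x|M. norm (d k x)) \<le> e * m + N4 (d k) / e ^ 3" for k
  proof -
    have "(LINT x|M. norm (d k x)) \<le> (LINT x|M. e + norm (d k x) ^ 4 / e ^ 3)"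
    proof (rule integral_mono)
      show "integrable M (\<lambda>x. norm (d k x))" using L4_integrable[OF d] by simp
      show "integrable M (\<lambda>x. e + norm (d k x) ^ 4 / e ^ 3)" using d[of k] by (auto simp: L4_iff)
      fix x
      show "norm (d k x) \<le> e + norm (d k x) ^ 4 / e ^ 3"
      proof (cases "norm (d k x) \<le> e")
        case False
        then have "norm (d k x) * e ^ 3 \<le> norm (d k x) * norm (d k x) ^ 3"
          using e by (intro mult_left_mono power_mono) auto
        also have "\<dots> = norm (d k x) ^ 4" by (simp add: power4_eq_xxxx power3_eq_cube)
        finally have "norm (d k x) \<le> norm (d k x) ^ 4 / e ^ 3" using e by (simp add: field_simps)
        then show ?thesis using e by linarith
      qed (use e in \<open>simp add: add_increasing2\<close>)
    qed
    also have "\<dots> = e * m + N4 (d k) / e ^ 3"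
      using d[of k] by (simp add: N4_def m_def L4_iff)
    finally show ?thesis .
  qed
  have "norm ((LINT x|M. norm (d k x)) - 0) < r" if "K \<le> k" for k
  proof -
    have "N4 (d k) / e ^ 3 < r / 2" using K[rule_format, OF that] e by (simp add: field_simps)
    with bound[of k] em have "(LINT x|M. norm (d k x)) < r" by linarith
    then show ?thesis by simp
  qed
  then show "\<exists>K. \<forall>k\<ge>K. norm ((LINT x|M. norm (d k x)) - 0) < r"
    by (intro exI[of _ K] allI impI)
qed

lemma integral_mult_tendsto:
  fixes f :: "nat \<Rightarrow> real^'n \<Rightarrow> 'b::euclidean_space"
  assumes f: "\<And>k. f k \<in> L_p 4 \<Omega>" and g: "g \<in> L_p 4 \<Omega>"
    and lim: "(\<lambda>k. N4 (\<lambda>x. g x - f k x)) \<longlonglongrightarrow> 0"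
    and T: "bounded_linear T" and le: "\<And>v. \<bar>T v\<bar> \<le> norm v"
    and h: "h \<in> borel_measurable M" "\<And>x. \<bar>h x\<bar> \<le> B"
  shows "(\<lambda>k. LINT x|M. T (f k x) * h x) \<longlonglongrightarrow> (LINT x|M. T (g x) * h x)"
proof -
  have Tm: "(\<lambda>x. T (w x)) \<in> borel_measurable M" if "w \<in> L_p 4 \<Omega>" for w :: "real^'n \<Rightarrow> 'b"
    using borel_measurable_integrable[OF integrable_bounded_linear[OF T L4_integrable[OF that]]] .
  have b: "\<bar>T v * h x\<bar> \<le> norm v * B" for v x
    unfolding abs_mult using le h(2) by (intro mult_mono) auto
  have int: "integrable M (\<lambda>x. T (w x) * h x)" if "w \<in> L_p 4 \<Omega>" for w :: "real^'n \<Rightarrow> 'b"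
  proof (rule Bochner_Integration.integrable_bound)
    show "integrable M (\<lambda>x. norm (w x) * B)" using L4_integrable[OF that] by simp
    show "(\<lambda>x. T (w x) * h x) \<in> borel_measurable M" using Tm[OF that] h(1) by simp
    show "AE x in M. norm (T (w x) * h x) \<le> norm (norm (w x) * B)"
      using b by (intro AE_I2) (metis abs_ge_self order_trans real_norm_def)
  qed
  have d: "(\<lambda>x. g x - f k x) \<in> L_p 4 \<Omega>" for k by (rule L4_diff[OF g f])
  have "(\<lambda>k. (LINT x|M. T (g x) * h x) - (LINT x|M. T (f k x) * h x)) \<longlonglongrightarrow> 0"
  proof (rule Lim_null_comparison)
    show "(\<lambda>k. (LINT x|M. norm (g x - f k x)) * B) \<longlonglongrightarrow> 0"
      using tendsto_mult_right[OF N4_tendsto_imp_L1[OF d lim], of B] by simp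
    have "norm ((LINT x|M. T (g x) * h x) - (LINT x|M. T (f k x) * h x)) \<le> (LINT x|M. norm (g x - f k x)) * B" for k
    proof -
      have "(LINT x|M. T (g x) * h x) - (LINT x|M. T (f k x) * h x) = (LINT x|M. T (g x) * h x - T (f k x) * h x)"
        using int[OF g] int[OF f] by simp
      also have "\<dots> = (LINT x|M. T (g x - f k x) * h x)"
        by (simp add: linear_diff[OF bounded_linear.linear[OF T]] left_diff_distrib)
      finally have "norm ((LINT x|M. T (g x) * h x) - (LINT x|M. T (f k x) * h x)) = norm (LINT x|M. T (g x - f k x) * h x)"
        by (rule arg_cong)
      also have "\<dots> \<le> (LINT x|M. norm (g x - f k x) * B)"
      proof (rule Bochner_Integration.integral_norm_bound_integral)
        show "integrable M (\<lambda>x. T (g x - f k x) * h x)" by (rule int[OF d])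
        show "integrable M (\<lambda>x. norm (g x - f k x) * B)" using L4_integrable[OF d[of k]] by simp
        show "norm (T (g x - f k x) * h x) \<le> norm (g x - f k x) * B" for x
          unfolding real_norm_def by (rule b)
      qed
      finally show ?thesis by simp
    qed
    then show "\<forall>\<^sub>F k in sequentially. norm ((LINT x|M. T (g x) * h x) - (LINT x|M. T (f k x) * h x)) \<le> (LINT x|M. norm (g x - f k x)) * B"
      by simp
  qed
  from tendsto_diff[OF tendsto_const[of "LINT x|M. T (g x) * h x"] this] show ?thesis by simp
qed

lemma domain_subset_cball: obtains r where "0 < r" "\<Omega> \<subseteq> cball 0 r"
proof -
  obtain r where "0 < r" "\<forall>x\<in>\<Omega>. norm x \<le> r" using bounded_domain[unfolded bounded_pos] by (elim exE conjE)
  then show ?thesis by (intro that[of r]) auto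
qed

section \<open>Weak gradients\<close>

abbreviation vector_test_function :: "(real^'n \<Rightarrow> real^'n) \<Rightarrow> bool" where
  "vector_test_function \<phi> \<equiv> (\<forall>i. test_function \<Omega> (\<lambda>x. \<phi> x $ i))"

definition gradient :: "(real^'n \<Rightarrow> real^'n) \<Rightarrow> real^'n \<Rightarrow> real^'n^'n" where
  "gradient \<phi> x = (\<chi> i j. partial_deriv j (\<lambda>x. \<phi> x $ i) x)"

lemma test_function_C1_c: "test_function \<Omega> \<phi> \<Longrightarrow> C1_c \<phi>"
  unfolding test_function_def C1_c_def
  using bounded_subset[OF compact_imp_bounded closure_subset] by blast

lemma test_function_zero_outside:
  assumes "test_function \<Omega> \<phi>" "x \<notin> \<Omega>"
  shows "\<phi> x = 0" "partial_deriv j \<phi> x = 0"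
proof -
  have "x \<notin> closure {x. \<phi> x \<noteq> 0}" using assms by (auto simp: test_function_def)
  then show "partial_deriv j \<phi> x = 0" "\<phi> x = 0"
    using partial_deriv_zero_outside closure_subset[of "{x. \<phi> x \<noteq> 0}"] by auto
qed

lemma test_function_lincomb:
  assumes "test_function \<Omega> \<phi>" "test_function \<Omega> \<psi>"
  shows "test_function \<Omega> (\<lambda>x. a * \<phi> x + b * \<psi> x)"
proof -
  let ?S = "closure {x. a * \<phi> x + b * \<psi> x \<noteq> 0}"
  let ?K = "closure {x. \<phi> x \<noteq> 0} \<union> closure {x. \<psi> x \<noteq> 0}"
  have "{x. a * \<phi> x + b * \<psi> x \<noteq> 0} \<subseteq> {x. \<phi> x \<noteq> 0} \<union> {x. \<psi> x \<noteq> 0}" by auto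
  then have sub: "?S \<subseteq> ?K" unfolding closure_Un[symmetric] by (rule closure_mono)
  have "compact ?K" using assms by (auto simp: test_function_def)
  then have "bounded ?S" using sub by (meson bounded_subset compact_imp_bounded)
  then have "compact ?S" by (simp add: compact_eq_bounded_closed)
  moreover have "?S \<subseteq> \<Omega>" using sub assms by (auto simp: test_function_def)
  moreover have "\<forall>k. C_k k (\<lambda>x. a * \<phi> x + b * \<psi> x)"
    using assms by (auto simp: test_function_def intro!: C_k_add C_k_mult C_k_const)
  ultimately show ?thesis by (simp add: test_function_def)
qed

lemma test_function_continuous:
  assumes "test_function \<Omega> \<phi>"
  shows "continuous_on UNIV \<phi>" "continuous_on UNIV (partial_deriv j \<phi>)"
  using C1_c_continuous C1_c_continuous_partial test_function_C1_c[OF assms] by auto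

lemma borel_imp_measurable_domain:
  "f \<in> borel_measurable borel \<Longrightarrow> f \<in> borel_measurable M"
  by (intro measurable_restrict_space1 measurable_completion) simp

text \<open>The factor \<open>f\<close> stands for a test function or one of its derivatives.\<close>

lemma integrable_mult_test:
  fixes g :: "real^'n \<Rightarrow> real"
  assumes g: "locally_integrable \<Omega> g" and \<phi>: "test_function \<Omega> \<phi>"
    and f: "continuous_on UNIV f" "\<And>x. x \<notin> closure {x. \<phi> x \<noteq> 0} \<Longrightarrow> f x = 0" "\<And>x. \<bar>f x\<bar> \<le> B"
  shows "integrable M (\<lambda>x. g x * f x)"
proof -
  let ?K = "closure {x. \<phi> x \<noteq> 0}"
  have K: "compact ?K" "?K \<subseteq> \<Omega>" using \<phi> by (auto simp: test_function_def)
  have int: "integrable lebesgue (\<lambda>x. indicator ?K x *\<^sub>R g x)"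
    using g K by (auto simp: locally_integrable_def set_integrable_def)
  have "f \<in> borel_measurable lebesgue"
    using borel_measurable_continuous_onI[OF f(1)] by (intro measurable_completion) simp
  with borel_measurable_integrable[OF int]
  have m: "(\<lambda>x. (indicator ?K x *\<^sub>R g x) * f x) \<in> borel_measurable lebesgue"
    by (rule borel_measurable_times)
  have "integrable lebesgue (\<lambda>x. B * (indicator ?K x *\<^sub>R g x))" using int by simp
  then have "integrable lebesgue (\<lambda>x. (indicator ?K x *\<^sub>R g x) * f x)"
  proof (rule Bochner_Integration.integrable_bound[OF _ m])
    have "\<bar>f x\<bar> \<le> \<bar>B\<bar>" for x using f(3)[of x] by linarith
    then show "AE x in lebesgue. norm ((indicator ?K x *\<^sub>R g x) * f x) \<le> norm (B * (indicator ?K x *\<^sub>R g x))"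
      by (intro AE_I2) (auto simp: abs_mult mult.commute intro!: mult_right_mono)
  qed
  moreover have "(indicator ?K x *\<^sub>R g x) * f x = indicator \<Omega> x *\<^sub>R (g x * f x)" for x
    using K(2) f(2)[of x] by (auto simp: indicator_def)
  ultimately show ?thesis unfolding integrable_restrict_space[OF domain_sets] by (simp only:)
qed

lemma integrable_mult_test_function:
  fixes g :: "real^'n \<Rightarrow> real"
  assumes g: "locally_integrable \<Omega> g" and \<phi>: "test_function \<Omega> \<phi>"
  shows "integrable M (\<lambda>x. g x * \<phi> x)" "integrable M (\<lambda>x. g x * partial_deriv j \<phi> x)"
proof -
  obtain R B where b: "0 < R" "0 \<le> B" "\<And>x. \<bar>\<phi> x\<bar> \<le> B" "\<And>x j. \<bar>partial_deriv j \<phi> x\<bar> \<le> B"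
    "\<And>x. R < norm x \<Longrightarrow> \<phi> x = 0" "\<And>x j. R < norm x \<Longrightarrow> partial_deriv j \<phi> x = 0"
    by (rule C1_c_bounds[OF test_function_C1_c[OF \<phi>]]) (rule that)
  have z: "\<phi> x = 0" if "x \<notin> closure {x. \<phi> x \<noteq> 0}" for x
    using that closure_subset[of "{x. \<phi> x \<noteq> 0}"] by auto
  show "integrable M (\<lambda>x. g x * \<phi> x)"
    by (rule integrable_mult_test[OF g \<phi> test_function_continuous(1)[OF \<phi>] z b(3)])
  show "integrable M (\<lambda>x. g x * partial_deriv j \<phi> x)"
    by (rule integrable_mult_test[OF g \<phi> test_function_continuous(2)[OF \<phi>] partial_deriv_zero_outside b(4)])
qed

text \<open>Each entry of the difference integrates to zero against every test function. This is what makes the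
  choice of a weak gradient harmless.\<close>

lemma weak_gradient_AE_unique:
  assumes "has_weak_gradient \<Omega> y G" "has_weak_gradient \<Omega> y H"
  shows "AE x in M. G x = H x"
proof -
  have loc: "locally_integrable \<Omega> (\<lambda>x. G x $ i $ j)" "locally_integrable \<Omega> (\<lambda>x. H x $ i $ j)" for i j
    using assms locally_integrable_bounded_linear[OF _ bounded_linear_entry]
    by (auto simp: has_weak_gradient_def)
  have "AE x in M. G x $ i $ j - H x $ i $ j = 0" for i j
  proof (rule fundamental_lemma_calculus_of_variations[OF open_domain])
    show "locally_integrable \<Omega> (\<lambda>x. G x $ i $ j - H x $ i $ j)"
      using locally_integrable_lincomb[OF loc, of 1 i j "-1" i j] by simp
    fix \<phi> assume \<phi>: "test_function \<Omega> \<phi>"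
    have "(LINT x|M. G x $ i $ j * \<phi> x) = (LINT x|M. H x $ i $ j * \<phi> x)"
    proof -
      have "(LINT x|M. y x $ i * partial_deriv j \<phi> x) = - (LINT x|M. G x $ i $ j * \<phi> x)"
        "(LINT x|M. y x $ i * partial_deriv j \<phi> x) = - (LINT x|M. H x $ i $ j * \<phi> x)"
        using assms \<phi> by (auto simp: has_weak_gradient_def)
      then show ?thesis by linarith
    qed
    then show "(LINT x|M. (G x $ i $ j - H x $ i $ j) * \<phi> x) = 0"
      using integrable_mult_test_function(1)[OF _ \<phi>] loc by (simp add: left_diff_distrib)
  qed
  then have "AE x in M. \<forall>i j. G x $ i $ j - H x $ i $ j = 0" by (simp add: AE_all_countable)
  then show ?thesis by eventually_elim (simp add: vec_eq_iff)
qed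

lemma has_weak_gradient_lincomb:
  assumes "has_weak_gradient \<Omega> y G" "has_weak_gradient \<Omega> z H"
  shows "has_weak_gradient \<Omega> (\<lambda>x. a *\<^sub>R y x + b *\<^sub>R z x) (\<lambda>x. a *\<^sub>R G x + b *\<^sub>R H x)"
proof -
  have loc: "locally_integrable \<Omega> y" "locally_integrable \<Omega> z" "locally_integrable \<Omega> G" "locally_integrable \<Omega> H"
    using assms by (auto simp: has_weak_gradient_def)
  note c = locally_integrable_bounded_linear[OF loc(1) bounded_linear_vec_nth]
    locally_integrable_bounded_linear[OF loc(2) bounded_linear_vec_nth]
    locally_integrable_bounded_linear[OF loc(3) bounded_linear_entry]
    locally_integrable_bounded_linear[OF loc(4) bounded_linear_entry]
  have "(LINT x|M. (a *\<^sub>R y x + b *\<^sub>R z x) $ i * partial_deriv j \<phi> x)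
      = - (LINT x|M. (a *\<^sub>R G x + b *\<^sub>R H x) $ i $ j * \<phi> x)" if \<phi>: "test_function \<Omega> \<phi>" for \<phi> i j
  proof -
    have e1: "(LINT x|M. y x $ i * partial_deriv j \<phi> x) = - (LINT x|M. G x $ i $ j * \<phi> x)"
      and e2: "(LINT x|M. z x $ i * partial_deriv j \<phi> x) = - (LINT x|M. H x $ i $ j * \<phi> x)"
      using assms \<phi> by (auto simp: has_weak_gradient_def)
    note int = integrable_mult_test_function[OF _ \<phi>]
    have "(LINT x|M. (a *\<^sub>R y x + b *\<^sub>R z x) $ i * partial_deriv j \<phi> x)
       = (LINT x|M. a * (y x $ i * partial_deriv j \<phi> x) + b * (z x $ i * partial_deriv j \<phi> x))"
      by (simp add: algebra_simps)
    also have "\<dots> = a * (LINT x|M. y x $ i * partial_deriv j \<phi> x) + b * (LINT x|M. z x $ i * partial_deriv j \<phi> x)"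
      using int(2)[OF c(1)] int(2)[OF c(2)] by simp
    also have "\<dots> = - (a * (LINT x|M. G x $ i $ j * \<phi> x) + b * (LINT x|M. H x $ i $ j * \<phi> x))"
      unfolding e1 e2 by simp
    also have "a * (LINT x|M. G x $ i $ j * \<phi> x) + b * (LINT x|M. H x $ i $ j * \<phi> x)
       = (LINT x|M. a * (G x $ i $ j * \<phi> x) + b * (H x $ i $ j * \<phi> x))"
      using int(1)[OF c(3)] int(1)[OF c(4)] by simp
    also have "\<dots> = (LINT x|M. (a *\<^sub>R G x + b *\<^sub>R H x) $ i $ j * \<phi> x)"
      by (simp add: algebra_simps)
    finally show ?thesis .
  qed
  then show ?thesis
    using loc by (simp add: has_weak_gradient_def locally_integrable_lincomb)
qed

lemma W1p_I: "y \<in> L_p 4 \<Omega> \<Longrightarrow> G \<in> L_p 4 \<Omega> \<Longrightarrow> has_weak_gradient \<Omega> y G \<Longrightarrow> y \<in> W1p 4 \<Omega>"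
  by (auto simp: W1p_def)

lemma weak_gradient_AE_eq:
  assumes "has_weak_gradient \<Omega> y G"
  shows "AE x in M. G x = weak_gradient \<Omega> y x"
  by (rule weak_gradient_AE_unique[OF assms])
    (use someI[of "has_weak_gradient \<Omega> y", OF assms] in \<open>simp add: weak_gradient_def\<close>)

text \<open>The chosen weak gradient need not be the fourth-power integrable one whose existence is known, but
  it agrees with it almost everywhere.\<close>

lemma W1p_D:
  assumes "y \<in> W1p 4 \<Omega>"
  shows "y \<in> L_p 4 \<Omega>" "weak_gradient \<Omega> y \<in> L_p 4 \<Omega>" "has_weak_gradient \<Omega> y (weak_gradient \<Omega> y)"
proof -
  obtain G where G: "G \<in> L_p 4 \<Omega>" "has_weak_gradient \<Omega> y G" and y: "y \<in> L_p 4 \<Omega>"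
    using assms by (auto simp: W1p_def)
  show "y \<in> L_p 4 \<Omega>" by (rule y)
  show "has_weak_gradient \<Omega> y (weak_gradient \<Omega> y)"
    unfolding weak_gradient_def by (rule someI[of "has_weak_gradient \<Omega> y", OF G(2)])
  show "weak_gradient \<Omega> y \<in> L_p 4 \<Omega>"
    by (rule L4_AE_cong[OF G(1) weak_gradient_AE_eq[OF G(2)]])
qed

lemma W1p_lincomb:
  assumes y: "y \<in> W1p 4 \<Omega>" and z: "z \<in> W1p 4 \<Omega>"
  shows "(\<lambda>x. a *\<^sub>R y x + b *\<^sub>R z x) \<in> W1p 4 \<Omega>"
    and "AE x in M. a *\<^sub>R weak_gradient \<Omega> y x + b *\<^sub>R weak_gradient \<Omega> z x
      = weak_gradient \<Omega> (\<lambda>x. a *\<^sub>R y x + b *\<^sub>R z x) x"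
  using W1p_I[OF L4_lincomb(1) L4_lincomb(1) has_weak_gradient_lincomb] W1p_D[OF y] W1p_D[OF z]
    weak_gradient_AE_eq[OF has_weak_gradient_lincomb] by auto

lemma W1p_diff:
  assumes y: "y \<in> W1p 4 \<Omega>" and z: "z \<in> W1p 4 \<Omega>"
  shows "(\<lambda>x. y x - z x) \<in> W1p 4 \<Omega>"
    and "AE x in M. weak_gradient \<Omega> y x - weak_gradient \<Omega> z x = weak_gradient \<Omega> (\<lambda>x. y x - z x) x"
  using W1p_lincomb[OF assms, of 1 "-1"] by simp_all

lemma N4_weak_gradient_diff:
  assumes y: "y \<in> W1p 4 \<Omega>" and z: "z \<in> W1p 4 \<Omega>"
  shows "N4 (weak_gradient \<Omega> (\<lambda>x. y x - z x)) = N4 (\<lambda>x. weak_gradient \<Omega> y x - weak_gradient \<Omega> z x)"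
  using W1p_D[OF W1p_diff(1)[OF assms]] L4_diff W1p_D[OF y] W1p_D[OF z] W1p_diff(2)[OF assms]
  by (intro N4_cong_AE[symmetric]) (auto simp: L4_iff)

text \<open>For test functions the classical gradient is a weak gradient, by integration by parts over the
  whole space.\<close>

lemma vector_test_function_W1p:
  assumes \<phi>: "vector_test_function \<phi>"
  shows "has_weak_gradient \<Omega> \<phi> (gradient \<phi>)" "\<phi> \<in> L_p 4 \<Omega>" "gradient \<phi> \<in> L_p 4 \<Omega>"
    "\<phi> \<in> W1p 4 \<Omega>" "AE x in M. gradient \<phi> x = weak_gradient \<Omega> \<phi> x"
proof -
  have C: "C1_c (\<lambda>x. \<phi> x $ i)" for i using \<phi> test_function_C1_c by blast
  have "continuous_on UNIV (\<lambda>x. \<chi> i. \<phi> x $ i)"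
    by (intro continuous_on_vec_lambda C1_c_continuous[OF C])
  then have cont1: "continuous_on UNIV \<phi>" by simp
  have cont2: "continuous_on UNIV (gradient \<phi>)"
    unfolding gradient_def [abs_def] by (intro continuous_on_vec_lambda C1_c_continuous_partial[OF C])
  have L4: "f \<in> L_p 4 \<Omega>" if f: "continuous_on UNIV f" for f :: "real^'n \<Rightarrow> 'c::euclidean_space"
  proof -
    have fm: "f \<in> borel_measurable M"
      using borel_measurable_continuous_onI[OF f] by (rule borel_imp_measurable_domain)
    have "compact (f ` closure \<Omega>)"
      using bounded_domain f by (intro compact_continuous_image) (auto intro: continuous_on_subset)
    then obtain B where B: "\<And>x. x \<in> \<Omega> \<Longrightarrow> norm (f x) \<le> B"
      using compact_imp_bounded closure_subset by (metis bounded_iff image_eqI subsetD)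
    have "integrable M (\<lambda>x. norm (f x) ^ 4)"
      using fm B by (intro integrable_const_bound[where B = "B ^ 4"]) (auto intro!: AE_I2 power_mono simp: space_restrict_space)
    then show ?thesis using fm by (simp add: L4_iff)
  qed
  show L: "\<phi> \<in> L_p 4 \<Omega>" "gradient \<phi> \<in> L_p 4 \<Omega>" by (intro L4 cont1, intro L4 cont2)
  have "(LINT x|M. \<phi> x $ i * partial_deriv j \<eta> x) = - (LINT x|M. gradient \<phi> x $ i $ j * \<eta> x)"
    if \<eta>: "test_function \<Omega> \<eta>" for \<eta> i j
  proof -
    note m = C1_c_continuous C1_c_continuous_partial C test_function_C1_c[OF \<eta>]
    have "(LINT x|M. \<phi> x $ i * partial_deriv j \<eta> x) = (LINT x|lborel. \<phi> x $ i * partial_deriv j \<eta> x)"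
      using test_function_zero_outside[OF \<eta>]
      by (intro integral_domain_eq_lborel borel_measurable_continuous_onI continuous_on_mult m) auto
    also have "\<dots> = - (LINT x|lborel. partial_deriv j (\<lambda>x. \<phi> x $ i) x * \<eta> x)"
      by (rule integration_by_parts[OF C test_function_C1_c[OF \<eta>]])
    also have "(LINT x|lborel. partial_deriv j (\<lambda>x. \<phi> x $ i) x * \<eta> x) = (LINT x|M. partial_deriv j (\<lambda>x. \<phi> x $ i) x * \<eta> x)"
      using test_function_zero_outside[OF \<eta>]
      by (intro integral_domain_eq_lborel[symmetric] borel_measurable_continuous_onI continuous_on_mult m) auto
    finally show ?thesis by (simp add: gradient_def)
  qed
  then show h: "has_weak_gradient \<Omega> \<phi> (gradient \<phi>)"
    using L by (simp add: has_weak_gradient_def integrable_imp_locally_integrable L4_integrable)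
  show "\<phi> \<in> W1p 4 \<Omega>" using L h by (rule W1p_I)
  show "AE x in M. gradient \<phi> x = weak_gradient \<Omega> \<phi> x" using h by (rule weak_gradient_AE_eq)
qed

lemma gradient_lincomb:
  assumes \<phi>: "vector_test_function \<phi>" and \<psi>: "vector_test_function \<psi>"
  shows "vector_test_function (\<lambda>x. a *\<^sub>R \<phi> x + b *\<^sub>R \<psi> x)"
    and "gradient (\<lambda>x. a *\<^sub>R \<phi> x + b *\<^sub>R \<psi> x) x = a *\<^sub>R gradient \<phi> x + b *\<^sub>R gradient \<psi> x"
proof -
  show "vector_test_function (\<lambda>x. a *\<^sub>R \<phi> x + b *\<^sub>R \<psi> x)"
    using \<phi> \<psi> test_function_lincomb by simp
  have "partial_deriv j (\<lambda>x. a * \<phi> x $ i + b * \<psi> x $ i) x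
    = a * partial_deriv j (\<lambda>x. \<phi> x $ i) x + b * partial_deriv j (\<lambda>x. \<psi> x $ i) x" for i j
  proof -
    have "(\<lambda>x. \<phi> x $ i) differentiable at x" "(\<lambda>x. \<psi> x $ i) differentiable at x"
      using C1_c_differentiable[OF test_function_C1_c[OF spec[OF \<phi>]]]
        C1_c_differentiable[OF test_function_C1_c[OF spec[OF \<psi>]]] by simp_all
    note D = this[THEN has_derivative_partial]
    show ?thesis
      using partial_deriv_eq[OF has_derivative_add[OF has_derivative_mult_right[OF D(1)] has_derivative_mult_right[OF D(2)]]]
      by (simp add: partial_deriv_def)
  qed
  then show "gradient (\<lambda>x. a *\<^sub>R \<phi> x + b *\<^sub>R \<psi> x) x = a *\<^sub>R gradient \<phi> x + b *\<^sub>R gradient \<psi> x"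
    by (simp add: gradient_def vec_eq_iff)
qed

lemma gradient_zero_outside:
  assumes "vector_test_function \<phi>" "x \<notin> \<Omega>"
  shows "gradient \<phi> x = 0"
  using test_function_zero_outside(2)[of "\<lambda>x. \<phi> x $ i" x for i] assms
  by (simp add: gradient_def vec_eq_iff)

text \<open>Both sides of the defining identity are continuous in \<open>L\<^sup>4\<close>, since test functions and their derivatives are
  bounded.\<close>

lemma has_weak_gradient_limit:
  assumes wg: "\<And>k::nat. has_weak_gradient \<Omega> (y k) (G k)"
    and L: "\<And>k. y k \<in> L_p 4 \<Omega>" "\<And>k. G k \<in> L_p 4 \<Omega>" "z \<in> L_p 4 \<Omega>" "H \<in> L_p 4 \<Omega>"
    and lim: "(\<lambda>k. N4 (\<lambda>x. z x - y k x)) \<longlonglongrightarrow> 0" "(\<lambda>k. N4 (\<lambda>x. H x - G k x)) \<longlonglongrightarrow> 0"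
  shows "has_weak_gradient \<Omega> z H"
proof -
  have "(LINT x|M. z x $ i * partial_deriv j \<eta> x) = - (LINT x|M. H x $ i $ j * \<eta> x)"
    if \<eta>: "test_function \<Omega> \<eta>" for \<eta> i j
  proof -
    obtain R B where b: "0 < R" "0 \<le> B" "\<And>x. \<bar>\<eta> x\<bar> \<le> B" "\<And>x j. \<bar>partial_deriv j \<eta> x\<bar> \<le> B"
      "\<And>x. R < norm x \<Longrightarrow> \<eta> x = 0" "\<And>x j. R < norm x \<Longrightarrow> partial_deriv j \<eta> x = 0"
      by (rule C1_c_bounds[OF test_function_C1_c[OF \<eta>]]) (rule that)
    note m = test_function_continuous[OF \<eta>, THEN borel_measurable_continuous_onI, THEN borel_imp_measurable_domain]
    have l1: "(\<lambda>k. LINT x|M. y k x $ i * partial_deriv j \<eta> x) \<longlonglongrightarrow> (LINT x|M. z x $ i * partial_deriv j \<eta> x)"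
      by (rule integral_mult_tendsto[OF L(1) L(3) lim(1) bounded_linear_vec_nth component_le_norm_cart m(2) b(4)])
    have "\<bar>A $ i $ j\<bar> \<le> norm A" for A :: "real^'n^'n"
      by (rule order_trans[OF component_le_norm_cart Finite_Cartesian_Product.norm_nth_le])
    from integral_mult_tendsto[OF L(2) L(4) lim(2) bounded_linear_entry this m(1) b(3)]
    have "(\<lambda>k. - (LINT x|M. G k x $ i $ j * \<eta> x)) \<longlonglongrightarrow> - (LINT x|M. H x $ i $ j * \<eta> x)"
      by (rule tendsto_minus)
    moreover have "- (LINT x|M. G k x $ i $ j * \<eta> x) = (LINT x|M. y k x $ i * partial_deriv j \<eta> x)" for k
      using wg[of k] \<eta> by (simp add: has_weak_gradient_def)
    ultimately show ?thesis using l1 LIMSEQ_unique by simp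
  qed
  then show ?thesis
    using L by (simp add: has_weak_gradient_def integrable_imp_locally_integrable L4_integrable)
qed

lemma W1p_limit:
  assumes y: "\<And>k::nat. y k \<in> W1p 4 \<Omega>"
    and 1: "\<And>k l. k \<le> l \<Longrightarrow> N4 (\<lambda>x. y l x - y k x) \<le> c * (1/4) ^ k"
    and 2: "\<And>k l. k \<le> l \<Longrightarrow> N4 (\<lambda>x. weak_gradient \<Omega> (y l) x - weak_gradient \<Omega> (y k) x) \<le> c' * (1/4) ^ k"
  obtains z where "z \<in> W1p 4 \<Omega>" "(\<lambda>k. N4 (\<lambda>x. z x - y k x)) \<longlonglongrightarrow> 0"
    "(\<lambda>k. N4 (\<lambda>x. weak_gradient \<Omega> z x - weak_gradient \<Omega> (y k) x)) \<longlonglongrightarrow> 0"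
    "AE x in M. (\<lambda>k. weak_gradient \<Omega> (y k) x) \<longlonglongrightarrow> weak_gradient \<Omega> z x"
proof -
  obtain z where z: "z \<in> L_p 4 \<Omega>" "AE x in M. (\<lambda>k. y k x) \<longlonglongrightarrow> z x"
    "\<And>k. N4 (\<lambda>x. z x - y k x) \<le> c * (1/4) ^ k"
    by (rule L4_complete_rate[OF W1p_D(1)[OF y] 1]) (assumption, rule that)
  obtain G where G: "G \<in> L_p 4 \<Omega>" "AE x in M. (\<lambda>k. weak_gradient \<Omega> (y k) x) \<longlonglongrightarrow> G x"
    "\<And>k. N4 (\<lambda>x. G x - weak_gradient \<Omega> (y k) x) \<le> c' * (1/4) ^ k"
    by (rule L4_complete_rate[OF W1p_D(2)[OF y] 2]) (assumption, rule that)
  have l1: "(\<lambda>k. N4 (\<lambda>x. z x - y k x)) \<longlonglongrightarrow> 0"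
    by (rule tendsto_sandwich[OF _ _ tendsto_const geometric_tendsto_zero[of c]])
      (intro always_eventually allI N4_nonneg z(3))+
  have l2: "(\<lambda>k. N4 (\<lambda>x. G x - weak_gradient \<Omega> (y k) x)) \<longlonglongrightarrow> 0"
    by (rule tendsto_sandwich[OF _ _ tendsto_const geometric_tendsto_zero[of c']])
      (intro always_eventually allI N4_nonneg G(3))+
  have wg: "has_weak_gradient \<Omega> z G"
    by (rule has_weak_gradient_limit[OF W1p_D(3)[OF y] W1p_D(1)[OF y] W1p_D(2)[OF y] z(1) G(1) l1 l2])
  have zW: "z \<in> W1p 4 \<Omega>" by (rule W1p_I[OF z(1) G(1) wg])
  note eq = weak_gradient_AE_eq[OF wg]
  have "N4 (\<lambda>x. weak_gradient \<Omega> z x - weak_gradient \<Omega> (y k) x) = N4 (\<lambda>x. G x - weak_gradient \<Omega> (y k) x)" for k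
  proof (rule N4_cong_AE)
    show "AE x in M. weak_gradient \<Omega> z x - weak_gradient \<Omega> (y k) x = G x - weak_gradient \<Omega> (y k) x"
      using eq by eventually_elim simp
    show "(\<lambda>x. weak_gradient \<Omega> z x - weak_gradient \<Omega> (y k) x) \<in> borel_measurable M"
      using L4_diff[OF W1p_D(2)[OF zW] W1p_D(2)[OF y]] unfolding L4_iff by (rule conjunct1)
    show "(\<lambda>x. G x - weak_gradient \<Omega> (y k) x) \<in> borel_measurable M"
      using L4_diff[OF G(1) W1p_D(2)[OF y]] unfolding L4_iff by (rule conjunct1)
  qed
  then have l3: "(\<lambda>k. N4 (\<lambda>x. weak_gradient \<Omega> z x - weak_gradient \<Omega> (y k) x)) \<longlonglongrightarrow> 0"
    using l2 by simp
  have "AE x in M. (\<lambda>k. weak_gradient \<Omega> (y k) x) \<longlonglongrightarrow> weak_gradient \<Omega> z x"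
    using G(2) eq by eventually_elim simp
  from that[OF zW l1 l3 this] show ?thesis .
qed

section \<open>The closure of the test functions\<close>

text \<open>The density condition in the definition of \<open>W\<^sup>1\<^sup>,\<^sup>4\<^sub>0\<close>, with the sequence replaced by an accuracy \<open>e\<close>, the
  norm by its two parts, and the weak gradient of the test function by the classical one. In this
  form closedness is a diagonal argument without sequences.\<close>

definition approximable :: "(real^'n \<Rightarrow> real^'n) \<Rightarrow> bool" where
  "approximable u \<longleftrightarrow> (\<forall>e>0. \<exists>\<phi>. vector_test_function \<phi> \<and>
     N4 (\<lambda>x. u x - \<phi> x) < e \<and> N4 (\<lambda>x. weak_gradient \<Omega> u x - gradient \<phi> x) < e)"

lemma approximableE:
  assumes "approximable u" "0 < e"
  obtains \<phi> where "vector_test_function \<phi>" "N4 (\<lambda>x. u x - \<phi> x) < e"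
    "N4 (\<lambda>x. weak_gradient \<Omega> u x - gradient \<phi> x) < e"
  using assms(1)[unfolded approximable_def, THEN spec, THEN mp, OF assms(2)]
  by (elim exE conjE) (rule that)

lemma W1p_norm_eq:
  "W1p_norm 4 \<Omega> y = (N4 y + N4 (weak_gradient \<Omega> y)) powr (1/4)"
  by (simp add: W1p_norm_def N4_def powr_numeral)

lemma W1p_norm_diff_test:
  assumes u: "u \<in> W1p 4 \<Omega>" and \<phi>: "vector_test_function \<phi>"
  shows "W1p_norm 4 \<Omega> (\<lambda>x. u x - \<phi> x) =
    (N4 (\<lambda>x. u x - \<phi> x) + N4 (\<lambda>x. weak_gradient \<Omega> u x - gradient \<phi> x)) powr (1/4)"
proof -
  note t = vector_test_function_W1p[OF \<phi>]
  have "N4 (\<lambda>x. weak_gradient \<Omega> u x - weak_gradient \<Omega> \<phi> x) = N4 (\<lambda>x. weak_gradient \<Omega> u x - gradient \<phi> x)"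
    using t(5) W1p_D[OF u] W1p_D[OF t(4)] L4_diff t(3)
    by (intro N4_cong_AE) (auto simp: L4_iff)
  then show ?thesis
    using W1p_norm_eq[of "\<lambda>x. u x - \<phi> x"] N4_weak_gradient_diff[OF u t(4)] by simp
qed

lemma W1p_0_approximable:
  assumes "u \<in> W1p_0 4 \<Omega>"
  shows "u \<in> W1p 4 \<Omega>" "approximable u"
proof -
  from assms obtain \<phi> where u: "u \<in> W1p 4 \<Omega>" and \<phi>: "\<And>k::nat. vector_test_function (\<phi> k)"
    and lim: "(\<lambda>k. W1p_norm 4 \<Omega> (\<lambda>x. u x - \<phi> k x)) \<longlonglongrightarrow> 0"
    by (auto simp: W1p_0_def)
  show "u \<in> W1p 4 \<Omega>" by (rule u)
  let ?s = "\<lambda>k. N4 (\<lambda>x. u x - \<phi> k x) + N4 (\<lambda>x. weak_gradient \<Omega> u x - gradient (\<phi> k) x)"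
  have "(\<lambda>k. (?s k powr (1/4)) ^ 4) \<longlonglongrightarrow> 0 ^ 4"
    using lim unfolding W1p_norm_diff_test[OF u \<phi>] by (rule tendsto_power)
  moreover have "(?s k powr (1/4)) ^ 4 = ?s k" for k
  proof -
    have "(t powr (1/4)) ^ 4 = t" if "0 \<le> t" for t :: real
      using powr_numeral[of "t powr (1/4)" "num.Bit0 (num.Bit0 num.One)"] that by (simp add: powr_powr)
    then show ?thesis by (simp add: N4_nonneg)
  qed
  ultimately have lim': "?s \<longlonglongrightarrow> 0" by simp
  show "approximable u"
    unfolding approximable_def
  proof safe
    fix e :: real assume "0 < e"
    obtain k where "?s k < e"
      using eventually_happens'[OF sequentially_bot order_tendstoD(2)[OF lim' \<open>0 < e\<close>]] by (rule exE)
    then have "N4 (\<lambda>x. u x - \<phi> k x) < e" "N4 (\<lambda>x. weak_gradient \<Omega> u x - gradient (\<phi> k) x) < e"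
      using N4_nonneg[of "\<lambda>x. u x - \<phi> k x"] N4_nonneg[of "\<lambda>x. weak_gradient \<Omega> u x - gradient (\<phi> k) x"] by linarith+
    then show "\<exists>\<phi>. vector_test_function \<phi> \<and> N4 (\<lambda>x. u x - \<phi> x) < e \<and> N4 (\<lambda>x. weak_gradient \<Omega> u x - gradient \<phi> x) < e"
      using \<phi> by (intro exI[of _ "\<phi> k"] conjI)
  qed
qed

lemma approximable_W1p_0:
  assumes u: "u \<in> W1p 4 \<Omega>" and a: "approximable u"
  shows "u \<in> W1p_0 4 \<Omega>"
proof -
  have "\<forall>k::nat. \<exists>\<phi>. vector_test_function \<phi> \<and> N4 (\<lambda>x. u x - \<phi> x) < inverse (real (Suc k))
      \<and> N4 (\<lambda>x. weak_gradient \<Omega> u x - gradient \<phi> x) < inverse (real (Suc k))"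
  proof
    fix k :: nat
    have "0 < inverse (real (Suc k))" by simp
    from a[unfolded approximable_def, THEN spec, THEN mp, OF this] show "\<exists>\<phi>. vector_test_function \<phi> \<and> N4 (\<lambda>x. u x - \<phi> x) < inverse (real (Suc k))
      \<and> N4 (\<lambda>x. weak_gradient \<Omega> u x - gradient \<phi> x) < inverse (real (Suc k))"
      .
  qed
  from choice[OF this] obtain \<phi> where A: "\<forall>k. vector_test_function (\<phi> k)
      \<and> N4 (\<lambda>x. u x - \<phi> k x) < inverse (real (Suc k))
      \<and> N4 (\<lambda>x. weak_gradient \<Omega> u x - gradient (\<phi> k) x) < inverse (real (Suc k))"
    by (rule exE)
  then have \<phi>: "\<And>k. vector_test_function (\<phi> k)"
    and l: "\<And>k. N4 (\<lambda>x. u x - \<phi> k x) < inverse (real (Suc k))"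
      "\<And>k. N4 (\<lambda>x. weak_gradient \<Omega> u x - gradient (\<phi> k) x) < inverse (real (Suc k))"
    by simp_all
  have l1: "(\<lambda>k. N4 (\<lambda>x. u x - \<phi> k x)) \<longlonglongrightarrow> 0"
    by (rule tendsto_sandwich[OF _ _ tendsto_const LIMSEQ_inverse_real_of_nat])
      (intro always_eventually allI N4_nonneg less_imp_le[OF l(1)])+
  have l2: "(\<lambda>k. N4 (\<lambda>x. weak_gradient \<Omega> u x - gradient (\<phi> k) x)) \<longlonglongrightarrow> 0"
    by (rule tendsto_sandwich[OF _ _ tendsto_const LIMSEQ_inverse_real_of_nat])
      (intro always_eventually allI N4_nonneg less_imp_le[OF l(2)])+
  have conv: "(\<lambda>k. W1p_norm 4 \<Omega> (\<lambda>x. u x - \<phi> k x)) \<longlonglongrightarrow> 0"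
    unfolding W1p_norm_diff_test[OF u \<phi>]
    by (rule tendsto_zero_powrI[OF _ tendsto_const])
      (use tendsto_add[OF l1 l2] in \<open>simp_all add: N4_nonneg\<close>)
  have "\<forall>k i. test_function \<Omega> (\<lambda>x. \<phi> k x $ i)" using \<phi> by simp
  with u conv show "u \<in> W1p_0 4 \<Omega>"
    unfolding W1p_0_def mem_Collect_eq by (intro conjI exI[of _ \<phi>])
qed

lemma approximable_lincomb:
  assumes u: "u \<in> W1p 4 \<Omega>" "approximable u" and v: "v \<in> W1p 4 \<Omega>" "approximable v"
  shows "approximable (\<lambda>x. a *\<^sub>R u x + b *\<^sub>R v x)"
  unfolding approximable_def
proof (intro allI impI)
  fix e :: real assume e: "0 < e"
  \<comment> \<open>The summand \<open>1\<close> keeps the scale positive when \<open>a = b = 0\<close>.\<close>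
  define s where "s = a ^ 4 + b ^ 4 + 1"
  have s: "0 < s" unfolding s_def by (intro add_nonneg_pos add_nonneg_nonneg) simp_all
  define d where "d = e / (8 * s)"
  have d: "0 < d" using e s by (simp add: d_def)
  obtain \<phi> where \<phi>: "vector_test_function \<phi>" "N4 (\<lambda>x. u x - \<phi> x) < d" "N4 (\<lambda>x. weak_gradient \<Omega> u x - gradient \<phi> x) < d"
    using u(2) d by (rule approximableE)
  obtain \<psi> where \<psi>: "vector_test_function \<psi>" "N4 (\<lambda>x. v x - \<psi> x) < d" "N4 (\<lambda>x. weak_gradient \<Omega> v x - gradient \<psi> x) < d"
    using v(2) d by (rule approximableE)
  have small: "8 * (a ^ 4 * p + b ^ 4 * q) < e" if "p < d" "q < d" for p q
  proof -
    have "a ^ 4 * p + b ^ 4 * q \<le> a ^ 4 * d + b ^ 4 * d"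
      using that by (intro add_mono mult_left_mono) auto
    also have "\<dots> < s * d" using d by (simp add: s_def algebra_simps)
    finally show ?thesis using s by (simp add: d_def)
  qed
  let ?w = "\<lambda>x. a *\<^sub>R u x + b *\<^sub>R v x" and ?\<chi> = "\<lambda>x. a *\<^sub>R \<phi> x + b *\<^sub>R \<psi> x"
  note t = vector_test_function_W1p[OF \<phi>(1)] vector_test_function_W1p[OF \<psi>(1)]
  note U = W1p_D[OF u(1)] W1p_D[OF v(1)]
  have "N4 (\<lambda>x. ?w x - ?\<chi> x) = N4 (\<lambda>x. a *\<^sub>R (u x - \<phi> x) + b *\<^sub>R (v x - \<psi> x))"
    by (simp add: N4_def algebra_simps)
  also have "\<dots> \<le> 8 * (a ^ 4 * N4 (\<lambda>x. u x - \<phi> x) + b ^ 4 * N4 (\<lambda>x. v x - \<psi> x))"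
    using U t by (intro L4_lincomb(2) L4_diff) auto
  also have "\<dots> < e" using \<phi>(2) \<psi>(2) by (rule small)
  finally have 1: "N4 (\<lambda>x. ?w x - ?\<chi> x) < e" .
  have "N4 (\<lambda>x. weak_gradient \<Omega> ?w x - gradient ?\<chi> x)
     = N4 (\<lambda>x. a *\<^sub>R (weak_gradient \<Omega> u x - gradient \<phi> x) + b *\<^sub>R (weak_gradient \<Omega> v x - gradient \<psi> x))"
  proof (rule N4_cong_AE)
    show "AE x in M. weak_gradient \<Omega> ?w x - gradient ?\<chi> x =
        a *\<^sub>R (weak_gradient \<Omega> u x - gradient \<phi> x) + b *\<^sub>R (weak_gradient \<Omega> v x - gradient \<psi> x)"
      using W1p_lincomb(2)[OF u(1) v(1), of a b]
    proof eventually_elim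
      case (elim x)
      show ?case unfolding elim[symmetric] gradient_lincomb(2)[OF \<phi>(1) \<psi>(1)] by (simp add: algebra_simps)
    qed
    have "(\<lambda>x. weak_gradient \<Omega> ?w x - gradient ?\<chi> x) \<in> L_p 4 \<Omega>"
      by (rule L4_diff[OF W1p_D(2)[OF W1p_lincomb(1)[OF u(1) v(1)]]
          vector_test_function_W1p(3)[OF gradient_lincomb(1)[OF \<phi>(1) \<psi>(1)]]])
    then show "(\<lambda>x. weak_gradient \<Omega> ?w x - gradient ?\<chi> x) \<in> borel_measurable M"
      unfolding L4_iff by (rule conjunct1)
    have "(\<lambda>x. a *\<^sub>R (weak_gradient \<Omega> u x - gradient \<phi> x) + b *\<^sub>R (weak_gradient \<Omega> v x - gradient \<psi> x)) \<in> L_p 4 \<Omega>"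
      using U t by (intro L4_lincomb(1) L4_diff) auto
    then show "(\<lambda>x. a *\<^sub>R (weak_gradient \<Omega> u x - gradient \<phi> x) + b *\<^sub>R (weak_gradient \<Omega> v x - gradient \<psi> x)) \<in> borel_measurable M"
      unfolding L4_iff by (rule conjunct1)
  qed
  also have "\<dots> \<le> 8 * (a ^ 4 * N4 (\<lambda>x. weak_gradient \<Omega> u x - gradient \<phi> x) + b ^ 4 * N4 (\<lambda>x. weak_gradient \<Omega> v x - gradient \<psi> x))"
    using U t by (intro L4_lincomb(2) L4_diff) auto
  also have "\<dots> < e" using \<phi>(3) \<psi>(3) by (rule small)
  finally have 2: "N4 (\<lambda>x. weak_gradient \<Omega> ?w x - gradient ?\<chi> x) < e" .
  show "\<exists>\<phi>. vector_test_function \<phi> \<and> N4 (\<lambda>x. ?w x - \<phi> x) < e \<and> N4 (\<lambda>x. weak_gradient \<Omega> ?w x - gradient \<phi> x) < e"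
    by (rule exI[of _ ?\<chi>]) (intro conjI 1 2 gradient_lincomb(1)[OF \<phi>(1) \<psi>(1)])
qed

lemma W1p_0_lincomb:
  assumes u: "u \<in> W1p_0 4 \<Omega>" and v: "v \<in> W1p_0 4 \<Omega>"
  shows "(\<lambda>x. a *\<^sub>R u x + b *\<^sub>R v x) \<in> W1p_0 4 \<Omega>"
  using W1p_0_approximable[OF u] W1p_0_approximable[OF v]
  by (intro approximable_W1p_0 approximable_lincomb W1p_lincomb)

lemma zero_W1p_0: "(\<lambda>x. 0) \<in> W1p_0 4 \<Omega>"
proof -
  have t: "vector_test_function (\<lambda>x. 0)" by (simp add: test_function_def C_k_const)
  note v = vector_test_function_W1p[OF t]
  have "N4 (\<lambda>x. weak_gradient \<Omega> (\<lambda>x. 0) x - gradient (\<lambda>x. 0) x) = N4 (\<lambda>x. 0 :: real^'n^'n)"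
    using v(5) W1p_D(2)[OF v(4)] v(3) L4_diff
    by (intro N4_cong_AE) (auto simp: L4_iff)
  then have "approximable (\<lambda>x. 0)"
    unfolding approximable_def using t by (auto simp: N4_def intro!: exI[of _ "\<lambda>x. 0"])
  then show ?thesis using v(4) by (rule approximable_W1p_0[rotated])
qed

text \<open>Approximations of a nearby element of \<open>W\<^sup>1\<^sup>,\<^sup>4\<^sub>0\<close> are approximations of the limit.\<close>

lemma W1p_0_closed:
  assumes u: "u \<in> W1p 4 \<Omega>" and v: "\<And>k::nat. v k \<in> W1p_0 4 \<Omega>"
    and lim: "(\<lambda>k. N4 (\<lambda>x. u x - v k x)) \<longlonglongrightarrow> 0"
      "(\<lambda>k. N4 (\<lambda>x. weak_gradient \<Omega> u x - weak_gradient \<Omega> (v k) x)) \<longlonglongrightarrow> 0"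
  shows "u \<in> W1p_0 4 \<Omega>"
proof (rule approximable_W1p_0[OF u], unfold approximable_def, intro allI impI)
  fix e :: real assume e: "0 < e"
  have "\<forall>\<^sub>F k in sequentially. N4 (\<lambda>x. u x - v k x) < e / 16 \<and> N4 (\<lambda>x. weak_gradient \<Omega> u x - weak_gradient \<Omega> (v k) x) < e / 16"
    using order_tendstoD(2)[OF lim(1), of "e / 16"] order_tendstoD(2)[OF lim(2), of "e / 16"] e
    by (simp add: eventually_conj)
  from eventually_happens'[OF sequentially_bot this] obtain k where
    k: "N4 (\<lambda>x. u x - v k x) < e / 16" "N4 (\<lambda>x. weak_gradient \<Omega> u x - weak_gradient \<Omega> (v k) x) < e / 16"
    by (elim exE conjE)
  note w = W1p_0_approximable[OF v[of k]]
  have "0 < e / 16" using e by simp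
  with w(2) obtain \<phi> where
    \<phi>: "vector_test_function \<phi>" "N4 (\<lambda>x. v k x - \<phi> x) < e / 16" "N4 (\<lambda>x. weak_gradient \<Omega> (v k) x - gradient \<phi> x) < e / 16"
    by (rule approximableE)
  note t = vector_test_function_W1p[OF \<phi>(1)]
  have aux: "p < e" if "p \<le> 8 * (q + r)" "q < e / 16" "r < e / 16" for p q r
    using that by (simp add: field_simps)
  have "N4 (\<lambda>x. u x - \<phi> x) < e"
    by (rule aux[OF N4_triangle[OF W1p_D(1)[OF u] W1p_D(1)[OF w(1)] t(2)] k(1) \<phi>(2)])
  moreover have "N4 (\<lambda>x. weak_gradient \<Omega> u x - gradient \<phi> x) < e"
    by (rule aux[OF N4_triangle[OF W1p_D(2)[OF u] W1p_D(2)[OF w(1)] t(3)] k(2) \<phi>(3)])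
  ultimately show "\<exists>\<phi>. vector_test_function \<phi> \<and> N4 (\<lambda>x. u x - \<phi> x) < e \<and> N4 (\<lambda>x. weak_gradient \<Omega> u x - gradient \<phi> x) < e"
    using \<phi>(1) by (intro exI[of _ \<phi>] conjI)
qed

text \<open>The scalar inequality is applied to every component in one fixed direction.\<close>

lemma poincare_vector_test:
  obtains C where "0 \<le> C" "\<And>\<phi>. vector_test_function \<phi> \<Longrightarrow> N4 \<phi> \<le> C * N4 (gradient \<phi>)"
proof -
  obtain r where r: "0 < r" "\<Omega> \<subseteq> cball 0 r" by (rule domain_subset_cball)
  define K where "K = 8 * r * (8 * r) ^ 3"
  have K: "0 \<le> K" using r by (simp add: K_def)
  obtain j :: 'n where True by simp
  have main: "N4 \<phi> \<le> (CARD('n) * (CARD('n) * K)) * N4 (gradient \<phi>)" if \<phi>: "vector_test_function \<phi>" for \<phi>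
  proof -
    have tf: "test_function \<Omega> (\<lambda>x. \<phi> x $ i)" for i using \<phi> by (rule spec)
    note C = test_function_C1_c[OF tf]
    note cont = C1_c_continuous[OF C] C1_c_continuous_partial[OF C]
    note t = vector_test_function_W1p[OF \<phi>]
    have i1: "integrable M (\<lambda>x. (\<phi> x $ i) ^ 4)" for i
    proof (rule integrable_by_L4[OF t(2), where c = 1])
      show "(\<lambda>x. (\<phi> x $ i) ^ 4) \<in> borel_measurable M"
        by (intro borel_imp_measurable_domain borel_measurable_continuous_onI continuous_intros cont)
      show "norm ((\<phi> x $ i) ^ 4) \<le> 1 * (1 + norm (\<phi> x) ^ 4)" for x
        using power_mono[OF component_le_norm_cart[of "\<phi> x" i] abs_ge_zero, of 4] by (simp add: power_abs)
    qed
    have "N4 \<phi> \<le> (LINT x|M. CARD('n) * (\<Sum>i\<in>UNIV. (\<phi> x $ i) ^ 4))"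
      unfolding N4_def using t(2) i1
      by (intro integral_mono norm_power4_le_sum) (auto simp: L4_iff)
    also have "\<dots> = CARD('n) * (\<Sum>i\<in>UNIV. LINT x|M. (\<phi> x $ i) ^ 4)"
      using i1 by simp
    also have "\<dots> \<le> CARD('n) * (\<Sum>i\<in>(UNIV::'n set). K * N4 (gradient \<phi>))"
    proof (intro mult_left_mono sum_mono)
      fix i :: 'n
      have "(LINT x|M. (\<phi> x $ i) ^ 4) = (LINT x|lborel. (\<phi> x $ i) ^ 4)"
        using test_function_zero_outside(1)[OF tf]
        by (intro integral_domain_eq_lborel borel_measurable_continuous_onI continuous_intros cont) simp
      also have "\<dots> \<le> K * (LINT x|lborel. \<bar>partial_deriv j (\<lambda>x. \<phi> x $ i) x\<bar> ^ 4)"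
        unfolding K_def using r test_function_zero_outside(1)[OF tf]
        by (intro poincare_scalar C) (auto simp: subset_iff)
      also have "(LINT x|lborel. \<bar>partial_deriv j (\<lambda>x. \<phi> x $ i) x\<bar> ^ 4) = (LINT x|M. \<bar>partial_deriv j (\<lambda>x. \<phi> x $ i) x\<bar> ^ 4)"
        using test_function_zero_outside(2)[OF tf]
        by (intro integral_domain_eq_lborel[symmetric] borel_measurable_continuous_onI continuous_intros cont) simp
      also have "\<dots> \<le> N4 (gradient \<phi>)"
        unfolding N4_def
      proof (rule integral_mono)
        have le: "\<bar>partial_deriv j (\<lambda>x. \<phi> x $ i) x\<bar> \<le> norm (gradient \<phi> x)" for x
          using order_trans[OF component_le_norm_cart[of "gradient \<phi> x $ i" j] Finite_Cartesian_Product.norm_nth_le[of "gradient \<phi> x" i]]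
          by (simp add: gradient_def)
        then show le4: "\<bar>partial_deriv j (\<lambda>x. \<phi> x $ i) x\<bar> ^ 4 \<le> norm (gradient \<phi> x) ^ 4" for x
          by (intro power_mono) auto
        show "integrable M (\<lambda>x. norm (gradient \<phi> x) ^ 4)" using t(3) by (simp add: L4_iff)
        show "integrable M (\<lambda>x. \<bar>partial_deriv j (\<lambda>x. \<phi> x $ i) x\<bar> ^ 4)"
        proof (rule integrable_by_L4[OF t(3), where c = 1])
          show "(\<lambda>x. \<bar>partial_deriv j (\<lambda>x. \<phi> x $ i) x\<bar> ^ 4) \<in> borel_measurable M"
            by (intro borel_imp_measurable_domain borel_measurable_continuous_onI continuous_intros cont)
          show "norm (\<bar>partial_deriv j (\<lambda>x. \<phi> x $ i) x\<bar> ^ 4) \<le> 1 * (1 + norm (gradient \<phi> x) ^ 4)" for x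
            using le4[of x] by simp
        qed
      qed
      finally show "(LINT x|M. (\<phi> x $ i) ^ 4) \<le> K * N4 (gradient \<phi>)"
        using K by (meson mult_left_mono order_trans)
    qed simp
    finally show ?thesis by (simp add: mult.assoc)
  qed
  have "0 \<le> CARD('n) * (CARD('n) * K)" using K by simp
  from that[OF this main] show ?thesis .
qed

text \<open>Density carries the inequality over from test functions, with a worse constant.\<close>

lemma poincare_W1p_0:
  obtains C where "0 \<le> C" "\<And>u. u \<in> W1p_0 4 \<Omega> \<Longrightarrow> N4 u \<le> C * N4 (weak_gradient \<Omega> u)"
proof -
  obtain C where C: "0 \<le> C" "\<And>\<phi>. vector_test_function \<phi> \<Longrightarrow> N4 \<phi> \<le> C * N4 (gradient \<phi>)"
    by (rule poincare_vector_test) (rule that)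
  have "N4 u \<le> 64 * C * N4 (weak_gradient \<Omega> u)" if u0: "u \<in> W1p_0 4 \<Omega>" for u
  proof (rule field_le_epsilon)
    fix e :: real assume e: "0 < e"
    \<comment> \<open>Passing to an approximation and back costs \<open>8 * d\<close> for the function and \<open>64 * C * d\<close> for the gradient.\<close>
    define d where "d = e / (8 + 64 * C)"
    have d: "0 < d" using e C(1) by (simp add: d_def add_pos_nonneg)
    have de: "(8 + 64 * C) * d = e" using C(1) by (simp add: d_def add_nonneg_eq_0_iff)
    note u = W1p_0_approximable[OF u0]
    obtain \<phi> where \<phi>: "vector_test_function \<phi>" "N4 (\<lambda>x. u x - \<phi> x) < d" "N4 (\<lambda>x. weak_gradient \<Omega> u x - gradient \<phi> x) < d"
      using u(2) d by (rule approximableE)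
    note t = vector_test_function_W1p[OF \<phi>(1)]
    have "N4 (gradient \<phi>) \<le> 8 * (d + N4 (weak_gradient \<Omega> u))"
    proof (rule order_trans[OF N4_le_split[OF t(3) W1p_D(2)[OF u(1)]]])
      show "8 * (N4 (\<lambda>x. gradient \<phi> x - weak_gradient \<Omega> u x) + N4 (weak_gradient \<Omega> u)) \<le> 8 * (d + N4 (weak_gradient \<Omega> u))"
        unfolding N4_commute[of "gradient \<phi>"] using \<phi>(3) by (intro mult_left_mono add_right_mono) auto
    qed
    then have CN: "C * N4 (gradient \<phi>) \<le> C * (8 * (d + N4 (weak_gradient \<Omega> u)))"
      using C(1) by (rule mult_left_mono)
    have aux: "p \<le> 8 * (d + t)" if "s \<le> t" "p \<le> 8 * (q + r)" "r \<le> s" "q < d" for p q r s t :: real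
      using that by (simp add: field_simps)
    have "N4 u \<le> 8 * (d + C * (8 * (d + N4 (weak_gradient \<Omega> u))))"
      by (rule aux[OF CN N4_le_split[OF W1p_D(1)[OF u(1)] t(2)] C(2)[OF \<phi>(1)] \<phi>(2)])
    also have "\<dots> = 64 * C * N4 (weak_gradient \<Omega> u) + (8 + 64 * C) * d" by (simp add: algebra_simps)
    finally show "N4 u \<le> 64 * C * N4 (weak_gradient \<Omega> u) + e" unfolding de .
  qed
  then show ?thesis using C(1) by (intro that[of "64 * C"]) auto
qed

section \<open>Positivity of the quadratic form on gradients\<close>

lemma two_well_form_integrable:
  assumes "Z \<in> L_p 4 \<Omega>"
  shows "integrable M (\<lambda>x. two_well_form A (Z x))"
proof (rule integrable_by_L4[OF assms, where c = "3 * (norm A)\<^sup>2"])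
  show "(\<lambda>x. two_well_form A (Z x)) \<in> borel_measurable M"
    using assms unfolding two_well_form_def L4_iff by auto
  fix x
  have "(norm (Z x))\<^sup>2 \<le> 1 + norm (Z x) ^ 4" by (rule power2_le_one_plus_power4)
  then have "3 * (norm A)\<^sup>2 * (norm (Z x))\<^sup>2 \<le> 3 * (norm A)\<^sup>2 * (1 + norm (Z x) ^ 4)"
    by (intro mult_left_mono) auto
  then show "norm (two_well_form A (Z x)) \<le> 3 * (norm A)\<^sup>2 * (1 + norm (Z x) ^ 4)"
    using abs_two_well_form_le[of A "Z x"] by simp
qed

text \<open>With \<open>D\<close> the gradient, exchanging derivatives replaces \<open>(A \<bullet> D)\<^sup>2\<close> under the integral by the
  inner product of \<open>D A\<^sup>T\<close> with its transpose. That is at most \<open>|D A\<^sup>T|\<^sup>2\<close>, which the assumption on \<open>A\<close>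
  bounds by half of \<open>|A|\<^sup>2 |D|\<^sup>2\<close>.\<close>

lemma two_well_form_test_nonneg:
  assumes A: "\<And>z. 2 * (norm (A *v z))\<^sup>2 \<le> (norm A)\<^sup>2 * (norm z)\<^sup>2"
    and \<phi>: "vector_test_function \<phi>"
  shows "0 \<le> (LINT x|M. two_well_form A (gradient \<phi> x))"
proof -
  let ?D = "gradient \<phi>"
  let ?B = "\<lambda>x. ?D x ** transpose A"
  define d where "d i j = partial_deriv j (\<lambda>x. \<phi> x $ i)" for i j
  have D: "?D x $ i $ j = d i j x" for x i j by (simp add: gradient_def d_def)
  have tf: "test_function \<Omega> (\<lambda>x. \<phi> x $ i)" for i using \<phi> by (rule spec)
  have dcont: "continuous_on UNIV (d i j)" for i j
    unfolding d_def by (rule test_function_continuous(2)[OF tf])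
  have dzero: "d i j x = 0" if "x \<notin> \<Omega>" for i j x
    unfolding d_def by (rule test_function_zero_outside(2)[OF tf that])
  obtain r where r: "0 < r" "\<Omega> \<subseteq> cball 0 r" by (rule domain_subset_cball)
  have out: "x \<notin> \<Omega>" if "r < norm x" for x using r that by (auto simp: subset_iff)
  have int: "integrable lborel (\<lambda>x. d i j x * d k l x)" for i j k l
  proof (rule integrable_continuous_bounded_support)
    show "continuous_on UNIV (\<lambda>x. d i j x * d k l x)" by (intro continuous_on_mult dcont)
    show "d i j x * d k l x = 0" if "r < norm x" for x using dzero[OF out[OF that]] by simp
  qed
  \<comment> \<open>Exchanging the derivatives \<open>j\<close> and \<open>l\<close> turns the square of \<open>A \<bullet> ?D\<close> into the trace of the
    square of \<open>?B\<close>.\<close>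
  have swap: "(LINT x|lborel. d i j x * d k l x) = (LINT x|lborel. d i l x * d k j x)" for i j k l
    unfolding d_def by (rule integral_partial_swap[OF test_function_C1_c[OF tf] test_function_C1_c[OF tf]])
  have e1: "(A \<bullet> ?D x)\<^sup>2 = (\<Sum>i\<in>UNIV. \<Sum>j\<in>UNIV. \<Sum>k\<in>UNIV. \<Sum>l\<in>UNIV. (A$i$j * A$k$l) * (d i j x * d k l x))" for x
  proof -
    have "A \<bullet> ?D x = (\<Sum>i\<in>UNIV. \<Sum>j\<in>UNIV. A$i$j * d i j x)" by (simp add: inner_vec_def D)
    then have "(A \<bullet> ?D x)\<^sup>2 = (\<Sum>i\<in>UNIV. \<Sum>k\<in>UNIV. (\<Sum>j\<in>UNIV. A$i$j * d i j x) * (\<Sum>l\<in>UNIV. A$k$l * d k l x))"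
      by (simp only: power2_eq_square sum_product[of "\<lambda>i. \<Sum>j\<in>UNIV. A$i$j * d i j x"])
    also have "\<dots> = (\<Sum>i\<in>UNIV. \<Sum>k\<in>UNIV. \<Sum>j\<in>UNIV. \<Sum>l\<in>UNIV. (A$i$j * A$k$l) * (d i j x * d k l x))"
      unfolding sum_product by (intro sum.cong refl) (simp only: mult_ac)
    also have "\<dots> = (\<Sum>i\<in>UNIV. \<Sum>j\<in>UNIV. \<Sum>k\<in>UNIV. \<Sum>l\<in>UNIV. (A$i$j * A$k$l) * (d i j x * d k l x))"
      by (rule sum.cong[OF refl sum.swap])
    finally show ?thesis .
  qed
  have e2: "?B x \<bullet> transpose (?B x) = (\<Sum>i\<in>UNIV. \<Sum>j\<in>UNIV. \<Sum>k\<in>UNIV. \<Sum>l\<in>UNIV. (A$i$j * A$k$l) * (d i l x * d k j x))" for x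
  proof -
    have "?B x \<bullet> transpose (?B x) = (\<Sum>i\<in>UNIV. \<Sum>k\<in>UNIV. (\<Sum>l\<in>UNIV. d i l x * A$k$l) * (\<Sum>j\<in>UNIV. d k j x * A$i$j))"
      by (simp add: inner_vec_def matrix_matrix_mult_def transpose_def D)
    also have "\<dots> = (\<Sum>i\<in>UNIV. \<Sum>k\<in>UNIV. \<Sum>j\<in>UNIV. \<Sum>l\<in>UNIV. (A$i$j * A$k$l) * (d i l x * d k j x))"
    proof (intro sum.cong refl)
      fix i k
      have "(\<Sum>l\<in>UNIV. d i l x * A$k$l) * (\<Sum>j\<in>UNIV. d k j x * A$i$j)
          = (\<Sum>j\<in>UNIV. d k j x * A$i$j) * (\<Sum>l\<in>UNIV. d i l x * A$k$l)" by (rule mult.commute)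
      also have "\<dots> = (\<Sum>j\<in>UNIV. \<Sum>l\<in>UNIV. (A$i$j * A$k$l) * (d i l x * d k j x))"
        unfolding sum_product by (intro sum.cong refl) (simp only: mult_ac)
      finally show "(\<Sum>l\<in>UNIV. d i l x * A$k$l) * (\<Sum>j\<in>UNIV. d k j x * A$i$j)
          = (\<Sum>j\<in>UNIV. \<Sum>l\<in>UNIV. (A$i$j * A$k$l) * (d i l x * d k j x))" .
    qed
    also have "\<dots> = (\<Sum>i\<in>UNIV. \<Sum>j\<in>UNIV. \<Sum>k\<in>UNIV. \<Sum>l\<in>UNIV. (A$i$j * A$k$l) * (d i l x * d k j x))"
      by (rule sum.cong[OF refl sum.swap])
    finally show ?thesis .
  qed
  have i1: "integrable lborel (\<lambda>x. (A \<bullet> ?D x)\<^sup>2)" and i2: "integrable lborel (\<lambda>x. ?B x \<bullet> transpose (?B x))"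
    unfolding e1 e2 by (intro Bochner_Integration.integrable_sum integrable_mult_right int)+
  have lin: "(LINT x|lborel. (\<Sum>i\<in>UNIV. \<Sum>j\<in>UNIV. \<Sum>k\<in>UNIV. \<Sum>l\<in>UNIV. (A$i$j * A$k$l) * F i j k l x))
      = (\<Sum>i\<in>UNIV. \<Sum>j\<in>UNIV. \<Sum>k\<in>UNIV. \<Sum>l\<in>UNIV. (A$i$j * A$k$l) * (LINT x|lborel. F i j k l x))"
    if F: "\<And>i j k l. integrable lborel (F i j k l)" for F :: "'n \<Rightarrow> 'n \<Rightarrow> 'n \<Rightarrow> 'n \<Rightarrow> real^'n \<Rightarrow> real"
  proof -
    note I = Bochner_Integration.integrable_sum integrable_mult_right F
    show ?thesis
      apply (subst Bochner_Integration.integral_sum, intro I)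
      apply (rule sum.cong[OF refl], subst Bochner_Integration.integral_sum, intro I)
      apply (rule sum.cong[OF refl], subst Bochner_Integration.integral_sum, intro I)
      apply (rule sum.cong[OF refl], subst Bochner_Integration.integral_sum, intro I)
      apply (rule sum.cong[OF refl], rule integral_mult_right_zero)
      done
  qed
  have eq: "(LINT x|lborel. (A \<bullet> ?D x)\<^sup>2) = (LINT x|lborel. ?B x \<bullet> transpose (?B x))"
  proof -
    have "(LINT x|lborel. (A \<bullet> ?D x)\<^sup>2) = (\<Sum>i\<in>UNIV. \<Sum>j\<in>UNIV. \<Sum>k\<in>UNIV. \<Sum>l\<in>UNIV. (A$i$j * A$k$l) * (LINT x|lborel. d i j x * d k l x))"
      unfolding e1 by (intro lin int)
    also have "\<dots> = (\<Sum>i\<in>UNIV. \<Sum>j\<in>UNIV. \<Sum>k\<in>UNIV. \<Sum>l\<in>UNIV. (A$i$j * A$k$l) * (LINT x|lborel. d i l x * d k j x))"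
      by (intro sum.cong refl arg_cong2[where f = "(*)"] swap)
    also have "\<dots> = (LINT x|lborel. ?B x \<bullet> transpose (?B x))"
      unfolding e2 by (intro lin[symmetric] int)
    finally show ?thesis .
  qed
  have n: "(norm (?D x))\<^sup>2 = (\<Sum>i\<in>UNIV. \<Sum>j\<in>UNIV. d i j x * d i j x)" for x
    by (simp add: power2_norm_eq_inner inner_vec_def D)
  have i3: "integrable lborel (\<lambda>x. (norm (?D x))\<^sup>2)"
    unfolding n by (intro Bochner_Integration.integrable_sum int)
  have "continuous_on UNIV (\<lambda>x. (norm A)\<^sup>2 * (norm (?D x))\<^sup>2 - 2 * (A \<bullet> ?D x)\<^sup>2)"
    unfolding n e1 by (intro continuous_intros dcont)
  then have "(LINT x|M. two_well_form A (?D x)) = (LINT x|lborel. two_well_form A (?D x))"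
    unfolding two_well_form_def using gradient_zero_outside[OF \<phi>]
    by (intro integral_domain_eq_lborel borel_measurable_continuous_onI) auto
  also have "\<dots> = (norm A)\<^sup>2 * (LINT x|lborel. (norm (?D x))\<^sup>2) - 2 * (LINT x|lborel. ?B x \<bullet> transpose (?B x))"
    unfolding two_well_form_def eq[symmetric] using i1 i3 by simp
  also have "\<dots> = (LINT x|lborel. (norm A)\<^sup>2 * (norm (?D x))\<^sup>2 - 2 * (?B x \<bullet> transpose (?B x)))"
    using i2 i3 by simp
  also have "\<dots> \<ge> 0"
  proof (rule Bochner_Integration.integral_nonneg)
    fix x
    have "?B x \<bullet> transpose (?B x) \<le> norm (?B x) * norm (transpose (?B x))" by (rule norm_cauchy_schwarz)
    also have "\<dots> = (norm (?B x))\<^sup>2" by (simp add: norm_transpose power2_eq_square)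
    also have "\<dots> \<le> ((norm A)\<^sup>2 / 2) * (norm (?D x))\<^sup>2"
      by (rule norm_matrix_mult_transpose_le) (use A in \<open>simp add: field_simps\<close>)
    finally show "0 \<le> (norm A)\<^sup>2 * (norm (?D x))\<^sup>2 - 2 * (?B x \<bullet> transpose (?B x))" by simp
  qed
  finally show ?thesis .
qed

text \<open>The form is continuous under perturbations of the gradient that are small in \<open>L\<^sup>4\<close>, so the inequality
  passes from test functions to their closure.\<close>

lemma two_well_form_W1p_0_nonneg:
  assumes A: "\<And>z. 2 * (norm (A *v z))\<^sup>2 \<le> (norm A)\<^sup>2 * (norm z)\<^sup>2"
    and u0: "u \<in> W1p_0 4 \<Omega>"
  shows "0 \<le> (LINT x|M. two_well_form A (weak_gradient \<Omega> u x))"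
proof (rule field_le_epsilon)
  fix e' :: real assume e': "0 < e'"
  note u = W1p_0_approximable[OF u0]
  let ?Z = "weak_gradient \<Omega> u"
  note Z = W1p_D(2)[OF u(1)]
  define m where "m = measure M (space M)"
  \<comment> \<open>The total error below is at most \<open>(s - 1) * e\<close>, hence at most \<open>e'\<close>.\<close>
  define s where "s = 3 * (norm A)\<^sup>2 * (2 * m + N4 ?Z + 1) + 1"
  have m: "0 \<le> m" by (simp add: m_def)
  have "0 \<le> 3 * (norm A)\<^sup>2 * (2 * m + N4 ?Z + 1)"
    using m N4_nonneg[of ?Z] by (intro mult_nonneg_nonneg) simp_all
  then have s: "0 < s" by (simp add: s_def)
  define e where "e = e' / s"
  have e: "0 < e" using e' s by (simp add: e_def)
  define c where "c = (1 + 1 / e)\<^sup>2 / e"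
  have c: "0 < c" using e unfolding c_def by (intro divide_pos_pos zero_less_power add_pos_pos) auto
  have "0 < e / c" using e c by simp
  with u(2) obtain \<phi> where
    \<phi>: "vector_test_function \<phi>" "N4 (\<lambda>x. u x - \<phi> x) < e / c" "N4 (\<lambda>x. ?Z x - gradient \<phi> x) < e / c"
    by (rule approximableE)
  let ?D = "\<lambda>x. ?Z x - gradient \<phi> x"
  note t = vector_test_function_W1p[OF \<phi>(1)]
  have D: "?D \<in> L_p 4 \<Omega>" by (rule L4_diff[OF Z t(3)])
  let ?k = "3 * (norm A)\<^sup>2"
  have "0 \<le> (LINT x|M. two_well_form A (gradient \<phi> x))"
    by (rule two_well_form_test_nonneg[OF A \<phi>(1)])
  also have "\<dots> \<le> (LINT x|M. two_well_form A (?Z x) + ?k * (e * (2 + norm (?Z x) ^ 4) + c * norm (?D x) ^ 4))"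
  proof (rule integral_mono)
    show "integrable M (\<lambda>x. two_well_form A (gradient \<phi> x))" by (rule two_well_form_integrable[OF t(3)])
    show "integrable M (\<lambda>x. two_well_form A (?Z x) + ?k * (e * (2 + norm (?Z x) ^ 4) + c * norm (?D x) ^ 4))"
      using two_well_form_integrable[OF Z] Z D unfolding L4_iff
      by (intro Bochner_Integration.integrable_add integrable_mult_right integrable_const) auto
    fix x
    have "two_well_form A (gradient \<phi> x) = two_well_form A (?Z x - ?D x)" by simp
    also have "\<dots> \<le> two_well_form A (?Z x) + ?k * (2 * (norm (?Z x) * norm (?D x)) + (norm (?D x))\<^sup>2)"
      using two_well_form_diff_le[of A "?Z x" "?D x"] by (simp add: algebra_simps)
    also have "\<dots> \<le> two_well_form A (?Z x) + ?k * (e * (2 + norm (?Z x) ^ 4) + c * norm (?D x) ^ 4)"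
      unfolding c_def by (intro add_left_mono mult_left_mono young_square e) auto
    finally show "two_well_form A (gradient \<phi> x) \<le> two_well_form A (?Z x) + ?k * (e * (2 + norm (?Z x) ^ 4) + c * norm (?D x) ^ 4)" .
  qed
  also have "\<dots> = (LINT x|M. two_well_form A (?Z x)) + ?k * (e * (2 * m + N4 ?Z) + c * N4 ?D)"
    using two_well_form_integrable[OF Z] Z D unfolding L4_iff N4_def m_def by (simp add: algebra_simps)
  also have "\<dots> \<le> (LINT x|M. two_well_form A (?Z x)) + ?k * (e * (2 * m + N4 ?Z) + e)"
    using \<phi>(3) c by (intro add_left_mono mult_left_mono) (auto simp: field_simps)
  also have "\<dots> = (LINT x|M. two_well_form A (?Z x)) + (s - 1) * e"
    by (simp add: s_def algebra_simps)
  also have "\<dots> \<le> (LINT x|M. two_well_form A (?Z x)) + e'"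
  proof -
    have "(s - 1) * e \<le> s * e" using e by (simp add: algebra_simps)
    also have "\<dots> = e'" using s by (simp add: e_def)
    finally show ?thesis by simp
  qed
  finally show "0 \<le> (LINT x|M. two_well_form A (?Z x)) + e'" .
qed

section \<open>Minimization of the two-well energy\<close>

lemma W1p_0_minus_boundary_lincomb:
  assumes y: "(\<lambda>x. y x - y0 x) \<in> W1p_0 4 \<Omega>" and z: "(\<lambda>x. z x - y0 x) \<in> W1p_0 4 \<Omega>"
  shows "(\<lambda>x. ((1/2) *\<^sub>R y x + (1/2) *\<^sub>R z x) - y0 x) \<in> W1p_0 4 \<Omega>"
    and "(\<lambda>x. (1/2) *\<^sub>R y x - (1/2) *\<^sub>R z x) \<in> W1p_0 4 \<Omega>"
proof -
  have 1: "(1/2) *\<^sub>R (y x - y0 x) + (1/2) *\<^sub>R (z x - y0 x) = ((1/2) *\<^sub>R y x + (1/2) *\<^sub>R z x) - y0 x" for x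
    by (simp add: algebra_simps flip: scaleR_add_left)
  have 2: "(1/2) *\<^sub>R (y x - y0 x) + (-1/2) *\<^sub>R (z x - y0 x) = (1/2) *\<^sub>R y x - (1/2) *\<^sub>R z x" for x
    by (simp add: algebra_simps)
  show "(\<lambda>x. ((1/2) *\<^sub>R y x + (1/2) *\<^sub>R z x) - y0 x) \<in> W1p_0 4 \<Omega>"
    using W1p_0_lincomb[OF y z, of "1/2" "1/2"] unfolding 1 .
  show "(\<lambda>x. (1/2) *\<^sub>R y x - (1/2) *\<^sub>R z x) \<in> W1p_0 4 \<Omega>"
    using W1p_0_lincomb[OF y z, of "1/2" "-1/2"] unfolding 2 .
qed

lemma two_well_energy_integrable:
  fixes G :: "real^'n \<Rightarrow> real^'n^'n"
  assumes G: "G \<in> L_p 4 \<Omega>"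
  shows "integrable M (\<lambda>x. (norm (G x - X1))\<^sup>2 * (norm (G x - X2))\<^sup>2)"
proof -
  have c: "(\<lambda>x. V) \<in> L_p 4 \<Omega>" for V :: "real^'n^'n" by (simp add: L4_iff)
  note d = L4_diff[OF G c]
  have m: "(\<lambda>x. (norm (G x - X1))\<^sup>2 * (norm (G x - X2))\<^sup>2) \<in> borel_measurable M"
    using G unfolding L4_iff by (elim conjE) simp
  have i: "integrable M (\<lambda>x. norm (G x - X1) ^ 4 + norm (G x - X2) ^ 4)"
    using d[of X1] d[of X2] unfolding L4_iff by (intro Bochner_Integration.integrable_add) (elim conjE, assumption)+
  show ?thesis
  proof (rule Bochner_Integration.integrable_bound[OF i m], rule AE_I2)
    fix x
    have "p\<^sup>2 * q\<^sup>2 \<le> p ^ 4 + q ^ 4" for p q :: real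
    proof -
      have "2 * (p\<^sup>2 * q\<^sup>2) \<le> p ^ 4 + q ^ 4"
        using zero_le_power2[of "p\<^sup>2 - q\<^sup>2"] by (simp add: power2_eq_square power4_eq_xxxx algebra_simps)
      moreover have "0 \<le> p\<^sup>2 * q\<^sup>2" by simp
      ultimately show ?thesis by linarith
    qed
    then show "norm ((norm (G x - X1))\<^sup>2 * (norm (G x - X2))\<^sup>2) \<le> norm (norm (G x - X1) ^ 4 + norm (G x - X2) ^ 4)"
      by simp
  qed
qed

text \<open>Uniform convexity of the energy on functions with the same boundary values: the pointwise
  inequality is integrated, and the quadratic defect drops out because it is evaluated at the
  gradient of an element of \<open>W\<^sup>1\<^sup>,\<^sup>4\<^sub>0\<close>.\<close>

lemma two_well_energy_midpoint:
  fixes X1 X2 :: "real^'n^'n"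
  defines "f \<equiv> \<lambda>X. (norm (X - X1))\<^sup>2 * (norm (X - X2))\<^sup>2"
  assumes cond: "\<And>z. 2 * (norm ((X1 - X2) *v z))\<^sup>2 \<le> (norm (X1 - X2))\<^sup>2 * (norm z)\<^sup>2"
    and y: "y \<in> W1p 4 \<Omega>" and z: "z \<in> W1p 4 \<Omega>"
    and u: "(\<lambda>x. (1/2) *\<^sub>R y x - (1/2) *\<^sub>R z x) \<in> W1p_0 4 \<Omega>"
  shows "(LINT x|M. f (weak_gradient \<Omega> (\<lambda>x. (1/2) *\<^sub>R y x + (1/2) *\<^sub>R z x) x))
      + N4 (weak_gradient \<Omega> (\<lambda>x. (1/2) *\<^sub>R y x - (1/2) *\<^sub>R z x))
    \<le> ((LINT x|M. f (weak_gradient \<Omega> y x)) + (LINT x|M. f (weak_gradient \<Omega> z x))) / 2"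
proof -
  let ?m = "weak_gradient \<Omega> (\<lambda>x. (1/2) *\<^sub>R y x + (1/2) *\<^sub>R z x)"
  let ?u = "weak_gradient \<Omega> (\<lambda>x. (1/2) *\<^sub>R y x - (1/2) *\<^sub>R z x)"
  let ?A = "(1/2) *\<^sub>R (X1 - X2)"
  have fi: "integrable M (\<lambda>x. f (G x))" if "G \<in> L_p 4 \<Omega>" for G
    unfolding f_def by (rule two_well_energy_integrable[OF that])
  note mW = W1p_lincomb[OF y z, of "1/2" "1/2"]
  have uW: "(\<lambda>x. (1/2) *\<^sub>R y x - (1/2) *\<^sub>R z x) \<in> W1p 4 \<Omega>"
    using u by (rule W1p_0_approximable(1))
  have ugrad: "AE x in M. (1/2) *\<^sub>R weak_gradient \<Omega> y x - (1/2) *\<^sub>R weak_gradient \<Omega> z x = ?u x"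
    using W1p_lincomb(2)[OF y z, of "1/2" "-1/2"] by simp
  note im = fi[OF W1p_D(2)[OF mW(1)]] and iy = fi[OF W1p_D(2)[OF y]] and iz = fi[OF W1p_D(2)[OF z]]
  have iu: "integrable M (\<lambda>x. norm (?u x) ^ 4)" using W1p_D(2)[OF uW] unfolding L4_iff by (rule conjunct2)
  note iq = two_well_form_integrable[OF W1p_D(2)[OF uW], of ?A]
  have "2 * (norm (?A *v v))\<^sup>2 \<le> (norm ?A)\<^sup>2 * (norm v)\<^sup>2" for v
  proof -
    have "?A *v v = (1/2) *\<^sub>R ((X1 - X2) *v v)" by (simp add: scaleR_matrix_vector_assoc)
    then have a: "(norm (?A *v v))\<^sup>2 = (norm ((X1 - X2) *v v))\<^sup>2 / 4" by (simp add: power_divide)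
    have b: "(norm ?A)\<^sup>2 = (norm (X1 - X2))\<^sup>2 / 4" by (simp add: power_divide)
    show ?thesis unfolding a b using cond[of v] by simp
  qed
  then have q: "0 \<le> (LINT x|M. two_well_form ?A (?u x))"
    by (rule two_well_form_W1p_0_nonneg[OF _ u])
  have "(LINT x|M. f (?m x) + norm (?u x) ^ 4 + 2 * two_well_form ?A (?u x))
     \<le> (LINT x|M. (f (weak_gradient \<Omega> y x) + f (weak_gradient \<Omega> z x)) / 2)"
  proof (rule integral_mono_AE)
    show "integrable M (\<lambda>x. f (?m x) + norm (?u x) ^ 4 + 2 * two_well_form ?A (?u x))"
      by (intro Bochner_Integration.integrable_add integrable_mult_right im iu iq)
    show "integrable M (\<lambda>x. (f (weak_gradient \<Omega> y x) + f (weak_gradient \<Omega> z x)) / 2)"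
      by (intro Bochner_Integration.integrable_add integrable_divide iy iz)
    show "AE x in M. f (?m x) + norm (?u x) ^ 4 + 2 * two_well_form ?A (?u x)
        \<le> (f (weak_gradient \<Omega> y x) + f (weak_gradient \<Omega> z x)) / 2"
      using mW(2) ugrad
    proof eventually_elim
      case (elim x)
      show ?case unfolding elim[symmetric] f_def by (rule two_well_uniform_convexity)
    qed
  qed
  also have "(LINT x|M. f (?m x) + norm (?u x) ^ 4 + 2 * two_well_form ?A (?u x))
      = (LINT x|M. f (?m x)) + N4 ?u + 2 * (LINT x|M. two_well_form ?A (?u x))"
    unfolding N4_def using im iu iq by simp
  also have "(LINT x|M. (f (weak_gradient \<Omega> y x) + f (weak_gradient \<Omega> z x)) / 2)
      = ((LINT x|M. f (weak_gradient \<Omega> y x)) + (LINT x|M. f (weak_gradient \<Omega> z x))) / 2"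
    using iy iz by simp
  finally show ?thesis using q by linarith
qed

text \<open>Fatou's lemma.\<close>

lemma two_well_energy_lower_semicontinuous:
  fixes f :: "real^'n^'n \<Rightarrow> real"
  assumes f: "continuous_on UNIV f" "\<And>X. 0 \<le> f X"
    and int: "\<And>k::nat. integrable M (\<lambda>x. f (G k x))" "integrable M (\<lambda>x. f (H x))"
    and ae: "AE x in M. (\<lambda>k. G k x) \<longlonglongrightarrow> H x"
    and lim: "(\<lambda>k. LINT x|M. f (G k x)) \<longlonglongrightarrow> c"
  shows "(LINT x|M. f (H x)) \<le> c"
proof -
  have "ennreal (LINT x|M. f (H x)) = (\<integral>\<^sup>+x. ennreal (f (H x)) \<partial>M)"
    using int(2) f(2) by (intro nn_integral_eq_integral[symmetric]) auto
  also have "\<dots> = (\<integral>\<^sup>+x. liminf (\<lambda>k. ennreal (f (G k x))) \<partial>M)"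
  proof (rule nn_integral_cong_AE, use ae in eventually_elim)
    fix x assume "(\<lambda>k. G k x) \<longlonglongrightarrow> H x"
    then have "(\<lambda>k. f (G k x)) \<longlonglongrightarrow> f (H x)"
      using f(1) by (intro isCont_tendsto_compose[of "H x" f]) (simp_all add: continuous_on_eq_continuous_at)
    then have "(\<lambda>k. ennreal (f (G k x))) \<longlonglongrightarrow> ennreal (f (H x))" by (rule tendsto_ennrealI)
    then show "ennreal (f (H x)) = liminf (\<lambda>k. ennreal (f (G k x)))"
      by (rule lim_imp_Liminf[OF sequentially_bot, symmetric])
  qed
  also have "\<dots> \<le> liminf (\<lambda>k. \<integral>\<^sup>+x. ennreal (f (G k x)) \<partial>M)"
    by (intro nn_integral_liminf measurable_compose[OF borel_measurable_integrable[OF int(1)] measurable_ennreal])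
  also have "(\<lambda>k. \<integral>\<^sup>+x. ennreal (f (G k x)) \<partial>M) = (\<lambda>k. ennreal (LINT x|M. f (G k x)))"
    using int(1) f(2) by (intro ext nn_integral_eq_integral) auto
  also have "liminf \<dots> = ennreal c"
    by (rule lim_imp_Liminf[OF sequentially_bot tendsto_ennrealI[OF lim]])
  finally have "ennreal (LINT x|M. f (H x)) \<le> ennreal c" .
  moreover have "0 \<le> c"
    using lim f(2) by (intro tendsto_lowerbound[OF lim]) auto
  ultimately show ?thesis by (simp add: ennreal_le_iff)
qed

text \<open>By uniform convexity a minimizing sequence is Cauchy in its gradients, and by the Poincare inequality
  also in its values. Its strong limit is admissible and, by lower semicontinuity, minimal; the
  same inequality for two minimizers gives uniqueness.\<close>

lemma two_well_unique_minimizer: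
  fixes X1 X2 :: "real^'n^'n" and I :: "(real^'n \<Rightarrow> real^'n) \<Rightarrow> real"
  defines "f \<equiv> \<lambda>X. (norm (X - X1))\<^sup>2 * (norm (X - X2))\<^sup>2"
  assumes cond: "\<And>z. 2 * (norm ((X1 - X2) *v z))\<^sup>2 \<le> (norm (X1 - X2))\<^sup>2 * (norm z)\<^sup>2"
    and y0: "y0 \<in> W1p 4 \<Omega>"
    and I: "\<And>y. y \<in> W1p 4 \<Omega> \<Longrightarrow> I y = (LINT x|M. f (weak_gradient \<Omega> y x))"
    and adm: "adm = {y \<in> W1p 4 \<Omega>. (\<lambda>x. y x - y0 x) \<in> W1p_0 4 \<Omega>}"
  shows "\<exists>y. is_minimizer_on I adm y \<and> (\<forall>z. is_minimizer_on I adm z \<longrightarrow> (AE x in M. z x = y x))"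
proof -
  obtain C where C: "0 \<le> C" "\<And>u. u \<in> W1p_0 4 \<Omega> \<Longrightarrow> N4 u \<le> C * N4 (weak_gradient \<Omega> u)"
    by (rule poincare_W1p_0) (rule that)
  have I0: "0 \<le> I y" if "y \<in> adm" for y
    using that by (simp add: adm I f_def)
  define J where "J = Inf (I ` adm)"
  have bdd: "bdd_below (I ` adm)" using I0 by (auto intro!: bdd_belowI[of _ 0])
  have y0a: "y0 \<in> adm" using y0 zero_W1p_0 by (simp add: adm)
  have J: "J \<le> I y" if "y \<in> adm" for y unfolding J_def using bdd that by (intro cInf_lower) auto
  \<comment> \<open>Midpoints are admissible, so the energy gap controls the distance of two admissible functions;
    the factor \<open>16 = 2 ^ 4\<close> undoes the scaling by \<open>1 / 2\<close>.\<close>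
  have close: "N4 (\<lambda>x. weak_gradient \<Omega> z x - weak_gradient \<Omega> y x) \<le> 16 * ((I y + I z) / 2 - J)"
    "N4 (\<lambda>x. z x - y x) \<le> C * (16 * ((I y + I z) / 2 - J))"
    if y: "y \<in> adm" and z: "z \<in> adm" for y z
  proof -
    have W: "y \<in> W1p 4 \<Omega>" "z \<in> W1p 4 \<Omega>" and W0: "(\<lambda>x. y x - y0 x) \<in> W1p_0 4 \<Omega>" "(\<lambda>x. z x - y0 x) \<in> W1p_0 4 \<Omega>"
      using y z by (simp_all add: adm)
    let ?m = "\<lambda>x. (1/2) *\<^sub>R z x + (1/2) *\<^sub>R y x" and ?u = "\<lambda>x. (1/2) *\<^sub>R z x - (1/2) *\<^sub>R y x"
    note l = W1p_0_minus_boundary_lincomb[OF W0(2) W0(1)]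
    have mW: "?m \<in> W1p 4 \<Omega>" by (rule W1p_lincomb(1)[OF W(2) W(1)])
    then have "?m \<in> adm" using l(1) by (simp add: adm)
    then have Jm: "J \<le> I ?m" by (rule J)
    have "I ?m + N4 (weak_gradient \<Omega> ?u) \<le> (I z + I y) / 2"
      unfolding I[OF mW] I[OF W(1)] I[OF W(2)] f_def
      by (rule two_well_energy_midpoint[OF cond W(2) W(1) l(2)])
    also have "(I z + I y) / 2 = (I y + I z) / 2" by simp
    finally have gu: "N4 (weak_gradient \<Omega> ?u) \<le> (I y + I z) / 2 - J" using Jm by linarith
    have uW: "?u \<in> W1p 4 \<Omega>" by (rule W1p_0_approximable(1)[OF l(2)])
    have half: "N4 (\<lambda>x. (1/2) *\<^sub>R g x - (1/2) *\<^sub>R h x) = N4 (\<lambda>x. g x - h x) / 16" for g h :: "real^'n \<Rightarrow> 'c::euclidean_space"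
      by (simp add: N4_def power_divide flip: scaleR_diff_right)
    have "N4 (weak_gradient \<Omega> ?u) = N4 (\<lambda>x. (1/2) *\<^sub>R weak_gradient \<Omega> z x - (1/2) *\<^sub>R weak_gradient \<Omega> y x)"
    proof (rule N4_cong_AE)
      show "AE x in M. weak_gradient \<Omega> ?u x = (1/2) *\<^sub>R weak_gradient \<Omega> z x - (1/2) *\<^sub>R weak_gradient \<Omega> y x"
        using W1p_lincomb(2)[OF W(2) W(1), of "1/2" "-1/2"] by (auto elim: eventually_mono)
      show "weak_gradient \<Omega> ?u \<in> borel_measurable M"
        using W1p_D(2)[OF uW] unfolding L4_iff by (rule conjunct1)
      show "(\<lambda>x. (1/2) *\<^sub>R weak_gradient \<Omega> z x - (1/2) *\<^sub>R weak_gradient \<Omega> y x) \<in> borel_measurable M"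
        using L4_lincomb(1)[OF W1p_D(2)[OF W(2)] W1p_D(2)[OF W(1)], of "1/2" "-1/2"] unfolding L4_iff by simp
    qed
    then have hg: "N4 (weak_gradient \<Omega> ?u) = N4 (\<lambda>x. weak_gradient \<Omega> z x - weak_gradient \<Omega> y x) / 16"
      unfolding half .
    show "N4 (\<lambda>x. weak_gradient \<Omega> z x - weak_gradient \<Omega> y x) \<le> 16 * ((I y + I z) / 2 - J)"
    proof -
      have "N4 (\<lambda>x. weak_gradient \<Omega> z x - weak_gradient \<Omega> y x) = 16 * N4 (weak_gradient \<Omega> ?u)"
        unfolding hg by simp
      also have "\<dots> \<le> 16 * ((I y + I z) / 2 - J)" using gu by (rule mult_left_mono) simp
      finally show ?thesis .
    qed
    have "N4 (\<lambda>x. z x - y x) = 16 * N4 ?u" unfolding half by simp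
    also have "\<dots> \<le> 16 * (C * N4 (weak_gradient \<Omega> ?u))" using C(2)[OF l(2)] by simp
    also have "\<dots> \<le> 16 * (C * ((I y + I z) / 2 - J))" using gu C(1) by (intro mult_left_mono) auto
    finally show "N4 (\<lambda>x. z x - y x) \<le> C * (16 * ((I y + I z) / 2 - J))" by (simp add: mult_ac)
  qed
  \<comment> \<open>A minimizing sequence with energy gap \<open>4 ^ (- k)\<close> is Cauchy at that rate.\<close>
  have "\<exists>y\<in>adm. I y < J + (1/4) ^ k" for k
  proof -
    have "Inf (I ` adm) < J + (1/4) ^ k" by (simp add: J_def)
    then show ?thesis using y0a bdd by (subst (asm) cInf_less_iff) auto
  qed
  then obtain y where y: "\<And>k. y k \<in> adm" "\<And>k. I (y k) < J + (1/4) ^ k" by metis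
  have gap: "(I (y k) + I (y l)) / 2 - J \<le> (1/4) ^ k" if "k \<le> l" for k l
  proof -
    have "(1/4 :: real) ^ l \<le> (1/4) ^ k" using that by (intro power_decreasing) auto
    then have "I (y k) \<le> J + (1/4) ^ k" "I (y l) \<le> J + (1/4) ^ k"
      using y(2)[of k] y(2)[of l] by linarith+
    moreover have "(a + b) / 2 - J \<le> q" if "a \<le> J + q" "b \<le> J + q" for a b q
      using that by (simp add: field_simps)
    ultimately show ?thesis by simp
  qed
  have yW: "y k \<in> W1p 4 \<Omega>" and yW0: "(\<lambda>x. y k x - y0 x) \<in> W1p_0 4 \<Omega>" for k
    using y(1)[of k] by (simp_all add: adm)
  have c1: "N4 (\<lambda>x. y l x - y k x) \<le> (C * 16) * (1/4) ^ k" if "k \<le> l" for k l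
  proof -
    have "C * (16 * ((I (y k) + I (y l)) / 2 - J)) \<le> C * (16 * (1/4) ^ k)"
      using gap[OF that] C(1) by (intro mult_left_mono) auto
    then show ?thesis using close(2)[OF y(1) y(1), of l k] by (simp add: mult.assoc)
  qed
  have c2: "N4 (\<lambda>x. weak_gradient \<Omega> (y l) x - weak_gradient \<Omega> (y k) x) \<le> 16 * (1/4) ^ k" if "k \<le> l" for k l
  proof -
    have "16 * ((I (y k) + I (y l)) / 2 - J) \<le> 16 * (1/4) ^ k"
      using gap[OF that] by (intro mult_left_mono) auto
    then show ?thesis using close(1)[OF y(1) y(1), of l k] by (rule order_trans[rotated])
  qed
  obtain z where z: "z \<in> W1p 4 \<Omega>" "(\<lambda>k. N4 (\<lambda>x. z x - y k x)) \<longlonglongrightarrow> 0"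
    "(\<lambda>k. N4 (\<lambda>x. weak_gradient \<Omega> z x - weak_gradient \<Omega> (y k) x)) \<longlonglongrightarrow> 0"
    "AE x in M. (\<lambda>k. weak_gradient \<Omega> (y k) x) \<longlonglongrightarrow> weak_gradient \<Omega> z x"
    by (rule W1p_limit[OF yW c1 c2]) (assumption, assumption, rule that)
  have "(\<lambda>x. z x - y0 x) \<in> W1p_0 4 \<Omega>"
  proof (rule W1p_0_closed[OF W1p_diff(1)[OF z(1) y0] yW0])
    show "(\<lambda>k. N4 (\<lambda>x. (z x - y0 x) - (y k x - y0 x))) \<longlonglongrightarrow> 0" using z(2) by simp
    have "N4 (\<lambda>x. weak_gradient \<Omega> (\<lambda>x. z x - y0 x) x - weak_gradient \<Omega> (\<lambda>x. y k x - y0 x) x)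
        = N4 (\<lambda>x. weak_gradient \<Omega> z x - weak_gradient \<Omega> (y k) x)" for k
    proof (rule N4_cong_AE)
      show "AE x in M. weak_gradient \<Omega> (\<lambda>x. z x - y0 x) x - weak_gradient \<Omega> (\<lambda>x. y k x - y0 x) x
          = weak_gradient \<Omega> z x - weak_gradient \<Omega> (y k) x"
        using W1p_diff(2)[OF z(1) y0] W1p_diff(2)[OF yW y0, of k]
      proof eventually_elim
        case (elim x)
        show ?case unfolding elim[symmetric] by simp
      qed
      show "(\<lambda>x. weak_gradient \<Omega> (\<lambda>x. z x - y0 x) x - weak_gradient \<Omega> (\<lambda>x. y k x - y0 x) x) \<in> borel_measurable M"
        using L4_diff[OF W1p_D(2)[OF W1p_diff(1)[OF z(1) y0]] W1p_D(2)[OF W1p_diff(1)[OF yW y0]]] unfolding L4_iff by (rule conjunct1)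
      show "(\<lambda>x. weak_gradient \<Omega> z x - weak_gradient \<Omega> (y k) x) \<in> borel_measurable M"
        using L4_diff[OF W1p_D(2)[OF z(1)] W1p_D(2)[OF yW]] unfolding L4_iff by (rule conjunct1)
    qed
    then show "(\<lambda>k. N4 (\<lambda>x. weak_gradient \<Omega> (\<lambda>x. z x - y0 x) x - weak_gradient \<Omega> (\<lambda>x. y k x - y0 x) x)) \<longlonglongrightarrow> 0"
      using z(3) by simp
  qed
  then have za: "z \<in> adm" using z(1) by (simp add: adm)
  have "(\<lambda>k. I (y k)) \<longlonglongrightarrow> J"
  proof (rule tendsto_sandwich)
    show "\<forall>\<^sub>F k in sequentially. J \<le> I (y k)" by (intro always_eventually allI J y(1))
    show "\<forall>\<^sub>F k in sequentially. I (y k) \<le> J + 1 * (1/4) ^ k"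
      using y(2) by (intro always_eventually allI) (simp add: less_imp_le)
    show "(\<lambda>k. J) \<longlonglongrightarrow> J" by (rule tendsto_const)
    show "(\<lambda>k. J + 1 * (1/4) ^ k) \<longlonglongrightarrow> J"
      using tendsto_add[OF tendsto_const[of J] geometric_tendsto_zero[of 1]] by simp
  qed
  then have "(\<lambda>k. LINT x|M. f (weak_gradient \<Omega> (y k) x)) \<longlonglongrightarrow> J"
    unfolding I[OF yW] .
  then have "(LINT x|M. f (weak_gradient \<Omega> z x)) \<le> J"
  proof (rule two_well_energy_lower_semicontinuous[rotated -1])
    show "continuous_on UNIV f" unfolding f_def by (intro continuous_intros)
    show "integrable M (\<lambda>x. f (weak_gradient \<Omega> (y k) x))" for k
      unfolding f_def by (rule two_well_energy_integrable[OF W1p_D(2)[OF yW]])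
    show "integrable M (\<lambda>x. f (weak_gradient \<Omega> z x))"
      unfolding f_def by (rule two_well_energy_integrable[OF W1p_D(2)[OF z(1)]])
  qed (use z(4) in \<open>simp_all add: f_def\<close>)
  then have IzJ: "I z \<le> J" using I[OF z(1)] by simp
  then have min: "is_minimizer_on I adm z"
    using za J by (auto simp: is_minimizer_on_def intro: order_trans)
  have "AE x in M. w x = z x" if w: "is_minimizer_on I adm w" for w
  proof -
    have wa: "w \<in> adm" and "I w \<le> I z" using w za by (auto simp: is_minimizer_on_def)
    then have "(I z + I w) / 2 - J \<le> 0" using IzJ by simp
    then have "C * (16 * ((I z + I w) / 2 - J)) \<le> 0" using C(1) by (intro mult_nonneg_nonpos) auto
    then have "N4 (\<lambda>x. w x - z x) \<le> 0" using close(2)[OF za wa] by linarith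
    moreover have "(\<lambda>x. w x - z x) \<in> L_p 4 \<Omega>"
      using wa z(1) by (intro L4_diff W1p_D(1)) (simp_all add: adm)
    ultimately have "AE x in M. w x - z x = 0" by (intro N4_eq_0_imp_AE)
    then show ?thesis by eventually_elim simp
  qed
  then show ?thesis using min by blast
qed

end

theorem theorem2:
  fixes \<Omega> :: "(real^'n) set"
    and X1 X2 :: "real^'n^'n"
    and f :: "real^'n^'n \<Rightarrow> real"
    and \<sigma> :: "nat \<Rightarrow> real"
    and y0 :: "real^'n \<Rightarrow> real^'n"
    and I :: "(real^'n \<Rightarrow> real^'n) \<Rightarrow> real"
    and admissible :: "(real^'n \<Rightarrow> real^'n) set"
  assumes "CARD('n) \<ge> 2"
    and "open \<Omega>" and "bounded \<Omega>" and "lipschitz_boundary \<Omega>"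
    and f_eq: "\<And>X. f X = frobenius_sq (X - X1) * frobenius_sq (X - X2)"
    and "are_singular_values (X1 - X2) \<sigma>"
    and "(\<Sum>i=1..CARD('n). (\<sigma> i)\<^sup>2) \<ge> 2 * (\<sigma> 1)\<^sup>2"
    and "y0 \<in> W1p 4 \<Omega>"
    and I_eq: "\<And>y. y \<in> W1p 4 \<Omega> \<Longrightarrow> I y = (LINT x|lebesgue_on \<Omega>. f (weak_gradient \<Omega> y x))"
    and admissible_eq: "admissible = {y \<in> W1p 4 \<Omega>. (\<lambda>x. y x - y0 x) \<in> W1p_0 4 \<Omega>}"
  shows "\<exists>y. is_minimizer_on I admissible y \<and>
           (\<forall>z. is_minimizer_on I admissible z \<longrightarrow> (AE x in lebesgue_on \<Omega>. z x = y x))"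
proof -
  interpret bounded_open_set \<Omega> using assms(2,3) by unfold_locales
  show ?thesis
  proof (rule two_well_unique_minimizer[OF _ assms(8) _ admissible_eq])
    show "2 * (norm ((X1 - X2) *v z))\<^sup>2 \<le> (norm (X1 - X2))\<^sup>2 * (norm z)\<^sup>2" for z
      by (rule singular_values_imp_well_condition[OF assms(6,7)])
    show "I y = (LINT x|lebesgue_on \<Omega>. (norm (weak_gradient \<Omega> y x - X1))\<^sup>2 * (norm (weak_gradient \<Omega> y x - X2))\<^sup>2)"
      if "y \<in> W1p 4 \<Omega>" for y
      using I_eq[OF that] unfolding f_eq frobenius_sq_eq_norm .
  qed
qed

end
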